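(* Let $n\ge 7$ be an integer and let $l$ be a real number with $2\le l<\frac n2-1$. Suppose $(u_0,u_1)\in (H^{l+1}(\mathbf{R}^n)\cap L^{1,1}(\mathbf{R}^n))\times(H^{l}(\mathbf{R}^n)\cap L^{1,1}(\mathbf{R}^n))$, and let $u\in X_2$ be the solution of the Cauchy problem $$u_{tt}-\Delta u_{tt}+\Delta^2u-\Delta u+u_t=0 \ \text{ in } (0,\infty)\times\mathbf{R}^n,\qquad u(0,x)=u_0(x),\quad u_t(0,x)=u_1(x).$$ Then $$\|u(t,\cdot)\|_2\le C I_0\, t^{-\frac{l+1}{2}}\qquad (t\ge 1),$$ where $C>0$ is a constant independent of $t$ and of $u_0,u_1$.
   Context: The Fourier transform (in $x$) is $\hat f(\xi)=\int_{\mathbf{R}^n}f(x)e^{-i\xi\cdot x}\,dx$. $\|\cdot\|_p$ is the $L^p(\mathbf{R}^n)$ norm. For real $l\ge 0$, $\|f\|_{H^l}=\left(\int_{\mathbf{R}^n}(1+|\xi|^2)^l|\hat f(\xi)|^2d\xi\right)^{1/2}$. $L^{1,1}(\mathbf{R}^n)$ is the set of $f\in L^1(\mathbf{R}^n)$ with $\|f\|_{1,1}:=\int_{\mathbf{R}^n}(1+|x|)|f(x)|dx<\infty$. The solution class is $X_2:=C^2([0,\infty);H^1(\mathbf{R}^n))\cap C^1([0,\infty);H^2(\mathbf{R}^n))\cap C([0,\infty);H^3(\mathbf{R}^n))$. It is known that for $(u_0,u_1)\in H^3(\mathbf{R}^n)\times H^2(\mathbf{R}^n)$ the Cauchy problem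 has a unique solution in $X_2$. Put $I_0:=\|u_1\|_{H^l}+\|u_0\|_{H^{l+1}}+\|u_1\|_{1,1}+\|u_0\|_{1,1}$. *)

theory Defs
  imports "HOL-Analysis.Analysis"
begin

text \<open>
  Elements of the function spaces below are represented by Borel measurable functions
  \<open>real ^ 'n \<Rightarrow> complex\<close>; equality of elements is equality almost everywhere.
\<close>

definition L2 :: "(real ^ 'n \<Rightarrow> complex) set" where
  "L2 = {f. f \<in> borel_measurable lborel \<and> integrable lborel (\<lambda>x. (cmod (f x))\<^sup>2)}"

definition L2_norm :: "(real ^ 'n \<Rightarrow> complex) \<Rightarrow> real" where
  "L2_norm f = sqrt (LINT x|lborel. (cmod (f x))\<^sup>2)"

definition L11 :: "(real ^ 'n \<Rightarrow> complex) set" where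
  "L11 = {f. integrable lborel f \<and> integrable lborel (\<lambda>x. (1 + norm x) * cmod (f x))}"

definition L11_norm :: "(real ^ 'n \<Rightarrow> complex) \<Rightarrow> real" where
  "L11_norm f = (LINT x|lborel. (1 + norm x) * cmod (f x))"

definition fourier :: "(real ^ 'n \<Rightarrow> complex) \<Rightarrow> real ^ 'n \<Rightarrow> complex" where
  "fourier f \<xi> = (LINT x|lborel. f x * exp (- \<i> * complex_of_real (\<xi> \<bullet> x)))"

text \<open>
  On \<open>L2\<close> the integral need not converge. There the Fourier transform is the limit in \<open>L2\<close>, as
  \<open>R \<rightarrow> \<infinity>\<close>, of the integrals over the balls of radius \<open>R\<close>. The limit exists by Plancherel's
  theorem and is unique up to null sets; \<open>fourier_L2\<close> picks one representative.
\<close>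

definition has_fourier_L2 :: "(real ^ 'n \<Rightarrow> complex) \<Rightarrow> (real ^ 'n \<Rightarrow> complex) \<Rightarrow> bool" where
  "has_fourier_L2 f g \<longleftrightarrow> g \<in> L2 \<and>
     ((\<lambda>R::real. \<integral>\<^sup>+ \<xi>. ennreal ((cmod (fourier (\<lambda>x. indicator (cball 0 R) x * f x) \<xi> - g \<xi>))\<^sup>2)
        \<partial>lborel) \<longlongrightarrow> 0) at_top"

definition fourier_L2 :: "(real ^ 'n \<Rightarrow> complex) \<Rightarrow> real ^ 'n \<Rightarrow> complex" where
  "fourier_L2 f = (SOME g. has_fourier_L2 f g)"

text \<open>The spaces \<open>H\<^sup>s\<close>; the definition is meant for orders \<open>s \<ge> 0\<close>, for which they lie in \<open>L2\<close>.\<close>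

definition Hs :: "real \<Rightarrow> (real ^ 'n \<Rightarrow> complex) set" where
  "Hs s = {f \<in> L2. integrable lborel (\<lambda>\<xi>. (1 + (norm \<xi>)\<^sup>2) powr s * (cmod (fourier_L2 f \<xi>))\<^sup>2)}"

definition Hs_norm :: "real \<Rightarrow> (real ^ 'n \<Rightarrow> complex) \<Rightarrow> real" where
  "Hs_norm s f = sqrt (LINT \<xi>|lborel. (1 + (norm \<xi>)\<^sup>2) powr s * (cmod (fourier_L2 f \<xi>))\<^sup>2)"

definition Hs_continuous :: "real \<Rightarrow> (real \<Rightarrow> real ^ 'n \<Rightarrow> complex) \<Rightarrow> bool" where
  "Hs_continuous s u \<longleftrightarrow> (\<forall>t\<ge>0. u t \<in> Hs s) \<and>
     (\<forall>t\<ge>0. ((\<lambda>r. Hs_norm s (\<lambda>x. u r x - u t x)) \<longlongrightarrow> 0) (at t within {0..}))"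

definition Hs_has_deriv ::
  "real \<Rightarrow> (real \<Rightarrow> real ^ 'n \<Rightarrow> complex) \<Rightarrow> (real \<Rightarrow> real ^ 'n \<Rightarrow> complex) \<Rightarrow> bool" where
  "Hs_has_deriv s u v \<longleftrightarrow> (\<forall>t\<ge>0. u t \<in> Hs s \<and> v t \<in> Hs s) \<and>
     (\<forall>t\<ge>0. ((\<lambda>r. Hs_norm s (\<lambda>x. (u r x - u t x) /\<^sub>R (r - t) - v t x)) \<longlongrightarrow> 0)
        (at t within {0..}))"

primrec Ck_Hs :: "nat \<Rightarrow> real \<Rightarrow> (real \<Rightarrow> real ^ 'n \<Rightarrow> complex) set" where
  "Ck_Hs 0 s = {u. Hs_continuous s u}"
| "Ck_Hs (Suc k) s = {u. \<exists>v. Hs_has_deriv s u v \<and> v \<in> Ck_Hs k s}"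

definition X2 :: "(real \<Rightarrow> real ^ 'n \<Rightarrow> complex) set" where
  "X2 = Ck_Hs 2 1 \<inter> Ck_Hs 1 2 \<inter> Ck_Hs 0 3"

definition partial_deriv :: "'n \<Rightarrow> (real ^ 'n \<Rightarrow> complex) \<Rightarrow> real ^ 'n \<Rightarrow> complex" where
  "partial_deriv i f x = frechet_derivative f (at x) (axis i 1)"

definition laplacian :: "(real ^ 'n \<Rightarrow> complex) \<Rightarrow> real ^ 'n \<Rightarrow> complex" where
  "laplacian f x = (\<Sum>i\<in>UNIV. partial_deriv i (partial_deriv i f) x)"

definition iter_deriv :: "'n list \<Rightarrow> (real ^ 'n \<Rightarrow> complex) \<Rightarrow> real ^ 'n \<Rightarrow> complex" where
  "iter_deriv is f = foldr partial_deriv is f"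

definition schwartz :: "(real ^ 'n \<Rightarrow> complex) set" where
  "schwartz = {\<phi>. \<forall>is. (\<forall>x. iter_deriv is \<phi> differentiable (at x)) \<and>
     (\<forall>k::nat. bounded (range (\<lambda>x. (1 + norm x) ^ k *\<^sub>R iter_deriv is \<phi> x)))}"

text \<open>
  For \<open>u \<in> X2\<close> and each \<open>t\<close>, the terms \<open>\<Delta>u\<^sub>t\<^sub>t\<close> and \<open>\<Delta>\<^sup>2u\<close> lie in \<open>H\<^sup>-\<^sup>1\<close> and are in general not
  functions. The equation is therefore read, for every \<open>t > 0\<close>, as an identity of tempered
  distributions in \<open>x\<close>. Below \<open>v\<close> is \<open>u\<^sub>t\<close> and \<open>w\<close> is \<open>u\<^sub>t\<^sub>t\<close>; a derivative in \<open>H\<^sup>2\<close> is also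
  a derivative in \<open>H\<^sup>1\<close>, so \<open>v\<close> agrees with the \<open>H\<^sup>2\<close> derivative provided by \<open>X2\<close>.
\<close>

definition solves_cauchy ::
  "(real ^ 'n \<Rightarrow> complex) \<Rightarrow> (real ^ 'n \<Rightarrow> complex) \<Rightarrow> (real \<Rightarrow> real ^ 'n \<Rightarrow> complex) \<Rightarrow> bool" where
  "solves_cauchy u0 u1 u \<longleftrightarrow>
     (\<exists>v w. Hs_has_deriv 1 u v \<and> Hs_has_deriv 1 v w \<and>
        (AE x in lborel. u 0 x = u0 x) \<and> (AE x in lborel. v 0 x = u1 x) \<and>
        (\<forall>t>0. \<forall>\<phi>\<in>schwartz.
           (LINT x|lborel. w t x * \<phi> x - w t x * laplacian \<phi> x
              + u t x * laplacian (laplacian \<phi>) x - u t x * laplacian \<phi> x + v t x * \<phi> x) = 0))"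

end

theory Submission
  imports Defs "HOL-Probability.Characteristic_Functions"
begin

text \<open>
  In Fourier variables the equation decouples. With \<open>\<rho> = \<bar>\<xi>\<bar>\<^sup>2\<close> the transform \<open>U\<close> of \<open>u\<close> solves
  \<open>(1 + \<rho>) U'' + U' + \<rho> (1 + \<rho>) U = 0\<close>, a damped oscillator with damping coefficient
  \<open>1 / (1 + \<rho>)\<close>. Put \<open>k = 1 / (2 (1 + \<rho>))\<close>. The functional \<open>\<bar>U' + k U\<bar>\<^sup>2 + (\<rho> + k\<^sup>2) \<bar>U\<bar>\<^sup>2\<close> has time
  derivative \<open>- 2 k (\<bar>U'\<bar>\<^sup>2 + \<rho> \<bar>U\<bar>\<^sup>2)\<close> (\<open>lyap_dissipation\<close>), so it decays at a rate of order \<open>\<rho>\<close>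
  for \<open>\<rho> \<le> 1\<close> and of order \<open>1 / \<rho>\<close> for \<open>\<rho> > 1\<close> (\<open>decay_rate_lyap_le\<close>).

  At low frequencies \<open>\<bar>U\<bar>\<^sup>2\<close> is at most \<open>exp (- \<rho> t / 8)\<close> times a constant that depends only on
  the norms of the data in \<open>L\<^sup>1\<^sup>,\<^sup>1\<close>, and integration over \<open>\<xi>\<close> gives \<open>t powr (- n / 2)\<close>. At high
  frequencies \<open>exp (- t / (4 (1 + \<rho>)))\<close> is at most a constant times
  \<open>((1 + \<rho>) / t) powr (l + 1)\<close>, and integration gives \<open>t powr (- (l + 1))\<close> times the squared
  Sobolev norms of the data. As \<open>l + 1 < n / 2\<close>, the second rate prevails, and Plancherel's
  theorem carries the bound to \<open>u\<close> (\<open>L2_decay\<close>).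

  Two points need care. The transform on \<open>L\<^sup>2\<close> is a limit of transforms of cut-offs; its
  existence and its properties rest on Plancherel's theorem, obtained here by averaging with
  Gaussians (\<open>heat_fourier\<close>, \<open>Plancherel_L1\<close>), and on the completeness of \<open>L\<^sup>2\<close>. And the equation
  holds only in the sense of distributions, with time derivatives taken in \<open>H\<^sup>1\<close>. Translated
  Gaussians as test functions give the equation for almost every \<open>\<xi>\<close> at each fixed time
  (\<open>weak_equation_fourier\<close>), and the functional is differentiated after integration over a set
  of frequencies (\<open>lyap_on_dissipation\<close>); the choice of the set then returns a bound for
  almost every \<open>\<xi>\<close> (\<open>lyap_decay_level\<close>, \<open>lyap_decay\<close>).
\<close>

section \<open>Gaussians and the Fourier transform of integrable functions\<close>

text \<open>
  Lebesgue measure is a product measure, so functions that factor over the coordinates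
  integrate factor by factor. This reduces the Gaussian Fourier integral to one dimension.
\<close>

lemma lborel_prod_integral:
  fixes f :: "'a::euclidean_space \<Rightarrow> real \<Rightarrow> complex"
  assumes "\<And>b. b \<in> Basis \<Longrightarrow> integrable lborel (f b)"
  shows "integrable lborel (\<lambda>x. \<Prod>b\<in>Basis. f b (x \<bullet> b))"
    and "(LINT x|lborel. (\<Prod>b\<in>Basis. f b (x \<bullet> b))) = (\<Prod>b\<in>Basis. LINT x|lborel. f b x)"
proof -
  interpret product_sigma_finite "\<lambda>_::'a. lborel :: real measure" by unfold_locales
  have [measurable]: "f b \<in> borel_measurable borel" if "b \<in> Basis" for b
    using assms[OF that] by auto
  have *: "(\<Prod>b\<in>Basis. f b ((\<Sum>b\<in>Basis. g b *\<^sub>R b) \<bullet> b)) = (\<Prod>b\<in>Basis. f b (g b))" for g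
    by (intro prod.cong) auto
  have 1: "integrable (Pi\<^sub>M (Basis::'a set) (\<lambda>_. lborel)) (\<lambda>g. \<Prod>b\<in>Basis. f b (g b))"
    by (intro product_integrable_prod assms) auto
  show "integrable lborel (\<lambda>x. \<Prod>b\<in>Basis. f b (x \<bullet> b))"
    apply (subst lborel_eq)
    apply (subst integrable_distr_eq)
      apply measurable
    using 1 by (simp add: *)
  show "(LINT x|lborel. (\<Prod>b\<in>Basis. f b (x \<bullet> b))) = (\<Prod>b\<in>Basis. LINT x|lborel. f b x)"
    apply (subst lborel_eq)
    apply (subst integral_distr)
      apply measurable
    using assms by (simp add: * product_integral_prod)
qed

text \<open>
  The density of the standard normal distribution. The product form makes it a case of
  \<open>lborel_prod_integral\<close>; \<open>gauss_eq\<close> gives the radial form.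
\<close>

definition gauss :: "'a::euclidean_space \<Rightarrow> real" where
  "gauss x = (\<Prod>b\<in>Basis. std_normal_density (x \<bullet> b))"

lemma gauss_measurable [measurable]: "gauss \<in> borel_measurable borel"
  unfolding gauss_def by measurable

lemma gauss_eq: "gauss x = exp (- (norm x)\<^sup>2 / 2) / sqrt (2 * pi) ^ DIM('a)" for x :: "'a::euclidean_space"
proof -
  have "(norm x)\<^sup>2 = (\<Sum>b\<in>Basis. (x \<bullet> b)\<^sup>2)"
    by (simp add: norm_eq_sqrt_inner euclidean_inner[of x x] power2_eq_square sum_nonneg)
  hence "- (norm x)\<^sup>2 / 2 = (\<Sum>b\<in>Basis. - (x \<bullet> b)\<^sup>2 / 2)"
    by (simp add: sum_negf sum_divide_distrib)
  thus ?thesis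
    by (simp add: gauss_def std_normal_density_def exp_sum prod_dividef)
qed

lemma gauss_pos: "gauss x > 0"
  by (simp add: gauss_eq)

lemma integrable_gauss [simp]: "integrable lborel (gauss :: 'a::euclidean_space \<Rightarrow> real)"
  and gauss_characteristic_function:
    "(LINT x|lborel. complex_of_real (gauss x) * exp (- \<i> * complex_of_real (\<xi> \<bullet> x)))
       = exp (- (norm \<xi>)\<^sup>2 / 2)" for \<xi> :: "'a::euclidean_space"
proof -
  let ?f = "\<lambda>t b::'a. \<lambda>x. complex_of_real (std_normal_density x) * exp (- \<i> * complex_of_real (t \<bullet> b * x))"
  have i: "integrable lborel (?f t b)" for t b
    by (rule Bochner_Integration.integrable_bound[OF integrable_std_normal_moment[of 0]]) (auto simp: norm_mult)
  have I: "(LINT x|lborel. ?f t b x) = exp (- (t \<bullet> b)\<^sup>2 / 2)" for t b :: 'a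
  proof -
    have "char std_normal_distribution (- (t \<bullet> b)) = (LINT x|lborel. ?f t b x)"
      unfolding char_def
      by (subst integral_density) (auto simp: scaleR_conv_of_real normal_density_nonneg)
    thus ?thesis by (simp add: char_std_normal_distribution)
  qed
  have P: "complex_of_real (gauss x) * exp (- \<i> * complex_of_real (t \<bullet> x)) = (\<Prod>b\<in>Basis. ?f t b (x \<bullet> b))" for t x :: 'a
  proof -
    have "- \<i> * complex_of_real (t \<bullet> x) = (\<Sum>b\<in>Basis. - \<i> * complex_of_real (t \<bullet> b * (x \<bullet> b)))"
      unfolding euclidean_inner[of t x] of_real_sum sum_distrib_left by simp
    hence "exp (- \<i> * complex_of_real (t \<bullet> x)) = (\<Prod>b\<in>Basis. exp (- \<i> * complex_of_real (t \<bullet> b * (x \<bullet> b))))"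
      using exp_sum[of Basis "\<lambda>b. - \<i> * complex_of_real (t \<bullet> b * (x \<bullet> b))"] by simp
    thus ?thesis unfolding gauss_def of_real_prod by (simp only: prod.distrib)
  qed
  have "integrable lborel (\<lambda>x::'a. complex_of_real (gauss x) * exp (- \<i> * complex_of_real (0 \<bullet> x)))"
    unfolding P by (rule lborel_prod_integral(1)[OF i])
  hence "integrable lborel (\<lambda>x::'a. complex_of_real (gauss x))" by simp
  thus "integrable lborel (gauss :: 'a \<Rightarrow> real)"
    by (simp only: complex_of_real_integrable_eq)
  have s: "(\<Sum>b\<in>Basis. - (\<xi> \<bullet> b)\<^sup>2 / 2) = - (norm \<xi>)\<^sup>2 / 2"
    unfolding sum_divide_distrib[symmetric] sum_negf
    by (simp add: norm_eq_sqrt_inner euclidean_inner[of \<xi> \<xi>] power2_eq_square sum_nonneg)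
  show "(LINT x|lborel. complex_of_real (gauss x) * exp (- \<i> * complex_of_real (\<xi> \<bullet> x)))
       = exp (- (norm \<xi>)\<^sup>2 / 2)"
    unfolding P lborel_prod_integral(2)[OF i] I s[symmetric] by (simp add: exp_sum)
qed

lemma integral_gauss: "(LINT x::'a::euclidean_space|lborel. gauss x) = 1"
proof -
  have "complex_of_real (LINT x::'a|lborel. gauss x) = 1"
    using gauss_characteristic_function[of "0::'a"] by simp
  thus ?thesis by (simp only: of_real_eq_1_iff)
qed

lemma nn_integral_gauss: "(\<integral>\<^sup>+x. ennreal (gauss (x::'a::euclidean_space)) \<partial>lborel) = 1"
  by (subst nn_integral_eq_integral) (auto simp: integral_gauss gauss_pos less_imp_le)

lemma nn_integral_lborel_affine:
  fixes t :: "'a::euclidean_space"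
  assumes [measurable]: "f \<in> borel_measurable borel" and "c \<noteq> 0"
  shows "(\<integral>\<^sup>+x. f x \<partial>lborel) = ennreal (\<bar>c\<bar> ^ DIM('a)) * (\<integral>\<^sup>+x. f (t + c *\<^sub>R x) \<partial>lborel)"
  by (subst lborel_affine[OF assms(2), of t])
     (simp add: nn_integral_density nn_integral_distr nn_integral_cmult)

lemma integrable_lborel_affine:
  fixes t :: "'a::euclidean_space" and f :: "'a \<Rightarrow> complex"
  assumes "integrable lborel f" "c \<noteq> 0"
  shows "integrable lborel (\<lambda>x. f (t + c *\<^sub>R x))"
proof -
  have [measurable]: "f \<in> borel_measurable borel" using assms by auto
  have "integrable (density (distr lborel borel (\<lambda>x. t + c *\<^sub>R x)) (\<lambda>_. \<bar>c\<bar>^DIM('a))) f"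
    using assms lborel_affine[OF assms(2), of t] by simp
  hence "integrable lborel (\<lambda>x. \<bar>c\<bar> ^ DIM('a) *\<^sub>R f (t + c *\<^sub>R x))"
    by (subst (asm) integrable_density) (auto simp: integrable_distr_eq)
  from integrable_scaleR_right[OF this, of "inverse (\<bar>c\<bar> ^ DIM('a))"] show ?thesis
    using assms(2) by simp
qed

lemma integral_lborel_affine:
  fixes t :: "'a::euclidean_space" and f :: "'a \<Rightarrow> complex"
  assumes [measurable]: "f \<in> borel_measurable borel" and "c \<noteq> 0"
  shows "(LINT x|lborel. f x) = \<bar>c\<bar> ^ DIM('a) *\<^sub>R (LINT x|lborel. f (t + c *\<^sub>R x))"
  by (subst lborel_affine[OF assms(2), of t])
     (simp add: integral_density integral_distr)

lemma fourier_measurable [measurable]: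
  assumes [measurable]: "f \<in> borel_measurable borel"
  shows "fourier f \<in> borel_measurable borel"
  unfolding fourier_def[abs_def]
  by (intro lborel.borel_measurable_lebesgue_integral) measurable

lemma integrable_fourier_integrand:
  assumes "integrable lborel f"
  shows "integrable lborel (\<lambda>x. f x * exp (- \<i> * complex_of_real (\<xi> \<bullet> x)))"
proof (rule Bochner_Integration.integrable_bound[OF assms])
  have [measurable]: "f \<in> borel_measurable borel" using assms by auto
  show "(\<lambda>x. f x * exp (- \<i> * complex_of_real (\<xi> \<bullet> x))) \<in> borel_measurable lborel" by measurable
qed (auto simp: norm_mult)

lemma cmod_fourier_le: "cmod (fourier f \<xi>) \<le> (LINT x|lborel. cmod (f x))"
proof -
  have "cmod (fourier f \<xi>) \<le> (LINT x|lborel. cmod (f x * exp (- \<i> * complex_of_real (\<xi> \<bullet> x))))"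
    unfolding fourier_def by (rule integral_norm_bound)
  thus ?thesis by (simp add: norm_mult)
qed

text \<open>
  The transform of a modulated Gaussian of width \<open>1/s\<close> is a Gaussian of width \<open>s\<close> centred at the
  modulation \<open>x\<close>. For \<open>s \<rightarrow> 0\<close> this yields an approximate identity; for \<open>s = 1\<close> it provides the
  test functions for the differential equation.
\<close>

lemma fourier_gaussian:
  fixes x z :: "real ^ 'n"
  assumes "s > 0"
  shows "fourier (\<lambda>\<xi>. exp (\<i> * complex_of_real (\<xi> \<bullet> x)) * exp (- (s * norm \<xi>)\<^sup>2 / 2)) z
    = complex_of_real ((2 * pi / s) ^ CARD('n) * gauss ((x - z) /\<^sub>R s))"
proof -
  let ?h = "\<lambda>\<xi>::real^'n. exp (\<i> * complex_of_real (\<xi> \<bullet> x)) * exp (- (s * norm \<xi>)\<^sup>2 / 2) * exp (- \<i> * complex_of_real (z \<bullet> \<xi>))"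
  let ?c = "sqrt (2 * pi) ^ CARD('n)"
  have "fourier (\<lambda>\<xi>. exp (\<i> * complex_of_real (\<xi> \<bullet> x)) * exp (- (s * norm \<xi>)\<^sup>2 / 2)) z = (LINT \<xi>|lborel. ?h \<xi>)"
    by (simp add: fourier_def)
  also have "\<dots> = (1/s) ^ CARD('n) *\<^sub>R (LINT \<xi>|lborel. ?h (0 + (1/s) *\<^sub>R \<xi>))"
    using assms by (subst integral_lborel_affine[of ?h "1/s" 0]) auto
  also have "(\<lambda>\<xi>. ?h (0 + (1/s) *\<^sub>R \<xi>)) = (\<lambda>\<xi>. of_real ?c * (complex_of_real (gauss \<xi>) * exp (- \<i> * complex_of_real (((z - x) /\<^sub>R s) \<bullet> \<xi>))))"
  proof
    fix \<xi> :: "real^'n"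
    have "exp (\<i> * complex_of_real ((1/s) *\<^sub>R \<xi> \<bullet> x)) * exp (- \<i> * complex_of_real (z \<bullet> (1/s) *\<^sub>R \<xi>))
      = exp (- \<i> * complex_of_real (((z - x) /\<^sub>R s) \<bullet> \<xi>))"
      unfolding mult_exp_exp using assms
      by (intro arg_cong[where f=exp]) (auto simp: inner_diff_left inner_commute[of \<xi>] divide_simps algebra_simps)
    moreover have "complex_of_real (exp (- (s * norm ((1/s) *\<^sub>R \<xi>))\<^sup>2 / 2)) = of_real ?c * complex_of_real (gauss \<xi>)"
      using assms by (simp add: gauss_eq power_mult_distrib)
    moreover have "?h (0 + (1/s) *\<^sub>R \<xi>) = (exp (\<i> * complex_of_real ((1/s) *\<^sub>R \<xi> \<bullet> x)) * exp (- \<i> * complex_of_real (z \<bullet> (1/s) *\<^sub>R \<xi>)))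
        * complex_of_real (exp (- (s * norm ((1/s) *\<^sub>R \<xi>))\<^sup>2 / 2))"
      by (simp only: mult_ac add_0_left)
    ultimately show "?h (0 + (1/s) *\<^sub>R \<xi>) = of_real ?c * (complex_of_real (gauss \<xi>) * exp (- \<i> * complex_of_real (((z - x) /\<^sub>R s) \<bullet> \<xi>)))"
      by (simp only: mult_ac)
  qed
  also have "(LINT \<xi>|lborel. \<dots> \<xi>) = of_real ?c * complex_of_real (exp (- (norm ((z - x) /\<^sub>R s))\<^sup>2 / 2))"
    by (simp only: integral_mult_right_zero gauss_characteristic_function)
  also have "exp (- (norm ((z - x) /\<^sub>R s))\<^sup>2 / 2) = ?c * gauss ((x - z) /\<^sub>R s)"
    by (simp add: gauss_eq norm_minus_commute)
  also have "(1/s) ^ CARD('n) *\<^sub>R (of_real ?c * of_real (?c * gauss ((x - z) /\<^sub>R s))) = complex_of_real (((1/s) ^ CARD('n) * (?c * ?c)) * gauss ((x - z) /\<^sub>R s))"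
    by (simp add: scaleR_conv_of_real)
  also have "?c * ?c = (2 * pi) ^ CARD('n)"
    unfolding power_mult_distrib[symmetric] by simp
  finally show ?thesis by (simp add: power_divide)
qed

lemma integrable_gaussian:
  fixes s :: real
  assumes "s > 0"
  shows "integrable lborel (\<lambda>\<xi>::real^'n. exp (- (s * norm \<xi>)\<^sup>2 / 2))"
proof -
  have "integrable lborel (\<lambda>\<xi>::real^'n. complex_of_real (gauss (0 + s *\<^sub>R \<xi>)))"
    using assms by (intro integrable_lborel_affine[of "\<lambda>x. complex_of_real (gauss x)"]) auto
  hence "integrable lborel (\<lambda>\<xi>::real^'n. gauss (s *\<^sub>R \<xi>))"
    by (simp only: complex_of_real_integrable_eq add_0_left)
  hence "integrable lborel (\<lambda>\<xi>::real^'n. sqrt (2 * pi) ^ CARD('n) * gauss (s *\<^sub>R \<xi>))" by simp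
  thus ?thesis using assms by (simp add: gauss_eq)
qed

text \<open>
  Fubini's theorem: both sides are the double integral of \<open>f x * g \<xi>\<close> against the kernel
  \<open>exp (- \<i> (\<xi> \<bullet> x))\<close>, which is symmetric in \<open>x\<close> and \<open>\<xi>\<close>.
\<close>

lemma fourier_multiplication:
  fixes f g :: "real ^ 'n \<Rightarrow> complex"
  assumes f: "integrable lborel f" and g: "integrable lborel g"
  shows "(LINT \<xi>|lborel. fourier f \<xi> * g \<xi>) = (LINT x|lborel. f x * fourier g x)"
proof -
  have [measurable]: "f \<in> borel_measurable borel" "g \<in> borel_measurable borel" using f g by auto
  let ?h = "\<lambda>x \<xi>::real^'n. f x * exp (- \<i> * complex_of_real (\<xi> \<bullet> x)) * g \<xi>"
  have "integrable (lborel \<Otimes>\<^sub>M lborel) (\<lambda>(x, \<xi>). ?h x \<xi>)"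
  proof (rule lborel_pair.Fubini_integrable)
    show "(\<lambda>(x, \<xi>). ?h x \<xi>) \<in> borel_measurable (lborel \<Otimes>\<^sub>M lborel)" by measurable
    have "(\<lambda>x. LINT \<xi>|lborel. cmod (case (x, \<xi>) of (x, \<xi>) \<Rightarrow> ?h x \<xi>)) = (\<lambda>x. cmod (f x) * (LINT \<xi>|lborel. cmod (g \<xi>)))"
      by (simp add: norm_mult)
    thus "integrable lborel (\<lambda>x. LINT \<xi>|lborel. cmod (case (x, \<xi>) of (x, \<xi>) \<Rightarrow> ?h x \<xi>))"
      using f by simp
    show "AE x in lborel. integrable lborel (\<lambda>y. case (x, y) of (x, \<xi>) \<Rightarrow> ?h x \<xi>)"
    proof (intro AE_I2)
      fix x
      have "integrable lborel (\<lambda>y. f x * (g y * exp (- \<i> * complex_of_real (x \<bullet> y))))"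
        by (intro integrable_mult_right integrable_fourier_integrand g)
      thus "integrable lborel (\<lambda>y. case (x, y) of (x, \<xi>) \<Rightarrow> ?h x \<xi>)"
        by (simp add: mult_ac inner_commute)
    qed
  qed
  from lborel_pair.Fubini_integral[OF this]
  have "(LINT \<xi>|lborel. LINT x|lborel. ?h x \<xi>) = (LINT x|lborel. LINT \<xi>|lborel. ?h x \<xi>)" .
  moreover have "(LINT x|lborel. ?h x \<xi>) = fourier f \<xi> * g \<xi>" for \<xi>
    unfolding fourier_def by simp
  moreover have "(LINT \<xi>|lborel. ?h x \<xi>) = f x * fourier g x" for x
  proof -
    have "?h x = (\<lambda>\<xi>. f x * (g \<xi> * exp (- \<i> * complex_of_real (x \<bullet> \<xi>))))"
      by (simp add: mult_ac inner_commute)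
    thus ?thesis unfolding fourier_def by simp
  qed
  ultimately show ?thesis by (simp only:)
qed

section \<open>Regularisation by Gaussian averages\<close>

lemma tendsto_0_ennrealI:
  fixes a :: "'a \<Rightarrow> ennreal"
  assumes "\<And>e::real. e > 0 \<Longrightarrow> eventually (\<lambda>k. a k \<le> ennreal e) F"
  shows "(a \<longlongrightarrow> 0) F"
proof (rule order_tendstoI)
  fix b :: ennreal assume "0 < b"
  then obtain c where c: "0 < c" "c < b" using dense by blast
  then obtain e where e: "c = ennreal e" "e > 0"
    by (cases c) (auto simp: ennreal_zero_less_top)
  show "eventually (\<lambda>k. a k < b) F"
    using assms[OF e(2)] by eventually_elim (use c e in auto)
qed auto

lemma nn_integral_lborel_translate:
  fixes h :: "'a::euclidean_space"
  assumes [measurable]: "f \<in> borel_measurable borel"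
  shows "(\<integral>\<^sup>+x. f (x - h) \<partial>lborel) = (\<integral>\<^sup>+x. f x \<partial>lborel)"
  by (subst nn_integral_lborel_affine[of f 1 "- h"]) auto

text \<open>
  Translations are isometries of \<open>L\<^sup>1\<close>, so continuity of translation passes to \<open>L\<^sup>1\<close> limits.
\<close>

lemma L1_translation_approx:
  fixes f :: "'a::euclidean_space \<Rightarrow> 'b::{real_normed_vector,second_countable_topology}"
  assumes [measurable]: "f \<in> borel_measurable borel"
    and approx: "\<And>e::real. e > 0 \<Longrightarrow> \<exists>g\<in>borel_measurable borel. (\<integral>\<^sup>+x. norm (f x - g x) \<partial>lborel) \<le> ennreal e
       \<and> (\<lambda>k. \<integral>\<^sup>+x. norm (g (x - h k) - g x) \<partial>lborel) \<longlonglongrightarrow> 0"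
  shows "(\<lambda>k::nat. \<integral>\<^sup>+x. norm (f (x - h k) - f x) \<partial>lborel) \<longlonglongrightarrow> 0"
proof (rule tendsto_0_ennrealI)
  fix e :: real assume "e > 0"
  then obtain g where g[measurable]: "g \<in> borel_measurable borel"
    and fg: "(\<integral>\<^sup>+x. norm (f x - g x) \<partial>lborel) \<le> ennreal (e/3)"
    and lim: "(\<lambda>k. \<integral>\<^sup>+x. norm (g (x - h k) - g x) \<partial>lborel) \<longlonglongrightarrow> 0"
    using approx[of "e/3"] by auto
  have "0 < ennreal (e/3)" using \<open>e > 0\<close> by simp
  from order_tendstoD(2)[OF lim this]
  show "eventually (\<lambda>k. (\<integral>\<^sup>+x. norm (f (x - h k) - f x) \<partial>lborel) \<le> ennreal e) sequentially"
  proof eventually_elim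
    case (elim k)
    have "(\<integral>\<^sup>+x. norm (f (x - h k) - f x) \<partial>lborel)
      \<le> (\<integral>\<^sup>+x. ennreal (norm (f (x - h k) - g (x - h k))) + (ennreal (norm (g (x - h k) - g x)) + ennreal (norm (f x - g x))) \<partial>lborel)"
    proof (intro nn_integral_mono)
      fix x
      have "norm (f (x - h k) - f x) = norm ((f (x - h k) - g (x - h k)) + ((g (x - h k) - g x) - (f x - g x)))"
        by simp
      also have "\<dots> \<le> norm (f (x - h k) - g (x - h k)) + norm ((g (x - h k) - g x) - (f x - g x))"
        by (rule norm_triangle_ineq)
      also have "norm ((g (x - h k) - g x) - (f x - g x)) \<le> norm (g (x - h k) - g x) + norm (f x - g x)"
        by (rule norm_triangle_ineq4)
      finally show "ennreal (norm (f (x - h k) - f x)) \<le> ennreal (norm (f (x - h k) - g (x - h k))) + (ennreal (norm (g (x - h k) - g x)) + ennreal (norm (f x - g x)))"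
        by (simp flip: ennreal_plus)
    qed
    also have "\<dots> = (\<integral>\<^sup>+x. norm (f (x - h k) - g (x - h k)) \<partial>lborel) + ((\<integral>\<^sup>+x. norm (g (x - h k) - g x) \<partial>lborel) + (\<integral>\<^sup>+x. norm (f x - g x) \<partial>lborel))"
      by (simp add: nn_integral_add)
    also have "(\<integral>\<^sup>+x. norm (f (x - h k) - g (x - h k)) \<partial>lborel) = (\<integral>\<^sup>+x. norm (f x - g x) \<partial>lborel)"
      by (rule nn_integral_lborel_translate[of "\<lambda>x. ennreal (norm (f x - g x))"]) measurable
    also have "\<dots> + ((\<integral>\<^sup>+x. norm (g (x - h k) - g x) \<partial>lborel) + (\<integral>\<^sup>+x. norm (f x - g x) \<partial>lborel)) \<le> ennreal (e/3) + (ennreal (e/3) + ennreal (e/3))"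
      using fg elim by (intro add_mono) auto
    also have "\<dots> = ennreal e" using \<open>e > 0\<close> by (simp flip: ennreal_plus)
    finally show ?case .
  qed
qed

text \<open>
  For an open set \<open>U\<close>, \<open>indicator U (x - h) * indicator U x\<close> converges to \<open>indicator U x\<close> at every
  point as \<open>h \<rightarrow> 0\<close>: openness handles \<open>x \<in> U\<close>, and outside \<open>U\<close> the product vanishes. So the overlap
  of \<open>U\<close> with its translate has nearly full measure, and the symmetric difference is small.
\<close>

lemma L1_translation_open:
  fixes h :: "nat \<Rightarrow> 'a::euclidean_space" and c :: "'b::{real_normed_vector,second_countable_topology}"
  assumes U: "open U" "emeasure lborel U < \<infinity>" and h: "h \<longlonglongrightarrow> 0"
  shows "(\<lambda>k. \<integral>\<^sup>+x. norm (indicator U (x - h k) *\<^sub>R c - indicator U x *\<^sub>R c) \<partial>lborel) \<longlonglongrightarrow> 0"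
proof -
  have [measurable]: "U \<in> sets borel" using U by auto
  let ?i = "indicator U :: 'a \<Rightarrow> real"
  have i: "integrable lborel ?i" using U by (simp add: integrable_indicator_iff)
  have T: "integrable lborel (\<lambda>x. ?i (x - v))" "(LINT x|lborel. ?i (x - v)) = (LINT x|lborel. ?i x)" for v
  proof -
    have "(\<integral>\<^sup>+x. ennreal (?i (x - v)) \<partial>lborel) = (\<integral>\<^sup>+x. ennreal (?i x) \<partial>lborel)"
      by (rule nn_integral_lborel_translate[of "\<lambda>x. ennreal (?i x)"]) measurable
    moreover have "(\<integral>\<^sup>+x. ennreal (?i x) \<partial>lborel) = ennreal (LINT x|lborel. ?i x)"
      by (rule nn_integral_eq_integral) (use i in auto)
    ultimately have "(\<integral>\<^sup>+x. ennreal (?i (x - v)) \<partial>lborel) = ennreal (LINT x|lborel. ?i x)" by simp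
    from this show "integrable lborel (\<lambda>x. ?i (x - v))" "(LINT x|lborel. ?i (x - v)) = (LINT x|lborel. ?i x)"
      by (auto intro!: integrableI_nonneg integral_eq_nn_integral[THEN trans] simp: integral_nonneg_AE)
  qed
  let ?p = "\<lambda>k x. ?i (x - h k) * ?i x"
  have p: "integrable lborel (?p k)" for k
    by (rule Bochner_Integration.integrable_bound[OF i]) (auto simp: indicator_def)
  have lim: "(\<lambda>k. LINT x|lborel. ?p k x) \<longlonglongrightarrow> (LINT x|lborel. ?i x)"
  proof (rule integral_dominated_convergence[where w = ?i])
    show "AE x in lborel. (\<lambda>k. ?p k x) \<longlonglongrightarrow> ?i x"
    proof (rule AE_I2)
      fix x
      show "(\<lambda>k. ?p k x) \<longlonglongrightarrow> ?i x"
      proof (cases "x \<in> U")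
        case True
        have "(\<lambda>k. x - h k) \<longlonglongrightarrow> x" using tendsto_diff[OF tendsto_const h, of x] by simp
        from topological_tendstoD[OF this U(1) True]
        have "eventually (\<lambda>k. ?p k x = ?i x) sequentially"
          by eventually_elim (use True in auto)
        thus ?thesis by (rule tendsto_eventually)
      qed simp
    qed
  qed (use i in \<open>auto simp: indicator_def\<close>)
  have eq: "(\<integral>\<^sup>+x. norm (?i (x - h k) *\<^sub>R c - ?i x *\<^sub>R c) \<partial>lborel)
     = ennreal (norm c * (2 * (LINT x|lborel. ?i x) - 2 * (LINT x|lborel. ?p k x)))" for k
  proof -
    have "(\<integral>\<^sup>+x. norm (?i (x - h k) *\<^sub>R c - ?i x *\<^sub>R c) \<partial>lborel)
      = (\<integral>\<^sup>+x. ennreal (norm c * (?i (x - h k) + ?i x - 2 * ?p k x)) \<partial>lborel)"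
      by (intro nn_integral_cong) (auto simp: indicator_def)
    also have "\<dots> = ennreal (LINT x|lborel. norm c * (?i (x - h k) + ?i x - 2 * ?p k x))"
    proof (rule nn_integral_eq_integral)
      show "integrable lborel (\<lambda>x. norm c * (?i (x - h k) + ?i x - 2 * ?p k x))"
        by (intro integrable_mult_right Bochner_Integration.integrable_diff Bochner_Integration.integrable_add i T p)
    qed (auto simp: indicator_def)
    also have "(LINT x|lborel. norm c * (?i (x - h k) + ?i x - 2 * ?p k x)) = norm c * (2 * (LINT x|lborel. ?i x) - 2 * (LINT x|lborel. ?p k x))"
      using i T p by simp
    finally show ?thesis .
  qed
  have "(\<lambda>k. norm c * (2 * (LINT x|lborel. ?i x) - 2 * (LINT x|lborel. ?p k x)))
    \<longlonglongrightarrow> norm c * (2 * (LINT x|lborel. ?i x) - 2 * (LINT x|lborel. ?i x))"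
    by (intro tendsto_intros lim)
  from tendsto_ennrealI[OF this] show ?thesis unfolding eq by simp
qed

text \<open>
  Open sets of finite measure are the model case; outer regularity passes to Borel sets of
  finite measure, and linearity and density to integrable functions.
\<close>

lemma L1_translation_continuous:
  fixes f :: "'a::euclidean_space \<Rightarrow> 'b::{banach,second_countable_topology}"
  assumes "integrable lborel f" and h: "h \<longlonglongrightarrow> 0"
  shows "(\<lambda>k::nat. \<integral>\<^sup>+x. norm (f (x - h k) - f x) \<partial>lborel) \<longlonglongrightarrow> 0"
  using assms(1)
proof (induction rule: integrable_induct)
  case (base A c)
  hence [measurable]: "A \<in> sets borel" by simp
  show ?case
  proof (rule L1_translation_approx)
    fix e :: real assume "e > 0"
    hence "e / (norm c + 1) > 0" by (simp add: add_nonneg_pos)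
    then obtain U where U: "open U" "A \<subseteq> U" "emeasure lborel (U - A) < e / (norm c + 1)"
      using outer_regular_lborel[of A "e / (norm c + 1)"] by auto
    have [measurable]: "U \<in> sets borel" using U by auto
    have "emeasure lborel U = emeasure lborel A + emeasure lborel (U - A)"
      using U by (subst plus_emeasure) (auto simp: Un_absorb1)
    also have "\<dots> < \<infinity>" using base U(3) by (auto simp: less_top[symmetric] top_unique)
    finally have fin: "emeasure lborel U < \<infinity>" .
    have "(\<integral>\<^sup>+x. norm (indicator A x *\<^sub>R c - indicator U x *\<^sub>R c) \<partial>lborel)
      = (\<integral>\<^sup>+x. ennreal (norm c) * indicator (U - A) x \<partial>lborel)"
      by (intro nn_integral_cong) (use U in \<open>auto simp: indicator_def\<close>)
    also have "\<dots> = ennreal (norm c) * emeasure lborel (U - A)"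
      by (subst nn_integral_cmult_indicator) auto
    also have "\<dots> \<le> ennreal (norm c) * ennreal (e / (norm c + 1))"
      using U(3) by (intro mult_left_mono) auto
    also have "\<dots> = ennreal (norm c * (e / (norm c + 1)))"
      using \<open>e > 0\<close> by (subst ennreal_mult) auto
    also have "\<dots> \<le> ennreal e"
    proof (rule ennreal_leI)
      have "norm c * e \<le> e * (norm c + 1)" using \<open>e > 0\<close> by (simp add: algebra_simps)
      thus "norm c * (e / (norm c + 1)) \<le> e"
        by (simp add: pos_divide_le_eq add_nonneg_pos)
    qed
    finally show "\<exists>g\<in>borel_measurable borel. (\<integral>\<^sup>+x. norm (indicator A x *\<^sub>R c - g x) \<partial>lborel) \<le> ennreal e
       \<and> (\<lambda>k. \<integral>\<^sup>+x. norm (g (x - h k) - g x) \<partial>lborel) \<longlonglongrightarrow> 0"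
      using L1_translation_open[OF U(1) fin h, of c] by (intro bexI[of _ "\<lambda>x. indicator U x *\<^sub>R c"]) auto
  qed measurable
next
  case (add f g)
  have [measurable]: "f \<in> borel_measurable borel" "g \<in> borel_measurable borel" using add by auto
  have le: "(\<integral>\<^sup>+x. norm (f (x - h k) + g (x - h k) - (f x + g x)) \<partial>lborel)
    \<le> (\<integral>\<^sup>+x. norm (f (x - h k) - f x) \<partial>lborel) + (\<integral>\<^sup>+x. norm (g (x - h k) - g x) \<partial>lborel)" for k
  proof -
    have "(\<integral>\<^sup>+x. norm (f (x - h k) + g (x - h k) - (f x + g x)) \<partial>lborel)
      \<le> (\<integral>\<^sup>+x. ennreal (norm (f (x - h k) - f x)) + ennreal (norm (g (x - h k) - g x)) \<partial>lborel)"
    proof (intro nn_integral_mono)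
      fix x
      have "norm (f (x - h k) + g (x - h k) - (f x + g x)) \<le> norm (f (x - h k) - f x) + norm (g (x - h k) - g x)"
        by (rule norm_diff_triangle_ineq)
      thus "ennreal (norm (f (x - h k) + g (x - h k) - (f x + g x))) \<le> ennreal (norm (f (x - h k) - f x)) + ennreal (norm (g (x - h k) - g x))"
        by (simp flip: ennreal_plus)
    qed
    thus ?thesis by (simp add: nn_integral_add)
  qed
  have lim: "(\<lambda>k. (\<integral>\<^sup>+x. norm (f (x - h k) - f x) \<partial>lborel) + (\<integral>\<^sup>+x. norm (g (x - h k) - g x) \<partial>lborel)) \<longlonglongrightarrow> 0"
    using tendsto_add[OF add.IH] by (simp only: add_0_left)
  show ?case
    by (rule tendsto_sandwich[OF always_eventually always_eventually tendsto_const lim]) (use le in simp_all)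
next
  case (lim f s)
  have [measurable]: "f \<in> borel_measurable borel" "\<And>i. s i \<in> borel_measurable borel" using lim by auto
  have "(\<lambda>i. \<integral>\<^sup>+x. norm (s i x - f x) \<partial>lborel) \<longlonglongrightarrow> (\<integral>\<^sup>+x. 0 \<partial>(lborel::'a measure))"
  proof (rule nn_integral_dominated_convergence[where w = "\<lambda>x. ennreal (3 * norm (f x))"])
    have "norm (s i x - f x) \<le> 3 * norm (f x)" for i x
    proof -
      have "norm (s i x) \<le> 2 * norm (f x)" using lim by simp
      thus ?thesis using norm_triangle_ineq4[of "s i x" "f x"] by simp
    qed
    thus "AE x in lborel. ennreal (norm (s i x - f x)) \<le> ennreal (3 * norm (f x))" for i
      by (intro AE_I2 ennreal_leI)
    have "integrable lborel (\<lambda>x. 3 * norm (f x))" using lim by simp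
    thus "(\<integral>\<^sup>+x. ennreal (3 * norm (f x)) \<partial>lborel) < \<infinity>"
      by (subst nn_integral_eq_integral) auto
    have "(\<lambda>i. norm (s i x - f x)) \<longlonglongrightarrow> norm (f x - f x)" for x
      by (intro tendsto_intros lim) auto
    from tendsto_ennrealI[OF this]
    show "AE x in lborel. (\<lambda>i. ennreal (norm (s i x - f x))) \<longlonglongrightarrow> 0" by simp
  qed auto
  hence L: "(\<lambda>i. \<integral>\<^sup>+x. norm (s i x - f x) \<partial>lborel) \<longlonglongrightarrow> 0" by simp
  show ?case
  proof (rule L1_translation_approx)
    fix e :: real assume "e > 0"
    hence "0 < ennreal e" by simp
    from order_tendstoD(2)[OF L this] obtain i where "(\<integral>\<^sup>+x. norm (s i x - f x) \<partial>lborel) < ennreal e"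
      by (auto simp: eventually_sequentially)
    thus "\<exists>g\<in>borel_measurable borel. (\<integral>\<^sup>+x. norm (f x - g x) \<partial>lborel) \<le> ennreal e
       \<and> (\<lambda>k. \<integral>\<^sup>+x. norm (g (x - h k) - g x) \<partial>lborel) \<longlonglongrightarrow> 0"
      using lim.IH[of i] by (intro bexI[of _ "s i"]) (auto simp: norm_minus_commute)
  qed measurable
qed

text \<open>
  Convolution with the centred Gaussian of standard deviation \<open>s\<close>, that is, the heat flow of \<open>f\<close>
  at time \<open>s\<^sup>2 / 2\<close>. The scaling sits in the argument of \<open>f\<close> so that the weight does not depend
  on \<open>s\<close>, which makes dominated convergence as \<open>s \<rightarrow> 0\<close> immediate.
\<close>

definition heat :: "real \<Rightarrow> ('a::euclidean_space \<Rightarrow> complex) \<Rightarrow> 'a \<Rightarrow> complex" where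
  "heat s f x = (LINT w|lborel. gauss w *\<^sub>R f (x - s *\<^sub>R w))"

lemma heat_measurable [measurable]:
  assumes [measurable]: "f \<in> borel_measurable borel"
  shows "heat s f \<in> borel_measurable borel"
  unfolding heat_def[abs_def]
  by (intro lborel.borel_measurable_lebesgue_integral) measurable

lemma integrable_translate:
  fixes f :: "'a::euclidean_space \<Rightarrow> complex"
  assumes "integrable lborel f"
  shows "integrable lborel (\<lambda>x. f (x - h))"
  using integrable_lborel_affine[OF assms, of 1 "-h"] by simp

lemma integrable_heat_kernel:
  fixes f :: "'a::euclidean_space \<Rightarrow> complex"
  assumes f: "integrable lborel f"
  shows "integrable (lborel \<Otimes>\<^sub>M lborel) (\<lambda>(w, x). gauss w *\<^sub>R f (x - s *\<^sub>R w))"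
proof (rule lborel_pair.Fubini_integrable)
  have [measurable]: "f \<in> borel_measurable borel" using f by auto
  show "(\<lambda>(w, x). gauss w *\<^sub>R f (x - s *\<^sub>R w)) \<in> borel_measurable (lborel \<Otimes>\<^sub>M lborel)" by measurable
  have "(LINT x|lborel. cmod (f (x - h))) = (LINT x|lborel. cmod (f x))" for h
  proof -
    have "complex_of_real (LINT x|lborel. cmod (f x)) = complex_of_real (LINT x|lborel. cmod (f (x - h)))"
      using integral_lborel_affine[of "\<lambda>x. complex_of_real (cmod (f x))" 1 "-h"]
      by (simp add: integral_complex_of_real)
    thus ?thesis by (simp only: of_real_eq_iff)
  qed
  hence "(\<lambda>w::'a. LINT x|lborel. cmod (case (w, x) of (w, x) \<Rightarrow> gauss w *\<^sub>R f (x - s *\<^sub>R w))) = (\<lambda>w. gauss w * (LINT x|lborel. cmod (f x)))"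
    by (simp add: gauss_pos less_imp_le abs_of_pos)
  thus "integrable lborel (\<lambda>w::'a. LINT x|lborel. cmod (case (w, x) of (w, x) \<Rightarrow> gauss w *\<^sub>R f (x - s *\<^sub>R w)))"
    by simp
  show "AE w in lborel. integrable lborel (\<lambda>x. case (w, x) of (w, x) \<Rightarrow> gauss w *\<^sub>R f (x - s *\<^sub>R w))"
    using integrable_translate[OF f] by simp
qed

lemma integrable_heat:
  fixes f :: "'a::euclidean_space \<Rightarrow> complex"
  assumes f: "integrable lborel f"
  shows "integrable lborel (heat s f)"
  unfolding heat_def[abs_def]
  using lborel_pair.integrable_snd[of "\<lambda>w x. gauss w *\<^sub>R f (x - s *\<^sub>R w)"] integrable_heat_kernel[OF f, of s]
  by simp

text \<open>
  The \<open>L\<^sup>1\<close> distance of \<open>heat s f\<close> from \<open>f\<close> is at most the Gaussian average over \<open>w\<close> of the \<open>L\<^sup>1\<close>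
  distance of \<open>f\<close> from its translate by \<open>s w\<close>.
\<close>

lemma heat_L1_limit:
  fixes f :: "'a::euclidean_space \<Rightarrow> complex"
  assumes f: "integrable lborel f" and s: "s \<longlonglongrightarrow> 0"
  shows "(\<lambda>k. \<integral>\<^sup>+x. norm (heat (s k) f x - f x) \<partial>lborel) \<longlonglongrightarrow> 0"
proof -
  have [measurable]: "f \<in> borel_measurable borel" using f by auto
  let ?T = "\<lambda>h. \<integral>\<^sup>+x. norm (f (x - h) - f x) \<partial>lborel"
  have bd: "?T h \<le> ennreal (2 * (LINT x|lborel. cmod (f x)))" for h
  proof -
    have "?T h \<le> (\<integral>\<^sup>+x. ennreal (norm (f (x - h))) + ennreal (norm (f x)) \<partial>lborel)"
      by (intro nn_integral_mono) (simp add: norm_triangle_ineq4 flip: ennreal_plus)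
    also have "\<dots> = (\<integral>\<^sup>+x. norm (f (x - h)) \<partial>lborel) + (\<integral>\<^sup>+x. norm (f x) \<partial>lborel)"
      by (simp add: nn_integral_add)
    also have "(\<integral>\<^sup>+x. norm (f (x - h)) \<partial>lborel) = (\<integral>\<^sup>+x. norm (f x) \<partial>lborel)"
      by (rule nn_integral_lborel_translate[of "\<lambda>x. ennreal (norm (f x))"]) measurable
    also have "(\<integral>\<^sup>+x. norm (f x) \<partial>lborel) = ennreal (LINT x|lborel. cmod (f x))"
      by (rule nn_integral_eq_integral) (use f in auto)
    finally show ?thesis by (simp flip: ennreal_plus)
  qed
  have le: "(\<integral>\<^sup>+x. norm (heat r f x - f x) \<partial>lborel) \<le> (\<integral>\<^sup>+w. ennreal (gauss w) * ?T (r *\<^sub>R w) \<partial>lborel)" for r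
  proof -
    have "AE x in lborel. integrable lborel (\<lambda>w. gauss w *\<^sub>R f (x - r *\<^sub>R w))"
      using lborel_pair.AE_integrable_snd[of "\<lambda>w x. gauss w *\<^sub>R f (x - r *\<^sub>R w)"] integrable_heat_kernel[OF f, of r]
      by simp
    hence "AE x in lborel. ennreal (norm (heat r f x - f x)) \<le> (\<integral>\<^sup>+w. ennreal (gauss w) * ennreal (norm (f (x - r *\<^sub>R w) - f x)) \<partial>lborel)"
    proof eventually_elim
      case (elim x)
      have "f x = (LINT w::'a|lborel. gauss w *\<^sub>R f x)" by (simp add: integral_gauss)
      hence "heat r f x - f x = (LINT w|lborel. gauss w *\<^sub>R f (x - r *\<^sub>R w) - gauss w *\<^sub>R f x)"
        unfolding heat_def using elim by (subst Bochner_Integration.integral_diff) auto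
      also have "ennreal (norm \<dots>) \<le> (\<integral>\<^sup>+w. norm (gauss w *\<^sub>R f (x - r *\<^sub>R w) - gauss w *\<^sub>R f x) \<partial>lborel)"
        using elim by (intro integral_norm_bound_ennreal) auto
      also have "\<dots> = (\<integral>\<^sup>+w. ennreal (gauss w) * ennreal (norm (f (x - r *\<^sub>R w) - f x)) \<partial>lborel)"
        by (intro nn_integral_cong)
           (simp add: gauss_pos less_imp_le abs_of_pos flip: ennreal_mult scaleR_diff_right)
      finally show ?case .
    qed
    hence "(\<integral>\<^sup>+x. norm (heat r f x - f x) \<partial>lborel) \<le> (\<integral>\<^sup>+x. \<integral>\<^sup>+w. ennreal (gauss w) * ennreal (norm (f (x - r *\<^sub>R w) - f x)) \<partial>lborel \<partial>lborel)"
      by (rule nn_integral_mono_AE)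
    also have "\<dots> = (\<integral>\<^sup>+w. \<integral>\<^sup>+x. ennreal (gauss w) * ennreal (norm (f (x - r *\<^sub>R w) - f x)) \<partial>lborel \<partial>lborel)"
      by (intro lborel_pair.Fubini') measurable
    also have "\<dots> = (\<integral>\<^sup>+w. ennreal (gauss w) * ?T (r *\<^sub>R w) \<partial>lborel)"
      by (simp add: nn_integral_cmult)
    finally show ?thesis .
  qed
  have "(\<lambda>k. \<integral>\<^sup>+w. ennreal (gauss w) * ?T (s k *\<^sub>R w) \<partial>lborel) \<longlonglongrightarrow> (\<integral>\<^sup>+w. 0 \<partial>(lborel::'a measure))"
  proof (rule nn_integral_dominated_convergence[where w = "\<lambda>w. ennreal (gauss w) * ennreal (2 * (LINT x|lborel. cmod (f x)))"])
    show "AE w in lborel. ennreal (gauss w) * ?T (s k *\<^sub>R w) \<le> ennreal (gauss w) * ennreal (2 * (LINT x|lborel. cmod (f x)))" for k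
      by (intro AE_I2 mult_left_mono bd) auto
    show "(\<integral>\<^sup>+w. ennreal (gauss (w::'a)) * ennreal (2 * (LINT x|lborel. cmod (f x))) \<partial>lborel) < \<infinity>"
      by (simp add: nn_integral_multc nn_integral_gauss)
    show "AE w in lborel. (\<lambda>k. ennreal (gauss w) * ?T (s k *\<^sub>R w)) \<longlonglongrightarrow> 0"
    proof (rule AE_I2)
      fix w :: 'a
      have "(\<lambda>k. s k *\<^sub>R w) \<longlonglongrightarrow> 0" using tendsto_scaleR[OF s tendsto_const, of w] by simp
      from L1_translation_continuous[OF f this]
      have "(\<lambda>k. ennreal (gauss w) * ?T (s k *\<^sub>R w)) \<longlonglongrightarrow> ennreal (gauss w) * 0"
        by (intro ennreal_tendsto_cmult) auto
      thus "(\<lambda>k. ennreal (gauss w) * ?T (s k *\<^sub>R w)) \<longlonglongrightarrow> 0" by simp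
    qed
  qed measurable
  hence lim: "(\<lambda>k. \<integral>\<^sup>+w. ennreal (gauss w) * ?T (s k *\<^sub>R w) \<partial>lborel) \<longlonglongrightarrow> 0" by simp
  show ?thesis
    by (rule tendsto_sandwich[OF always_eventually always_eventually tendsto_const lim]) (use le in simp_all)
qed

lemma integrable_fourier_gaussian:
  fixes f :: "real^'n \<Rightarrow> complex"
  assumes f: "integrable lborel f" and s: "s > 0"
  shows "integrable lborel (\<lambda>\<xi>. fourier f \<xi> * exp (- (s * norm \<xi>)\<^sup>2 / 2))"
proof -
  have [measurable]: "f \<in> borel_measurable borel" using f by auto
  show ?thesis
  proof (rule Bochner_Integration.integrable_bound)
    show "integrable lborel (\<lambda>\<xi>::real^'n. (LINT x|lborel. cmod (f x)) * exp (- (s * norm \<xi>)\<^sup>2 / 2))"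
      by (intro integrable_mult_right integrable_gaussian s)
    show "AE \<xi> in lborel. norm (fourier f \<xi> * exp (- (s * norm \<xi>)\<^sup>2 / 2)) \<le> norm ((LINT x|lborel. cmod (f x)) * exp (- (s * norm \<xi>)\<^sup>2 / 2))"
      using cmod_fourier_le[of f] by (auto simp: norm_mult intro!: mult_right_mono intro: order_trans[OF _ abs_ge_self])
  qed measurable
qed

text \<open>
  Fourier inversion regularised by a Gaussian: this is the multiplication formula for \<open>f\<close> and
  the modulated Gaussian of \<open>fourier_gaussian\<close>. It expresses \<open>heat s f\<close>, which tends to \<open>f\<close>, by
  the transform of \<open>f\<close> alone.
\<close>

lemma heat_fourier:
  fixes f :: "real^'n \<Rightarrow> complex"
  assumes f: "integrable lborel f" and s: "s > 0"
  shows "(2 * pi) ^ CARD('n) * heat s f x = fourier (\<lambda>\<xi>. fourier f \<xi> * exp (- (s * norm \<xi>)\<^sup>2 / 2)) (- x)"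
proof -
  have [measurable]: "f \<in> borel_measurable borel" using f by auto
  let ?g = "\<lambda>\<xi>::real^'n. exp (\<i> * complex_of_real (\<xi> \<bullet> x)) * exp (- (s * norm \<xi>)\<^sup>2 / 2)"
  have g: "integrable lborel ?g"
    by (rule Bochner_Integration.integrable_bound[OF integrable_gaussian[OF s]]) (auto simp: norm_mult)
  have "fourier (\<lambda>\<xi>. fourier f \<xi> * exp (- (s * norm \<xi>)\<^sup>2 / 2)) (- x) = (LINT \<xi>|lborel. fourier f \<xi> * ?g \<xi>)"
    unfolding fourier_def[of _ "- x"] by (simp add: mult_ac inner_commute)
  also have "\<dots> = (LINT z|lborel. f z * fourier ?g z)"
    by (rule fourier_multiplication[OF f g])
  also have "\<dots> = (LINT z|lborel. f z * complex_of_real ((2 * pi / s) ^ CARD('n) * gauss ((x - z) /\<^sub>R s)))"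
    by (simp only: fourier_gaussian[OF s])
  also have "\<dots> = \<bar>- s\<bar> ^ DIM(real^'n) *\<^sub>R (LINT w|lborel. f (x + (- s) *\<^sub>R w) * complex_of_real ((2 * pi / s) ^ CARD('n) * gauss ((x - (x + (- s) *\<^sub>R w)) /\<^sub>R s)))"
    by (rule integral_lborel_affine) (use s in \<open>auto simp del: DIM_cart\<close>)
  also have "(\<lambda>w. f (x + (- s) *\<^sub>R w) * complex_of_real ((2 * pi / s) ^ CARD('n) * gauss ((x - (x + (- s) *\<^sub>R w)) /\<^sub>R s)))
     = (\<lambda>w. complex_of_real ((2 * pi / s) ^ CARD('n)) * (gauss w *\<^sub>R f (x - s *\<^sub>R w)))"
  proof
    fix w
    have "(x - (x + (- s) *\<^sub>R w)) /\<^sub>R s = w" using s by simp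
    thus "f (x + (- s) *\<^sub>R w) * complex_of_real ((2 * pi / s) ^ CARD('n) * gauss ((x - (x + (- s) *\<^sub>R w)) /\<^sub>R s))
     = complex_of_real ((2 * pi / s) ^ CARD('n)) * (gauss w *\<^sub>R f (x - s *\<^sub>R w))"
      by (simp only: scaleR_conv_of_real[where 'a=complex] of_real_mult scaleR_minus_left diff_conv_add_uminus mult_ac)
  qed
  also have "\<bar>- s\<bar> ^ DIM(real^'n) *\<^sub>R (LINT w|lborel. \<dots> w) = (s ^ CARD('n) * (2 * pi / s) ^ CARD('n)) * heat s f x"
    using s by (simp add: heat_def scaleR_conv_of_real)
  also have "s ^ CARD('n) * (2 * pi / s) ^ CARD('n) = (2 * pi) ^ CARD('n)"
    unfolding power_mult_distrib[symmetric] using s by simp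
  finally show ?thesis by (simp add: mult_ac)
qed

text \<open>
  If the transform vanishes, so does every \<open>heat s f\<close>, and with them the limit \<open>f\<close>.
\<close>

lemma fourier_inj_AE:
  fixes f :: "real^'n \<Rightarrow> complex"
  assumes f: "integrable lborel f" and 0: "\<And>\<xi>. fourier f \<xi> = 0"
  shows "AE x in lborel. f x = 0"
proof -
  have [measurable]: "f \<in> borel_measurable borel" using f by auto
  have "heat (1 / real (Suc k)) f x = 0" for k x
  proof -
    have "complex_of_real ((2 * pi) ^ CARD('n)) * heat (1 / real (Suc k)) f x = 0"
      using heat_fourier[OF f, of "1 / real (Suc k)" x] unfolding 0 by (simp add: fourier_def del: of_nat_Suc)
    thus ?thesis by simp
  qed
  hence "(\<lambda>k::nat. \<integral>\<^sup>+x. norm (f x) \<partial>lborel) \<longlonglongrightarrow> 0"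
    using heat_L1_limit[OF f LIMSEQ_Suc[OF lim_1_over_n]] by (simp add: del: of_nat_Suc)
  hence "(\<integral>\<^sup>+x. norm (f x) \<partial>lborel) = 0" by (simp add: LIMSEQ_const_iff)
  thus ?thesis by (subst (asm) nn_integral_0_iff_AE) auto
qed

section \<open>Plancherel's theorem for integrable functions\<close>

text \<open>
  The squared \<open>L\<^sup>2\<close> norm as an extended nonnegative number, so that estimates can be stated
  before finiteness is known.
\<close>

definition L2_sq :: "(real^'n \<Rightarrow> complex) \<Rightarrow> ennreal" where
  "L2_sq f = (\<integral>\<^sup>+x. ennreal ((cmod (f x))\<^sup>2) \<partial>lborel)"

abbreviation L2_sqdist :: "(real^'n \<Rightarrow> complex) \<Rightarrow> (real^'n \<Rightarrow> complex) \<Rightarrow> ennreal" where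
  "L2_sqdist f g \<equiv> L2_sq (\<lambda>x. f x - g x)"

lemma L2_iff: "f \<in> L2 \<longleftrightarrow> f \<in> borel_measurable borel \<and> L2_sq f < \<infinity>"
  by (auto simp: L2_def L2_sq_def integrable_iff_bounded)

lemma L2_D: 
  assumes "f \<in> L2" 
  shows "f \<in> borel_measurable borel" "integrable lborel (\<lambda>x. (cmod (f x))\<^sup>2)"
  using assms by (auto simp: L2_def)

lemma L2_sq_eq_integral: "f \<in> L2 \<Longrightarrow> L2_sq f = ennreal (LINT x|lborel. (cmod (f x))\<^sup>2)"
  unfolding L2_sq_def L2_def by (intro nn_integral_eq_integral) auto

lemma norm_add_sq_le: "(norm (a + b))\<^sup>2 \<le> 2 * (norm a)\<^sup>2 + 2 * (norm b)\<^sup>2" for a b :: "'a::real_normed_vector"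
proof -
  have "(norm (a + b))\<^sup>2 \<le> (norm a + norm b)\<^sup>2" by (intro power_mono norm_triangle_ineq) auto
  also have "\<dots> \<le> 2 * (norm a)\<^sup>2 + 2 * (norm b)\<^sup>2"
    using zero_le_power2[of "norm a - norm b"] by (simp add: power2_eq_square algebra_simps)
  finally show ?thesis .
qed

lemma L2_sq_add_le:
  assumes [measurable]: "f \<in> borel_measurable borel" "g \<in> borel_measurable borel"
  shows "L2_sq (\<lambda>x. f x + g x) \<le> 2 * L2_sq f + 2 * L2_sq g"
proof -
  have "ennreal ((cmod (f x + g x))\<^sup>2) \<le> 2 * ennreal ((cmod (f x))\<^sup>2) + 2 * ennreal ((cmod (g x))\<^sup>2)" for x
  proof -
    have "ennreal ((cmod (f x + g x))\<^sup>2) \<le> ennreal (2 * (cmod (f x))\<^sup>2 + 2 * (cmod (g x))\<^sup>2)"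
      by (intro ennreal_leI norm_add_sq_le)
    thus ?thesis by (simp add: ennreal_mult)
  qed
  hence "L2_sq (\<lambda>x. f x + g x) \<le> (\<integral>\<^sup>+x. 2 * ennreal ((cmod (f x))\<^sup>2) + 2 * ennreal ((cmod (g x))\<^sup>2) \<partial>lborel)"
    unfolding L2_sq_def by (intro nn_integral_mono)
  thus ?thesis unfolding L2_sq_def by (simp add: nn_integral_add nn_integral_cmult)
qed

lemma L2_sq_cmult:
  assumes [measurable]: "f \<in> borel_measurable borel"
  shows "L2_sq (\<lambda>x. c * f x) = ennreal ((cmod c)\<^sup>2) * L2_sq f"
  unfolding L2_sq_def by (simp add: norm_mult power_mult_distrib ennreal_mult nn_integral_cmult)

lemma L2_sq_diff_commute: "L2_sqdist f g = L2_sqdist g f"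
  unfolding L2_sq_def by (simp add: norm_minus_commute)

lemma L2_sq_dist_le:
  assumes [measurable]: "f \<in> borel_measurable borel" "g \<in> borel_measurable borel" "h \<in> borel_measurable borel"
  shows "L2_sqdist f g \<le> 2 * L2_sqdist f h + 2 * L2_sqdist g h"
proof -
  have "L2_sq (\<lambda>x. (f x - h x) + (h x - g x)) \<le> 2 * L2_sqdist f h + 2 * L2_sqdist h g"
    by (intro L2_sq_add_le) measurable
  thus ?thesis by (simp add: L2_sq_diff_commute[of h g])
qed

lemma L2_lincomb:
  assumes "f \<in> L2" "g \<in> L2"
  shows "(\<lambda>x. a * f x + b * g x) \<in> L2"
proof -
  have [measurable]: "f \<in> borel_measurable borel" "g \<in> borel_measurable borel"
    using assms L2_D by auto
  have "L2_sq (\<lambda>x. a * f x + b * g x) \<le> 2 * (ennreal ((cmod a)\<^sup>2) * L2_sq f) + 2 * (ennreal ((cmod b)\<^sup>2) * L2_sq g)"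
    using L2_sq_add_le[of "\<lambda>x. a * f x" "\<lambda>x. b * g x"] by (simp add: L2_sq_cmult)
  also have "\<dots> < \<infinity>" using assms by (auto simp: L2_iff ennreal_mult_less_top)
  finally show ?thesis by (simp add: L2_iff)
qed

lemma L2_sq_fatou:
  assumes [measurable]: "\<And>k. f k \<in> borel_measurable borel" "g \<in> borel_measurable borel"
    and lim: "AE x in lborel. (\<lambda>k. f k x) \<longlonglongrightarrow> g x"
    and le: "eventually (\<lambda>k. L2_sq (f k) \<le> C) sequentially"
  shows "L2_sq g \<le> C"
proof -
  have "AE x in lborel. ennreal ((cmod (g x))\<^sup>2) = liminf (\<lambda>k. ennreal ((cmod (f k x))\<^sup>2))"
    using lim by eventually_elim (intro lim_imp_Liminf[symmetric] tendsto_ennrealI tendsto_intros, auto)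
  hence "L2_sq g = (\<integral>\<^sup>+x. liminf (\<lambda>k. ennreal ((cmod (f k x))\<^sup>2)) \<partial>lborel)"
    unfolding L2_sq_def by (rule nn_integral_cong_AE)
  also have "\<dots> \<le> liminf (\<lambda>k. L2_sq (f k))"
    unfolding L2_sq_def by (intro nn_integral_liminf) measurable
  also have "\<dots> \<le> liminf (\<lambda>k. C)"
    by (intro Liminf_mono le)
  finally show ?thesis by (simp add: Liminf_const)
qed

text \<open>
  The pairing of \<open>f\<close> with \<open>heat s f\<close> is an average over \<open>w\<close> of integrals of \<open>\<bar>f x\<bar> * \<bar>f (x - s w)\<bar>\<close>,
  and \<open>a b \<le> (a\<^sup>2 + b\<^sup>2) / 2\<close> together with translation invariance bounds each of them by the
  squared norm of \<open>f\<close>.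
\<close>

lemma heat_L2_pairing:
  fixes f :: "real^'n \<Rightarrow> complex"
  assumes [measurable]: "f \<in> borel_measurable borel"
  shows "(\<integral>\<^sup>+x. ennreal (cmod (f x)) * ennreal (cmod (heat s f x)) \<partial>lborel) \<le> L2_sq f"
proof -
  let ?g = "\<lambda>w x. ennreal (gauss w) * (ennreal ((cmod (f x))\<^sup>2 / 2) + ennreal ((cmod (f (x - s *\<^sub>R w)))\<^sup>2 / 2))"
  have "ennreal (cmod (f x)) * ennreal (cmod (heat s f x))
    \<le> (\<integral>\<^sup>+w. ?g w x \<partial>lborel)" for x
  proof -
    have "ennreal (cmod (heat s f x)) \<le> (\<integral>\<^sup>+w. ennreal (norm (gauss w *\<^sub>R f (x - s *\<^sub>R w))) \<partial>lborel)"
    proof (cases "integrable lborel (\<lambda>w. gauss w *\<^sub>R f (x - s *\<^sub>R w))")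
      case True
      thus ?thesis unfolding heat_def by (rule integral_norm_bound_ennreal)
    qed (simp add: heat_def not_integrable_integral_eq)
    hence "ennreal (cmod (f x)) * ennreal (cmod (heat s f x)) \<le> ennreal (cmod (f x)) * (\<integral>\<^sup>+w. ennreal (norm (gauss w *\<^sub>R f (x - s *\<^sub>R w))) \<partial>lborel)"
      by (intro mult_left_mono) auto
    also have "\<dots> = (\<integral>\<^sup>+w. ennreal (cmod (f x)) * ennreal (norm (gauss w *\<^sub>R f (x - s *\<^sub>R w))) \<partial>lborel)"
      by (rule nn_integral_cmult[symmetric]) measurable
    also have "\<dots> \<le> (\<integral>\<^sup>+w. ?g w x \<partial>lborel)"
    proof (intro nn_integral_mono)
      fix w
      let ?a = "cmod (f x)" and ?b = "cmod (f (x - s *\<^sub>R w))"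
      have "?a * ?b \<le> ?a\<^sup>2 / 2 + ?b\<^sup>2 / 2"
        using zero_le_power2[of "?a - ?b"] by (simp add: power2_eq_square algebra_simps)
      hence "?a * norm (gauss w *\<^sub>R f (x - s *\<^sub>R w)) \<le> gauss w * (?a\<^sup>2 / 2 + ?b\<^sup>2 / 2)"
        using gauss_pos[of w] by (simp add: abs_of_pos)
      hence "ennreal (?a * norm (gauss w *\<^sub>R f (x - s *\<^sub>R w))) \<le> ennreal (gauss w * (?a\<^sup>2 / 2 + ?b\<^sup>2 / 2))"
        by (rule ennreal_leI)
      thus "ennreal ?a * ennreal (norm (gauss w *\<^sub>R f (x - s *\<^sub>R w))) \<le> ennreal (gauss w) * (ennreal (?a\<^sup>2 / 2) + ennreal (?b\<^sup>2 / 2))"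
        using gauss_pos[of w] by (simp add: ennreal_mult flip: ennreal_plus)
    qed
    finally show ?thesis .
  qed
  hence "(\<integral>\<^sup>+x. ennreal (cmod (f x)) * ennreal (cmod (heat s f x)) \<partial>lborel)
    \<le> (\<integral>\<^sup>+x. \<integral>\<^sup>+w. ?g w x \<partial>lborel \<partial>lborel)"
    by (intro nn_integral_mono)
  also have "\<dots> = (\<integral>\<^sup>+w. \<integral>\<^sup>+x. ?g w x \<partial>lborel \<partial>lborel)"
    by (intro lborel_pair.Fubini') measurable
  also have "\<dots> = (\<integral>\<^sup>+w. ennreal (gauss (w::real^'n)) * L2_sq f \<partial>lborel)"
  proof (rule nn_integral_cong)
    fix w :: "real^'n"
    have "(\<integral>\<^sup>+x. ennreal ((cmod (f x))\<^sup>2 / 2) \<partial>lborel) = (\<integral>\<^sup>+x. ennreal (1/2) * ennreal ((cmod (f x))\<^sup>2) \<partial>lborel)"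
      by (intro nn_integral_cong, subst ennreal_mult[symmetric]) auto
    hence h: "(\<integral>\<^sup>+x. ennreal ((cmod (f x))\<^sup>2 / 2) \<partial>lborel) = ennreal (1/2) * L2_sq f"
      unfolding L2_sq_def by (subst (asm) nn_integral_cmult) auto
    have "(\<integral>\<^sup>+x. ennreal ((cmod (f (x - s *\<^sub>R w)))\<^sup>2 / 2) \<partial>lborel) = ennreal (1/2) * L2_sq f"
      unfolding h[symmetric] by (rule nn_integral_lborel_translate[of "\<lambda>x. ennreal ((cmod (f x))\<^sup>2 / 2)"]) measurable
    moreover have "ennreal (1/2) * L2_sq f + ennreal (1/2) * L2_sq f = L2_sq f"
      by (subst distrib_right[symmetric], subst ennreal_plus[symmetric]) auto
    ultimately show "(\<integral>\<^sup>+x. ?g w x \<partial>lborel) = ennreal (gauss w) * L2_sq f"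
      using h by (simp add: nn_integral_cmult nn_integral_add)
  qed
  also have "\<dots> = L2_sq f" by (simp add: nn_integral_multc nn_integral_gauss)
  finally show ?thesis .
qed

lemma fourier_cnj_gaussian:
  fixes f :: "real^'n \<Rightarrow> complex"
  assumes f: "integrable lborel f" and s: "s > 0"
  shows "fourier (\<lambda>\<xi>. cnj (fourier f \<xi>) * exp (- (s * norm \<xi>)\<^sup>2 / 2)) x = cnj ((2 * pi) ^ CARD('n) * heat s f x)"
  unfolding heat_fourier[OF assms] unfolding fourier_def[of _ x] fourier_def[of _ "- x"]
  by (simp add: exp_cnj flip: Bochner_Integration.integral_cnj)

text \<open>
  With a Gaussian factor inserted, the squared norm of the transform equals \<open>(2 \<pi>)\<^sup>n\<close> times the
  pairing of \<open>f\<close> with \<open>heat s f\<close>, by the multiplication formula. Fatou's lemma removes the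
  factor.
\<close>

lemma Bessel_inequality:
  fixes f :: "real^'n \<Rightarrow> complex"
  assumes f: "integrable lborel f"
  shows "L2_sq (fourier f) \<le> ennreal ((2 * pi) ^ CARD('n)) * L2_sq f"
proof -
  have [measurable]: "f \<in> borel_measurable borel" using f by auto
  let ?G = "\<lambda>s \<xi>::real^'n. exp (- (s * norm \<xi>)\<^sup>2 / 2)"
  \<comment> \<open>the factor with exponent 1/4 squares to the Gaussian with exponent 1/2 of the multiplication
    formula\<close>
  have reg: "L2_sq (\<lambda>\<xi>. fourier f \<xi> * complex_of_real (exp (- (s * norm \<xi>)\<^sup>2 / 4))) \<le> ennreal ((2 * pi) ^ CARD('n)) * L2_sq f"
    if s: "s > 0" for s
  proof -
    have g: "integrable lborel (\<lambda>\<xi>. cnj (fourier f \<xi>) * ?G s \<xi>)"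
      using integrable_cnj[OF integrable_fourier_gaussian[OF f s]] by simp
    have eq: "(cmod (fourier f \<xi> * complex_of_real (exp (- (s * norm \<xi>)\<^sup>2 / 4))))\<^sup>2 = (cmod (fourier f \<xi>))\<^sup>2 * ?G s \<xi>" for \<xi>
      by (simp add: norm_mult power_mult_distrib flip: exp_of_nat_mult)
    have eqc: "complex_of_real ((cmod (fourier f \<xi>))\<^sup>2 * ?G s \<xi>) = fourier f \<xi> * (cnj (fourier f \<xi>) * ?G s \<xi>)" for \<xi>
      by (simp only: of_real_mult complex_norm_square mult_ac)
    have int: "integrable lborel (\<lambda>\<xi>. (cmod (fourier f \<xi>))\<^sup>2 * ?G s \<xi>)"
    proof (rule Bochner_Integration.integrable_bound)
      show "integrable lborel (\<lambda>\<xi>::real^'n. (LINT x|lborel. cmod (f x))\<^sup>2 * ?G s \<xi>)"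
        by (intro integrable_mult_right integrable_gaussian s)
      show "AE \<xi> in lborel. norm ((cmod (fourier f \<xi>))\<^sup>2 * ?G s \<xi>) \<le> norm ((LINT x|lborel. cmod (f x))\<^sup>2 * ?G s \<xi>)"
        using cmod_fourier_le[of f] by (auto intro!: mult_right_mono power_mono)
    qed measurable
    let ?I = "LINT \<xi>|lborel. (cmod (fourier f \<xi>))\<^sup>2 * ?G s \<xi>"
    have "L2_sq (\<lambda>\<xi>. fourier f \<xi> * complex_of_real (exp (- (s * norm \<xi>)\<^sup>2 / 4))) = ennreal ?I"
      unfolding L2_sq_def eq by (rule nn_integral_eq_integral[OF int]) auto
    also have "?I = cmod (complex_of_real ?I)" by (simp add: integral_nonneg_AE)
    also have "complex_of_real ?I = (LINT \<xi>|lborel. fourier f \<xi> * (cnj (fourier f \<xi>) * ?G s \<xi>))"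
      by (simp only: integral_complex_of_real[symmetric] eqc)
    also have "\<dots> = (LINT x|lborel. f x * cnj ((2 * pi) ^ CARD('n) * heat s f x))"
      by (simp only: fourier_multiplication[OF f g] fourier_cnj_gaussian[OF f s])
    also have "ennreal (cmod \<dots>) \<le> (\<integral>\<^sup>+x. ennreal (cmod (f x * cnj ((2 * pi) ^ CARD('n) * heat s f x))) \<partial>lborel)"
    proof (cases "integrable lborel (\<lambda>x. f x * cnj ((2 * pi) ^ CARD('n) * heat s f x))")
      case True
      thus ?thesis by (rule integral_norm_bound_ennreal)
    qed (simp add: not_integrable_integral_eq)
    also have "\<dots> = (\<integral>\<^sup>+x. ennreal ((2 * pi) ^ CARD('n)) * (ennreal (cmod (f x)) * ennreal (cmod (heat s f x))) \<partial>lborel)"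
      by (intro nn_integral_cong) (simp add: norm_mult norm_power mult_ac flip: ennreal_mult)
    also have "\<dots> = ennreal ((2 * pi) ^ CARD('n)) * (\<integral>\<^sup>+x. ennreal (cmod (f x)) * ennreal (cmod (heat s f x)) \<partial>lborel)"
      by (rule nn_integral_cmult) measurable
    also have "\<dots> \<le> ennreal ((2 * pi) ^ CARD('n)) * L2_sq f"
      by (intro mult_left_mono heat_L2_pairing) auto
    finally show ?thesis .
  qed
  show ?thesis
  proof (rule L2_sq_fatou)
    let ?s = "\<lambda>k. 1 / real (Suc k)"
    have "(\<lambda>k. fourier f \<xi> * complex_of_real (exp (- (?s k * norm \<xi>)\<^sup>2 / 4))) \<longlonglongrightarrow> fourier f \<xi> * complex_of_real (exp (- (0 * norm \<xi>)\<^sup>2 / 4))" for \<xi>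
      by (intro tendsto_intros LIMSEQ_Suc[OF lim_1_over_n]) auto
    thus "AE \<xi> in lborel. (\<lambda>k. fourier f \<xi> * complex_of_real (exp (- (?s k * norm \<xi>)\<^sup>2 / 4))) \<longlonglongrightarrow> fourier f \<xi>" by simp
    show "\<forall>\<^sub>F k in sequentially. L2_sq (\<lambda>\<xi>. fourier f \<xi> * complex_of_real (exp (- (?s k * norm \<xi>)\<^sup>2 / 4))) \<le> ennreal ((2 * pi) ^ CARD('n)) * L2_sq f"
      by (intro always_eventually allI reg) simp
  qed measurable
qed

lemma L2_sq_reflect:
  assumes [measurable]: "f \<in> borel_measurable borel"
  shows "L2_sq (\<lambda>x. f (- x)) = L2_sq f"
  unfolding L2_sq_def
  by (subst (2) nn_integral_lborel_affine[of _ "-1" 0]) auto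

text \<open>
  The reverse inequality also comes from Bessel's inequality. It is applied to the transform
  of \<open>f\<close> times a Gaussian, which is integrable, and whose own transform is a reflection of
  \<open>(2 \<pi>)\<^sup>n heat s f\<close>. Along a sequence \<open>s \<rightarrow> 0\<close> on which \<open>heat s f\<close> converges almost everywhere to
  \<open>f\<close>, Fatou's lemma gives the bound for \<open>f\<close>.
\<close>

theorem Plancherel_L1:
  fixes f :: "real^'n \<Rightarrow> complex"
  assumes f: "integrable lborel f"
  shows "L2_sq (fourier f) = ennreal ((2 * pi) ^ CARD('n)) * L2_sq f"
proof (rule antisym)
  show "L2_sq (fourier f) \<le> ennreal ((2 * pi) ^ CARD('n)) * L2_sq f"
    by (rule Bessel_inequality[OF f])
  have [measurable]: "f \<in> borel_measurable borel" using f by auto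
  let ?c = "(2 * pi) ^ CARD('n)"
  let ?s = "\<lambda>k. 1 / real (Suc k)"
  have bd: "ennreal ?c * L2_sq (heat s f) \<le> L2_sq (fourier f)" if s: "s > 0" for s
  proof -
    let ?h = "\<lambda>\<xi>. fourier f \<xi> * complex_of_real (exp (- (s * norm \<xi>)\<^sup>2 / 2))"
    have "ennreal ?c * (ennreal ?c * L2_sq (heat s f)) = L2_sq (\<lambda>x. complex_of_real ?c * heat s f x)"
      by (subst L2_sq_cmult) (auto simp: mult.assoc[symmetric] power2_eq_square norm_mult norm_power simp flip: ennreal_mult)
    also have "(\<lambda>x. complex_of_real ?c * heat s f x) = (\<lambda>x. fourier ?h (- x))"
      using heat_fourier[OF f s] by simp
    also have "L2_sq \<dots> = L2_sq (fourier ?h)"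
      by (rule L2_sq_reflect) measurable
    also have "\<dots> \<le> ennreal ?c * L2_sq ?h"
      by (rule Bessel_inequality[OF integrable_fourier_gaussian[OF f s]])
    also have "L2_sq ?h \<le> L2_sq (fourier f)"
      unfolding L2_sq_def
      by (intro nn_integral_mono ennreal_leI power_mono) (auto simp: norm_mult mult_left_le)
    finally have "ennreal ?c * (ennreal ?c * L2_sq (heat s f)) \<le> ennreal ?c * L2_sq (fourier f)"
      by (simp add: mult_left_mono)
    thus ?thesis by (subst (asm) ennreal_mult_le_mult_iff) auto
  qed
  have fin: "integrable lborel (\<lambda>x. heat (?s k) f x - f x)" for k
    by (intro Bochner_Integration.integrable_diff integrable_heat f)
  have "(\<lambda>k. \<integral>\<^sup>+x. norm (heat (?s k) f x - f x) \<partial>lborel) \<longlonglongrightarrow> 0"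
    by (rule heat_L1_limit[OF f LIMSEQ_Suc[OF lim_1_over_n]])
  moreover have "(\<integral>\<^sup>+x. norm (heat (?s k) f x - f x) \<partial>lborel) = ennreal (LINT x|lborel. norm (heat (?s k) f x - f x))" for k
    by (rule nn_integral_eq_integral) (use fin in auto)
  ultimately have "(\<lambda>k. ennreal (LINT x|lborel. norm (heat (?s k) f x - f x))) \<longlonglongrightarrow> ennreal 0" by (simp del: of_nat_Suc)
  hence "(\<lambda>k. LINT x|lborel. norm (heat (?s k) f x - f x)) \<longlonglongrightarrow> 0"
    by (subst (asm) tendsto_ennreal_iff) (auto simp: integral_nonneg_AE)
  from tendsto_L1_AE_subseq[OF fin this]
  obtain r :: "nat \<Rightarrow> nat" where r: "AE x in lborel. (\<lambda>k. heat (?s (r k)) f x - f x) \<longlonglongrightarrow> 0" by blast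
  \<comment> \<open>the constant enters the function as a square root, so that both sides of Fatou's lemma are
    squared norms\<close>
  have "L2_sq (\<lambda>x. complex_of_real (sqrt ?c) * f x) \<le> L2_sq (fourier f)"
  proof (rule L2_sq_fatou)
    show "AE x in lborel. (\<lambda>k. complex_of_real (sqrt ?c) * heat (?s (r k)) f x) \<longlonglongrightarrow> complex_of_real (sqrt ?c) * f x"
      using r by eventually_elim (intro tendsto_intros, simp add: LIM_zero_iff)
    have "L2_sq (\<lambda>x. complex_of_real (sqrt ?c) * heat (?s (r k)) f x) \<le> L2_sq (fourier f)" for k
      using bd[of "?s (r k)"] by (subst L2_sq_cmult) auto
    thus "\<forall>\<^sub>F k in sequentially. L2_sq (\<lambda>x. complex_of_real (sqrt ?c) * heat (?s (r k)) f x) \<le> L2_sq (fourier f)"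
      by simp
  qed measurable
  thus "ennreal ?c * L2_sq f \<le> L2_sq (fourier f)"
    by (subst (asm) L2_sq_cmult) auto
qed

section \<open>The Fourier transform of square integrable functions\<close>

lemma L2_norm_sq: "f \<in> L2 \<Longrightarrow> L2_sq f = ennreal ((L2_norm f)\<^sup>2)"
  by (simp add: L2_sq_eq_integral L2_norm_def integral_nonneg_AE)

lemma L2_norm_nonneg [simp]: "0 \<le> L2_norm f"
  by (simp add: L2_norm_def integral_nonneg_AE)

lemma L2_mult_integrable:
  assumes "f \<in> L2" "g \<in> L2"
  shows "integrable lborel (\<lambda>x. f x * g x)"
proof (rule Bochner_Integration.integrable_bound)
  note [measurable] = L2_D(1)[OF assms(1)] L2_D(1)[OF assms(2)]
  show "integrable lborel (\<lambda>x. (cmod (f x))\<^sup>2 + (cmod (g x))\<^sup>2)"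
    using assms by (intro Bochner_Integration.integrable_add L2_D(2))
  have "cmod (f x) * cmod (g x) \<le> (cmod (f x))\<^sup>2 + (cmod (g x))\<^sup>2" for x
  proof -
    have "2 * (cmod (f x) * cmod (g x)) \<le> (cmod (f x))\<^sup>2 + (cmod (g x))\<^sup>2"
      using zero_le_power2[of "cmod (f x) - cmod (g x)"] by (simp add: power2_eq_square algebra_simps)
    moreover have "0 \<le> cmod (f x) * cmod (g x)" by simp
    ultimately show ?thesis by linarith
  qed
  thus "AE x in lborel. norm (f x * g x) \<le> norm ((cmod (f x))\<^sup>2 + (cmod (g x))\<^sup>2)"
    by (intro AE_I2) (simp add: norm_mult)
  show "(\<lambda>x. f x * g x) \<in> borel_measurable lborel" by measurable
qed

lemma quadratic_nonneg_discriminant: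
  fixes A B D :: real
  assumes nn: "\<And>t. 0 \<le> A - 2 * t * B + t\<^sup>2 * D" and "D \<ge> 0"
  shows "B\<^sup>2 \<le> A * D"
proof (cases "D = 0")
  case True
  have "B = 0"
  proof (rule ccontr)
    assume "B \<noteq> 0"
    thus False using nn[of "(A + 1) / (2 * B)"] True by simp
  qed
  thus ?thesis using True by simp
next
  case False
  thus ?thesis using nn[of "B / D"] \<open>D \<ge> 0\<close> by (simp add: power2_eq_square field_simps)
qed

lemma L2_Cauchy_Schwarz:
  assumes "f \<in> L2" "g \<in> L2"
  shows "cmod (LINT x|lborel. f x * g x) \<le> L2_norm f * L2_norm g"
proof -
  have i: "integrable lborel (\<lambda>x. cmod (f x) * cmod (g x))"
    using integrable_norm[OF L2_mult_integrable[OF assms]] by (simp add: norm_mult)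
  let ?A = "LINT x|lborel. (cmod (f x))\<^sup>2" and ?B = "LINT x|lborel. cmod (f x) * cmod (g x)" and ?D = "LINT x|lborel. (cmod (g x))\<^sup>2"
  have "0 \<le> ?A - 2 * t * ?B + t\<^sup>2 * ?D" for t
  proof -
    have "0 \<le> (LINT x|lborel. (cmod (f x) - t * cmod (g x))\<^sup>2)" by (intro integral_nonneg_AE) auto
    also have "(\<lambda>x. (cmod (f x) - t * cmod (g x))\<^sup>2) = (\<lambda>x. (cmod (f x))\<^sup>2 - 2 * t * (cmod (f x) * cmod (g x)) + t\<^sup>2 * (cmod (g x))\<^sup>2)"
      by (simp add: power2_eq_square algebra_simps)
    also have "(LINT x|lborel. \<dots> x) = ?A - 2 * t * ?B + t\<^sup>2 * ?D"
      using L2_D(2)[OF assms(1)] L2_D(2)[OF assms(2)] i by simp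
    finally show ?thesis .
  qed
  hence "?B\<^sup>2 \<le> ?A * ?D" by (rule quadratic_nonneg_discriminant) (simp add: integral_nonneg_AE)
  hence "?B \<le> sqrt (?A * ?D)" by (rule real_le_rsqrt)
  moreover have "cmod (LINT x|lborel. f x * g x) \<le> ?B"
    using integral_norm_bound[of lborel "\<lambda>x. f x * g x"] by (simp add: norm_mult)
  ultimately show ?thesis by (simp add: L2_norm_def real_sqrt_mult)
qed

text \<open>
  The Riesz--Fischer theorem. For a subsequence whose increments \<open>d n\<close> have squared norm at
  most \<open>4\<^sup>-\<^sup>n\<close>, the series of \<open>2\<^sup>n \<bar>d n\<bar>\<^sup>2\<close> has finite integral, so it converges almost everywhere.
  Since \<open>2 \<bar>d n\<bar> \<le> 2\<^sup>-\<^sup>n + 2\<^sup>n \<bar>d n\<bar>\<^sup>2\<close>, the increments are then absolutely summable and the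
  subsequence converges.
\<close>

lemma L2_Cauchy_convergent:
  fixes g :: "nat \<Rightarrow> real^'n \<Rightarrow> complex"
  assumes [measurable]: "\<And>k. g k \<in> borel_measurable borel"
    and cauchy: "\<And>e::real. e > 0 \<Longrightarrow> \<exists>N. \<forall>j\<ge>N. \<forall>k\<ge>N. L2_sqdist (g j) (g k) \<le> ennreal e"
  obtains G where "G \<in> borel_measurable borel"
    "\<And>e::real. e > 0 \<Longrightarrow> \<exists>N. \<forall>k\<ge>N. L2_sqdist (g k) G \<le> ennreal e"
proof -
  have "\<exists>r. \<forall>n. (\<forall>j\<ge>r n. \<forall>k\<ge>r n. L2_sqdist (g j) (g k) \<le> ennreal ((1/4)^n)) \<and> r n < r (Suc n)"
  proof (rule dependent_nat_choice)
    show "\<exists>N. \<forall>j\<ge>N. \<forall>k\<ge>N. L2_sqdist (g j) (g k) \<le> ennreal ((1/4)^0)" by (rule cauchy) simp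
  next
    fix N :: nat and n
    obtain M where M: "\<forall>j\<ge>M. \<forall>k\<ge>M. L2_sqdist (g j) (g k) \<le> ennreal ((1/4)^Suc n)"
      using cauchy[of "(1/4)^Suc n"] by auto
    show "\<exists>M. (\<forall>j\<ge>M. \<forall>k\<ge>M. L2_sqdist (g j) (g k) \<le> ennreal ((1/4)^Suc n)) \<and> N < M"
      using M by (intro exI[of _ "max M (Suc N)"]) auto
  qed
  then obtain r where r: "\<And>n j k. j \<ge> r n \<Longrightarrow> k \<ge> r n \<Longrightarrow> L2_sqdist (g j) (g k) \<le> ennreal ((1/4)^n)"
    and mono: "strict_mono r" by (auto simp: strict_mono_Suc_iff)
  let ?d = "\<lambda>n x. g (r (Suc n)) x - g (r n) x"
  let ?S = "\<lambda>x. \<Sum>n. ennreal (2^n * (cmod (?d n x))\<^sup>2)"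
  have "(\<integral>\<^sup>+x. ?S x \<partial>lborel) = (\<Sum>n. \<integral>\<^sup>+x. ennreal (2^n * (cmod (?d n x))\<^sup>2) \<partial>lborel)"
    by (rule nn_integral_suminf) measurable
  also have "\<dots> \<le> (\<Sum>n. ennreal ((1/2)^n))"
  proof (intro suminf_le)
    fix n
    have "(\<integral>\<^sup>+x. ennreal (2^n * (cmod (?d n x))\<^sup>2) \<partial>lborel) = ennreal (2^n) * L2_sq (?d n)"
      unfolding L2_sq_def by (simp add: nn_integral_cmult ennreal_mult)
    also have "\<dots> \<le> ennreal (2^n) * ennreal ((1/4)^n)"
      using mono by (intro mult_left_mono r) (auto simp: strict_mono_less_eq)
    also have "\<dots> = ennreal ((1/2)^n)"
      by (subst ennreal_mult[symmetric]) (auto simp flip: power_mult_distrib)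
    finally show "(\<integral>\<^sup>+x. ennreal (2^n * (cmod (?d n x))\<^sup>2) \<partial>lborel) \<le> ennreal ((1/2)^n)" .
  qed auto
  also have "\<dots> = ennreal (\<Sum>n. (1/2)^n)"
    by (intro suminf_ennreal2) (auto intro: summable_geometric)
  also have "\<dots> < \<infinity>" by simp
  finally have "(\<integral>\<^sup>+x. ?S x \<partial>lborel) \<noteq> \<infinity>" by simp
  hence "AE x in lborel. ?S x \<noteq> \<infinity>"
    by (intro nn_integral_PInf_AE) measurable
  hence conv: "AE x in lborel. convergent (\<lambda>n. g (r n) x)"
  proof eventually_elim
    case (elim x)
    hence "(\<Sum>n. ennreal (2^n * (cmod (?d n x))\<^sup>2)) \<noteq> top" by simp
    hence sm: "summable (\<lambda>n. 2^n * (cmod (?d n x))\<^sup>2)"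
      by (intro summable_suminf_not_top) auto
    have "summable (\<lambda>n. cmod (?d n x))"
    proof (rule summable_comparison_test')
      show "summable (\<lambda>n. (1/2)^n + 2^n * (cmod (?d n x))\<^sup>2)"
        by (intro summable_add sm summable_geometric) simp
      fix n
      let ?a = "cmod (?d n x)"
      have "2 * (sqrt ((1/2)^n) * (sqrt (2^n) * ?a)) \<le> (sqrt ((1/2)^n))\<^sup>2 + (sqrt (2^n) * ?a)\<^sup>2"
        using zero_le_power2[of "sqrt ((1/2)^n) - sqrt (2^n) * ?a"] by (simp only: power2_diff)
      moreover have "sqrt ((1/2)^n) * sqrt (2^n) = 1"
        by (simp add: power_one_over flip: real_sqrt_mult)
      ultimately have "2 * ?a \<le> (1/2)^n + 2^n * ?a\<^sup>2"
        by (simp add: power_mult_distrib mult.assoc[symmetric])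
      moreover have "0 \<le> ?a" by simp
      ultimately show "norm ?a \<le> (1/2)^n + 2^n * ?a\<^sup>2" unfolding real_norm_def by linarith
    qed
    hence "summable (\<lambda>n. ?d n x)" by (rule summable_norm_cancel)
    hence "convergent (\<lambda>m. \<Sum>n<m. ?d n x)" by (simp add: summable_iff_convergent)
    hence "convergent (\<lambda>m. g (r m) x - g (r 0) x)" by (simp only: sum_lessThan_telescope[of "\<lambda>n. g (r n) x"])
    from convergent_add[OF this convergent_const[of "g (r 0) x"]] show ?case by simp
  qed
  define G where "G x = lim (\<lambda>n. g (r n) x)" for x
  have G[measurable]: "G \<in> borel_measurable borel"
    unfolding G_def[abs_def] by (intro borel_measurable_lim_metric) measurable
  have lim: "AE x in lborel. (\<lambda>n. g (r n) x) \<longlonglongrightarrow> G x"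
    using conv by eventually_elim (simp add: G_def convergent_LIMSEQ_iff)
  show thesis
  proof (rule that[OF G])
    fix e :: real assume "e > 0"
    then obtain N where N: "\<forall>j\<ge>N. \<forall>k\<ge>N. L2_sqdist (g j) (g k) \<le> ennreal e" using cauchy by blast
    show "\<exists>N. \<forall>k\<ge>N. L2_sqdist (g k) G \<le> ennreal e"
    proof (intro exI[of _ N] allI impI)
      fix k assume k: "k \<ge> N"
      show "L2_sqdist (g k) G \<le> ennreal e"
      proof (rule L2_sq_fatou)
        show "AE x in lborel. (\<lambda>n. g k x - g (r n) x) \<longlonglongrightarrow> g k x - G x"
          using lim by eventually_elim (intro tendsto_intros)
        have "eventually (\<lambda>n. r n \<ge> N) sequentially"
          using filterlim_subseq[OF mono] by (auto simp: filterlim_at_top)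
        thus "\<forall>\<^sub>F n in sequentially. L2_sqdist (g k) (g (r n)) \<le> ennreal e"
          by eventually_elim (use N k in auto)
      qed measurable
    qed
  qed
qed

text \<open>
  The cut-off that occurs in \<open>has_fourier_L2\<close>.
\<close>

definition trunc :: "real \<Rightarrow> (real^'n \<Rightarrow> complex) \<Rightarrow> real^'n \<Rightarrow> complex" where
  "trunc R f x = indicator (cball 0 R) x * f x"

lemma has_fourier_L2_iff:
  "has_fourier_L2 f g \<longleftrightarrow> g \<in> L2 \<and> ((\<lambda>R. L2_sqdist (fourier (trunc R f)) g) \<longlongrightarrow> 0) at_top"
  unfolding has_fourier_L2_def L2_sq_def trunc_def[abs_def] ..

lemma trunc_measurable [measurable]:
  fixes f :: "real^'n \<Rightarrow> complex"
  assumes [measurable]: "f \<in> borel_measurable borel"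
  shows "trunc R f \<in> borel_measurable borel"
proof -
  have [measurable]: "cball (0::real^'n) R \<in> sets borel" by simp
  show ?thesis unfolding trunc_def[abs_def] by measurable
qed

lemma trunc_eventually: "\<forall>\<^sub>F k in sequentially. trunc (real k) f x = f x"
  using eventually_ge_at_top[of "nat \<lceil>norm x\<rceil>"]
  by eventually_elim (auto simp: trunc_def indicator_def nat_ceiling_le_eq)

lemma trunc_L2:
  fixes f :: "real^'n \<Rightarrow> complex"
  assumes f: "f \<in> L2"
  shows "trunc R f \<in> L2"
proof -
  note [measurable] = L2_D(1)[OF f]
  have "L2_sq (trunc R f) \<le> L2_sq f"
    unfolding L2_sq_def by (intro nn_integral_mono ennreal_leI power_mono) (auto simp: trunc_def indicator_def)
  thus ?thesis using f by (auto simp: L2_iff)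
qed

lemma trunc_integrable:
  fixes f :: "real^'n \<Rightarrow> complex"
  assumes f: "f \<in> L2"
  shows "integrable lborel (trunc R f)"
proof (rule Bochner_Integration.integrable_bound)
  note [measurable] = L2_D(1)[OF f]
  show "integrable lborel (\<lambda>x::real^'n. indicator (cball 0 R) x + (cmod (f x))\<^sup>2)"
    by (intro Bochner_Integration.integrable_add L2_D(2)[OF f])
       (use emeasure_lborel_cball_finite[of "0::real^'n" R] in \<open>simp add: integrable_indicator_iff\<close>)
  have "cmod (f x) \<le> 1 + (cmod (f x))\<^sup>2" for x
    using zero_le_power2[of "cmod (f x) - 1"] zero_le_power2[of "cmod (f x)"]
    by (simp add: power2_eq_square algebra_simps) (smt (verit) mult_nonneg_nonneg norm_ge_zero)
  thus "AE x in lborel. norm (trunc R f x) \<le> norm (indicator (cball 0 R) x + (cmod (f x))\<^sup>2)"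
    by (intro AE_I2) (auto simp: trunc_def indicator_def)
  show "trunc R f \<in> borel_measurable lborel" by measurable
qed

lemma trunc_tail:
  fixes f :: "real^'n \<Rightarrow> complex"
  assumes f: "f \<in> L2" and e: "e > 0"
  obtains N :: nat where "\<And>R S. real N \<le> R \<Longrightarrow> real N \<le> S \<Longrightarrow> L2_sqdist (trunc R f) (trunc S f) \<le> ennreal e"
proof -
  note [measurable] = L2_D(1)[OF f]
  let ?T = "\<lambda>k::nat. \<integral>\<^sup>+x. ennreal ((cmod (f x - trunc (real k) f x))\<^sup>2) \<partial>lborel"
  have "?T \<longlonglongrightarrow> (\<integral>\<^sup>+x. 0 \<partial>(lborel :: (real^'n) measure))"
  proof (rule nn_integral_dominated_convergence[where w = "\<lambda>x. ennreal ((cmod (f x))\<^sup>2)"])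
    show "AE x in lborel. ennreal ((cmod (f x - trunc (real k) f x))\<^sup>2) \<le> ennreal ((cmod (f x))\<^sup>2)" for k
      by (intro AE_I2) (auto simp: trunc_def indicator_def)
    show "(\<integral>\<^sup>+x. ennreal ((cmod (f x))\<^sup>2) \<partial>lborel) < \<infinity>" using f by (simp add: L2_iff L2_sq_def)
    show "AE x in lborel. (\<lambda>k. ennreal ((cmod (f x - trunc (real k) f x))\<^sup>2)) \<longlonglongrightarrow> 0"
    proof (intro AE_I2 tendsto_eventually)
      fix x :: "real^'n"
      show "\<forall>\<^sub>F k in sequentially. ennreal ((cmod (f x - trunc (real k) f x))\<^sup>2) = 0"
        using trunc_eventually[of f x] by eventually_elim simp
    qed
  qed auto
  hence "?T \<longlonglongrightarrow> 0" by simp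
  from order_tendstoD(2)[OF this, of "ennreal e"] e
  obtain N where N: "?T N < ennreal e" by (auto simp: eventually_sequentially)
  show thesis
  proof (rule that)
    fix R S :: real assume RS: "real N \<le> R" "real N \<le> S"
    have "L2_sqdist (trunc R f) (trunc S f) \<le> ?T N"
      unfolding L2_sq_def
      by (intro nn_integral_mono ennreal_leI power_mono) (use RS in \<open>auto simp: trunc_def indicator_def\<close>)
    with N show "L2_sqdist (trunc R f) (trunc S f) \<le> ennreal e" by simp
  qed
qed

lemma fourier_lincomb:
  assumes "integrable lborel f" "integrable lborel g"
  shows "fourier (\<lambda>x. a * f x + b * g x) \<xi> = a * fourier f \<xi> + b * fourier g \<xi>"
proof -
  have "fourier (\<lambda>x. a * f x + b * g x) \<xi> = (LINT x|lborel. a * (f x * exp (- \<i> * complex_of_real (\<xi> \<bullet> x))) + b * (g x * exp (- \<i> * complex_of_real (\<xi> \<bullet> x))))"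
    unfolding fourier_def by (simp add: algebra_simps)
  also have "\<dots> = a * fourier f \<xi> + b * fourier g \<xi>"
    unfolding fourier_def
    by (simp only: Bochner_Integration.integral_add integrable_mult_right integrable_fourier_integrand assms
          integral_mult_right_zero)
  finally show ?thesis .
qed

lemma fourier_trunc_diff:
  fixes f :: "real^'n \<Rightarrow> complex"
  assumes f: "f \<in> L2"
  shows "L2_sqdist (fourier (trunc R f)) (fourier (trunc S f)) = ennreal ((2 * pi) ^ CARD('n)) * L2_sqdist (trunc R f) (trunc S f)"
proof -
  have "(\<lambda>\<xi>. fourier (trunc R f) \<xi> - fourier (trunc S f) \<xi>) = fourier (\<lambda>x. trunc R f x - trunc S f x)"
    using fourier_lincomb[OF trunc_integrable[OF f, of R] trunc_integrable[OF f, of S], of 1 "-1"] by auto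
  thus ?thesis using Plancherel_L1[of "\<lambda>x. trunc R f x - trunc S f x"]
    by (simp add: Bochner_Integration.integrable_diff trunc_integrable[OF f])
qed

text \<open>
  Plancherel's theorem carries the smallness of the tails of \<open>f\<close> over to the transforms of its
  cut-offs, which therefore form a Cauchy family in \<open>L\<^sup>2\<close>. Completeness supplies a limit along
  the integers, and the Cauchy property extends it to all real radii.
\<close>

lemma has_fourier_L2_exists:
  fixes f :: "real^'n \<Rightarrow> complex"
  assumes f: "f \<in> L2"
  shows "\<exists>g. has_fourier_L2 f g"
proof -
  note [measurable] = L2_D(1)[OF f]
  let ?c = "(2 * pi) ^ CARD('n) :: real"
  have cauchy: "\<exists>N::nat. \<forall>R S. real N \<le> R \<longrightarrow> real N \<le> S \<longrightarrow> L2_sqdist (fourier (trunc R f)) (fourier (trunc S f)) \<le> ennreal e"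
    if "e > 0" for e :: real
  proof -
    have "e / ?c > 0" using that by simp
    then obtain N :: nat where N: "\<And>R S. real N \<le> R \<Longrightarrow> real N \<le> S \<Longrightarrow> L2_sqdist (trunc R f) (trunc S f) \<le> ennreal (e / ?c)"
      using trunc_tail[OF f] by metis
    show ?thesis
    proof (intro exI[of _ N] allI impI)
      fix R S assume "real N \<le> R" "real N \<le> S"
      hence "ennreal ?c * L2_sqdist (trunc R f) (trunc S f) \<le> ennreal ?c * ennreal (e / ?c)"
        by (intro mult_left_mono N) auto
      also have "\<dots> = ennreal e" using that by (subst ennreal_mult[symmetric]) auto
      finally show "L2_sqdist (fourier (trunc R f)) (fourier (trunc S f)) \<le> ennreal e"
        by (simp only: fourier_trunc_diff[OF f])
    qed
  qed
  obtain G where G[measurable]: "G \<in> borel_measurable borel"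
    and lim: "\<And>e::real. e > 0 \<Longrightarrow> \<exists>N. \<forall>k\<ge>N. L2_sqdist (fourier (trunc (real k) f)) G \<le> ennreal e"
  proof (rule L2_Cauchy_convergent[of "\<lambda>k. fourier (trunc (real k) f)"])
    show "\<exists>N. \<forall>j\<ge>N. \<forall>k\<ge>N. L2_sqdist (fourier (trunc (real j) f)) (fourier (trunc (real k) f)) \<le> ennreal e" if "e > 0" for e
      using cauchy[OF that] by (metis of_nat_le_iff)
  qed auto
  have lim': "\<exists>N::nat. \<forall>R\<ge>real N. L2_sqdist (fourier (trunc R f)) G \<le> ennreal e" if "e > 0" for e :: real
  proof -
    have e4: "e/4 > 0" using that by simp
    obtain N :: nat where N: "\<And>R S. real N \<le> R \<Longrightarrow> real N \<le> S \<Longrightarrow> L2_sqdist (fourier (trunc R f)) (fourier (trunc S f)) \<le> ennreal (e/4)"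
      using cauchy[OF e4] by blast
    obtain M where M: "\<And>k. k \<ge> M \<Longrightarrow> L2_sqdist (fourier (trunc (real k) f)) G \<le> ennreal (e/4)"
      using lim[OF e4] by blast
    show ?thesis
    proof (intro exI[of _ N] allI impI)
      fix R assume R: "real N \<le> R"
      let ?F = "fourier (trunc (real (max M N)) f)"
      have "L2_sqdist (fourier (trunc R f)) G
        \<le> 2 * L2_sqdist (fourier (trunc R f)) ?F + 2 * L2_sqdist G ?F"
        by (rule L2_sq_dist_le) measurable
      also have "\<dots> \<le> 2 * ennreal (e/4) + 2 * ennreal (e/4)"
        using N[OF R, of "real (max M N)"] M[of "max M N"]
        by (intro add_mono mult_left_mono) (auto simp: L2_sq_diff_commute[of G])
      also have "\<dots> = ennreal e"
        using that by (simp flip: ennreal_numeral ennreal_mult ennreal_plus)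
      finally show "L2_sqdist (fourier (trunc R f)) G \<le> ennreal e" .
    qed
  qed
  have "G \<in> L2"
  proof -
    obtain N :: nat where N: "\<And>R. real N \<le> R \<Longrightarrow> L2_sqdist (fourier (trunc R f)) G \<le> ennreal 1"
      using lim'[of 1] by auto
    let ?F = "fourier (trunc (real N) f)"
    have F: "L2_sq ?F < \<infinity>"
      using Plancherel_L1[OF trunc_integrable[OF f, of "real N"]] trunc_L2[OF f]
      by (simp add: L2_iff ennreal_mult_less_top)
    have "L2_sq G = L2_sq (\<lambda>\<xi>. ?F \<xi> + (G \<xi> - ?F \<xi>))" by simp
    also have "\<dots> \<le> 2 * L2_sq ?F + 2 * L2_sqdist G ?F"
      by (rule L2_sq_add_le) measurable
    also have "\<dots> < \<infinity>"
      using F N[of "real N"] by (auto simp: L2_sq_diff_commute[of G] ennreal_mult_less_top intro: le_less_trans)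
    finally show ?thesis by (simp add: L2_iff)
  qed
  moreover have "((\<lambda>R. L2_sqdist (fourier (trunc R f)) G) \<longlongrightarrow> 0) at_top"
  proof (rule tendsto_0_ennrealI)
    fix e :: real assume "e > 0"
    then obtain N :: nat where N: "\<And>R. real N \<le> R \<Longrightarrow> L2_sqdist (fourier (trunc R f)) G \<le> ennreal e"
      using lim'[of e] by auto
    show "\<forall>\<^sub>F R in at_top. L2_sqdist (fourier (trunc R f)) G \<le> ennreal e"
      using eventually_ge_at_top[of "real N"] by eventually_elim (rule N)
  qed
  ultimately show ?thesis by (auto simp: has_fourier_L2_iff)
qed

lemma fourier_L2_works: "f \<in> L2 \<Longrightarrow> has_fourier_L2 f (fourier_L2 f)"
  unfolding fourier_L2_def using has_fourier_L2_exists by (rule someI_ex)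

lemma fourier_L2_in_L2: "f \<in> L2 \<Longrightarrow> fourier_L2 f \<in> L2"
  using fourier_L2_works by (auto simp: has_fourier_L2_iff)

lemma fourier_L2_limit:
  fixes f :: "real^'n \<Rightarrow> complex"
  assumes f: "f \<in> L2"
  shows "(\<lambda>k. L2_sqdist (fourier (trunc (real k) f)) (fourier_L2 f)) \<longlonglongrightarrow> 0"
proof -
  have "((\<lambda>R. L2_sqdist (fourier (trunc R f)) (fourier_L2 f)) \<longlongrightarrow> 0) at_top"
    using fourier_L2_works[OF f] by (simp add: has_fourier_L2_iff)
  from filterlim_compose[OF this filterlim_real_sequentially] show ?thesis .
qed

lemma has_fourier_L2_unique:
  fixes f :: "real^'n \<Rightarrow> complex"
  assumes f: "f \<in> L2" and "has_fourier_L2 f g" "has_fourier_L2 f h"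
  shows "AE \<xi> in lborel. g \<xi> = h \<xi>"
proof -
  have gh: "g \<in> L2" "h \<in> L2" and lim: "((\<lambda>R. L2_sqdist (fourier (trunc R f)) g) \<longlongrightarrow> 0) at_top"
     "((\<lambda>R. L2_sqdist (fourier (trunc R f)) h) \<longlongrightarrow> 0) at_top"
    using assms by (auto simp: has_fourier_L2_iff)
  note [measurable] = gh[THEN L2_D(1)] L2_D(1)[OF f]
  have le: "L2_sqdist g h \<le> 2 * L2_sqdist (fourier (trunc R f)) g + 2 * L2_sqdist (fourier (trunc R f)) h" for R
    using L2_sq_dist_le[of g h "fourier (trunc R f)"] by (simp add: L2_sq_diff_commute[of _ "fourier (trunc R f)"])
  have "((\<lambda>R. 2 * L2_sqdist (fourier (trunc R f)) g + 2 * L2_sqdist (fourier (trunc R f)) h) \<longlongrightarrow> 2 * 0 + 2 * 0) at_top"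
    by (intro tendsto_add ennreal_tendsto_cmult lim) auto
  hence "((\<lambda>R. 2 * L2_sqdist (fourier (trunc R f)) g + 2 * L2_sqdist (fourier (trunc R f)) h) \<longlongrightarrow> 0) at_top"
    by simp
  from tendsto_lowerbound[OF this always_eventually] le
  have "L2_sqdist g h \<le> 0" by auto
  hence "AE \<xi> in lborel. ennreal ((cmod (g \<xi> - h \<xi>))\<^sup>2) = 0"
    unfolding L2_sq_def by (subst (asm) le_zero_eq, subst (asm) nn_integral_0_iff_AE) auto
  thus ?thesis by eventually_elim simp
qed

lemma fourier_L2_lincomb:
  fixes f g :: "real^'n \<Rightarrow> complex"
  assumes f: "f \<in> L2" and g: "g \<in> L2"
  shows "AE \<xi> in lborel. fourier_L2 (\<lambda>x. a * f x + b * g x) \<xi> = a * fourier_L2 f \<xi> + b * fourier_L2 g \<xi>"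
proof (rule has_fourier_L2_unique)
  let ?F = "fourier_L2 f" and ?G = "fourier_L2 g"
  note L2 = fourier_L2_in_L2[OF f] fourier_L2_in_L2[OF g]
  note [measurable] = L2[THEN L2_D(1)] L2_D(1)[OF f] L2_D(1)[OF g]
  show "has_fourier_L2 (\<lambda>x. a * f x + b * g x) (fourier_L2 (\<lambda>x. a * f x + b * g x))"
    by (intro fourier_L2_works L2_lincomb f g)
  show "(\<lambda>x. a * f x + b * g x) \<in> L2" by (intro L2_lincomb f g)
  have "((\<lambda>R. L2_sq (\<lambda>\<xi>. fourier (trunc R (\<lambda>x. a * f x + b * g x)) \<xi> - (a * ?F \<xi> + b * ?G \<xi>))) \<longlongrightarrow> 0) at_top"
  proof (rule tendsto_sandwich[OF always_eventually always_eventually tendsto_const])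
    let ?B = "\<lambda>R. 2 * (ennreal ((cmod a)\<^sup>2) * L2_sqdist (fourier (trunc R f)) ?F) + 2 * (ennreal ((cmod b)\<^sup>2) * L2_sqdist (fourier (trunc R g)) ?G)"
    have "(?B \<longlongrightarrow> 2 * (ennreal ((cmod a)\<^sup>2) * 0) + 2 * (ennreal ((cmod b)\<^sup>2) * 0)) at_top"
      using fourier_L2_works[OF f] fourier_L2_works[OF g] unfolding has_fourier_L2_iff
      by (intro tendsto_add ennreal_tendsto_cmult) auto
    thus "(?B \<longlongrightarrow> 0) at_top" by simp
    show "\<forall>R. L2_sq (\<lambda>\<xi>. fourier (trunc R (\<lambda>x. a * f x + b * g x)) \<xi> - (a * ?F \<xi> + b * ?G \<xi>)) \<le> ?B R"
    proof
      fix R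
      have t: "trunc R (\<lambda>x. a * f x + b * g x) = (\<lambda>x. a * trunc R f x + b * trunc R g x)"
        by (auto simp: trunc_def algebra_simps)
      have eq: "(\<lambda>\<xi>. fourier (trunc R (\<lambda>x. a * f x + b * g x)) \<xi> - (a * ?F \<xi> + b * ?G \<xi>))
        = (\<lambda>\<xi>. a * (fourier (trunc R f) \<xi> - ?F \<xi>) + b * (fourier (trunc R g) \<xi> - ?G \<xi>))"
        unfolding t fourier_lincomb[OF trunc_integrable[OF f] trunc_integrable[OF g]] by (simp add: algebra_simps)
      have "L2_sq (\<lambda>\<xi>. a * (fourier (trunc R f) \<xi> - ?F \<xi>) + b * (fourier (trunc R g) \<xi> - ?G \<xi>))
        \<le> 2 * L2_sq (\<lambda>\<xi>. a * (fourier (trunc R f) \<xi> - ?F \<xi>)) + 2 * L2_sq (\<lambda>\<xi>. b * (fourier (trunc R g) \<xi> - ?G \<xi>))"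
        by (rule L2_sq_add_le) measurable
      also have "\<dots> = ?B R" by (subst (1 2) L2_sq_cmult) auto
      finally show "L2_sq (\<lambda>\<xi>. fourier (trunc R (\<lambda>x. a * f x + b * g x)) \<xi> - (a * ?F \<xi> + b * ?G \<xi>)) \<le> ?B R"
        by (simp only: eq)
    qed
  qed auto
  thus "has_fourier_L2 (\<lambda>x. a * f x + b * g x) (\<lambda>\<xi>. a * ?F \<xi> + b * ?G \<xi>)"
    unfolding has_fourier_L2_iff using L2_lincomb[OF L2] by auto
qed

text \<open>
  The transforms of the cut-offs converge to \<open>fourier f\<close> at every frequency and to
  \<open>fourier_L2 f\<close> in \<open>L\<^sup>2\<close>; Fatou's lemma identifies the limits.
\<close>

lemma fourier_L2_eq_fourier:
  fixes f :: "real^'n \<Rightarrow> complex"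
  assumes f: "f \<in> L2" and int: "integrable lborel f"
  shows "AE \<xi> in lborel. fourier_L2 f \<xi> = fourier f \<xi>"
proof -
  note [measurable] = L2_D(1)[OF f] L2_D(1)[OF fourier_L2_in_L2[OF f]]
  have lim: "(\<lambda>k. fourier (trunc (real k) f) \<xi>) \<longlonglongrightarrow> fourier f \<xi>" for \<xi>
    unfolding fourier_def
  proof (rule integral_dominated_convergence[where w = "\<lambda>x. cmod (f x)"])
    show "AE x in lborel. (\<lambda>k. trunc (real k) f x * exp (- \<i> * complex_of_real (\<xi> \<bullet> x))) \<longlonglongrightarrow> f x * exp (- \<i> * complex_of_real (\<xi> \<bullet> x))"
      by (intro AE_I2 tendsto_eventually) (use trunc_eventually[of f] in \<open>auto elim!: eventually_mono\<close>)
    show "integrable lborel (\<lambda>x. cmod (f x))" using int by simp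
    show "AE x in lborel. norm (trunc (real k) f x * exp (- \<i> * complex_of_real (\<xi> \<bullet> x))) \<le> cmod (f x)" for k
      by (intro AE_I2) (auto simp: trunc_def indicator_def norm_mult)
  qed measurable
  have le: "L2_sqdist (fourier f) (fourier_L2 f) \<le> ennreal e" if e: "e > 0" for e :: real
  proof (rule L2_sq_fatou)
    show "AE \<xi> in lborel. (\<lambda>k. fourier (trunc (real k) f) \<xi> - fourier_L2 f \<xi>) \<longlonglongrightarrow> fourier f \<xi> - fourier_L2 f \<xi>"
      by (intro AE_I2 tendsto_intros lim)
    from order_tendstoD(2)[OF fourier_L2_limit[OF f], of "ennreal e"] e
    have "\<forall>\<^sub>F k in sequentially. L2_sqdist (fourier (trunc (real k) f)) (fourier_L2 f) < ennreal e"
      by simp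
    thus "\<forall>\<^sub>F k in sequentially. L2_sqdist (fourier (trunc (real k) f)) (fourier_L2 f) \<le> ennreal e"
      by (rule eventually_mono) (rule less_imp_le)
  qed measurable
  have "L2_sqdist (fourier f) (fourier_L2 f) \<le> 0"
    by (rule ennreal_le_epsilon) (simp add: le)
  hence "AE \<xi> in lborel. ennreal ((cmod (fourier f \<xi> - fourier_L2 f \<xi>))\<^sup>2) = 0"
    unfolding L2_sq_def by (subst (asm) le_zero_eq, subst (asm) nn_integral_0_iff_AE) auto
  thus ?thesis by eventually_elim simp
qed

text \<open>
  One half of Plancherel's theorem, up to a factor 2, which comes from using
  \<open>\<bar>a + b\<bar>\<^sup>2 \<le> 2 \<bar>a\<bar>\<^sup>2 + 2 \<bar>b\<bar>\<^sup>2\<close> in the passage to the limit and is absorbed in the constant of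
  the decay estimate.
\<close>

lemma L2_sq_le_fourier_L2:
  fixes f :: "real^'n \<Rightarrow> complex"
  assumes f: "f \<in> L2"
  shows "ennreal ((2 * pi) ^ CARD('n)) * L2_sq f \<le> 2 * L2_sq (fourier_L2 f)"
proof -
  note [measurable] = L2_D(1)[OF f] L2_D(1)[OF fourier_L2_in_L2[OF f]]
  let ?c = "(2 * pi) ^ CARD('n) :: real"
  have le: "L2_sq (\<lambda>x. complex_of_real (sqrt ?c) * f x) \<le> 2 * L2_sq (fourier_L2 f) + ennreal e" if e: "e > 0" for e :: real
  proof (rule L2_sq_fatou)
    show "AE x in lborel. (\<lambda>k. complex_of_real (sqrt ?c) * trunc (real k) f x) \<longlonglongrightarrow> complex_of_real (sqrt ?c) * f x"
      by (intro AE_I2 tendsto_eventually) (use trunc_eventually[of f] in \<open>auto elim!: eventually_mono\<close>)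
    from order_tendstoD(2)[OF fourier_L2_limit[OF f], of "ennreal (e/2)"] e
    have "\<forall>\<^sub>F k in sequentially. L2_sqdist (fourier (trunc (real k) f)) (fourier_L2 f) < ennreal (e/2)" by simp
    thus "\<forall>\<^sub>F k in sequentially. L2_sq (\<lambda>x. complex_of_real (sqrt ?c) * trunc (real k) f x) \<le> 2 * L2_sq (fourier_L2 f) + ennreal e"
    proof eventually_elim
      case (elim k)
      let ?F = "fourier (trunc (real k) f)"
      have "L2_sq (\<lambda>x. complex_of_real (sqrt ?c) * trunc (real k) f x) = ennreal ?c * L2_sq (trunc (real k) f)"
        by (subst L2_sq_cmult) auto
      also have "\<dots> = L2_sq ?F" by (rule Plancherel_L1[symmetric, OF trunc_integrable[OF f]])
      also have "\<dots> = L2_sq (\<lambda>\<xi>. fourier_L2 f \<xi> + (?F \<xi> - fourier_L2 f \<xi>))" by simp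
      also have "\<dots> \<le> 2 * L2_sq (fourier_L2 f) + 2 * L2_sqdist ?F (fourier_L2 f)"
        by (rule L2_sq_add_le) measurable
      also have "\<dots> \<le> 2 * L2_sq (fourier_L2 f) + 2 * ennreal (e/2)"
        using elim by (intro add_mono mult_left_mono) auto
      also have "2 * ennreal (e/2) = ennreal e"
        using e by (simp flip: ennreal_numeral ennreal_mult)
      finally show ?case .
    qed
  qed measurable
  have "L2_sq (\<lambda>x. complex_of_real (sqrt ?c) * f x) \<le> 2 * L2_sq (fourier_L2 f)"
    by (rule ennreal_le_epsilon) (rule le)
  thus ?thesis by (subst (asm) L2_sq_cmult) auto
qed

text \<open>
  The formula holds for the cut-offs of \<open>f\<close>. On the frequency side the Cauchy--Schwarz
  inequality gives the limit, on the physical side dominated convergence does.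
\<close>

lemma fourier_L2_multiplication:
  fixes f \<psi> :: "real^'n \<Rightarrow> complex"
  assumes f: "f \<in> L2" and \<psi>: "\<psi> \<in> L2" "integrable lborel \<psi>"
  shows "(LINT \<xi>|lborel. fourier_L2 f \<xi> * \<psi> \<xi>) = (LINT x|lborel. f x * fourier \<psi> x)"
    and "fourier \<psi> \<in> L2"
proof -
  note [measurable] = L2_D(1)[OF f] L2_D(1)[OF fourier_L2_in_L2[OF f]] L2_D(1)[OF \<psi>(1)]
  show \<psi>2: "fourier \<psi> \<in> L2"
    using Plancherel_L1[OF \<psi>(2)] \<psi>(1) by (auto simp: L2_iff ennreal_mult_less_top)
  let ?F = "\<lambda>k::nat. fourier (trunc (real k) f)"
  let ?D = "\<lambda>k \<xi>. ?F k \<xi> - fourier_L2 f \<xi>"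
  have F2: "?F k \<in> L2" for k
    using Plancherel_L1[OF trunc_integrable[OF f, of "real k"]] trunc_L2[OF f] by (auto simp: L2_iff ennreal_mult_less_top)
  have D2: "?D k \<in> L2" for k
    using L2_lincomb[OF F2[of k] fourier_L2_in_L2[OF f], of 1 "-1"] by simp
  have "(\<lambda>k. ennreal ((L2_norm (?D k))\<^sup>2)) \<longlonglongrightarrow> ennreal 0"
    using fourier_L2_limit[OF f] by (simp add: L2_norm_sq[OF D2])
  hence "(\<lambda>k. (L2_norm (?D k))\<^sup>2) \<longlonglongrightarrow> 0" by (subst (asm) tendsto_ennreal_iff) auto
  from tendsto_real_sqrt[OF this] have n0: "(\<lambda>k. L2_norm (?D k)) \<longlonglongrightarrow> 0" by simp
  have "(\<lambda>k. LINT \<xi>|lborel. ?D k \<xi> * \<psi> \<xi>) \<longlonglongrightarrow> 0"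
  proof (rule Lim_null_comparison)
    show "\<forall>\<^sub>F k in sequentially. norm (LINT \<xi>|lborel. ?D k \<xi> * \<psi> \<xi>) \<le> L2_norm (?D k) * L2_norm \<psi>"
      by (intro always_eventually allI L2_Cauchy_Schwarz D2 \<psi>)
    show "(\<lambda>k. L2_norm (?D k) * L2_norm \<psi>) \<longlonglongrightarrow> 0"
      using tendsto_mult[OF n0 tendsto_const, of "L2_norm \<psi>"] by simp
  qed
  moreover have "(LINT \<xi>|lborel. ?D k \<xi> * \<psi> \<xi>) = (LINT x|lborel. trunc (real k) f x * fourier \<psi> x) - (LINT \<xi>|lborel. fourier_L2 f \<xi> * \<psi> \<xi>)" for k
    using L2_mult_integrable[OF F2[of k] \<psi>(1)] L2_mult_integrable[OF fourier_L2_in_L2[OF f] \<psi>(1)]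
    by (simp add: left_diff_distrib fourier_multiplication[OF trunc_integrable[OF f] \<psi>(2)])
  ultimately have "(\<lambda>k. (LINT x|lborel. trunc (real k) f x * fourier \<psi> x) - (LINT \<xi>|lborel. fourier_L2 f \<xi> * \<psi> \<xi>)) \<longlonglongrightarrow> 0"
    by simp
  hence 1: "(\<lambda>k. LINT x|lborel. trunc (real k) f x * fourier \<psi> x) \<longlonglongrightarrow> (LINT \<xi>|lborel. fourier_L2 f \<xi> * \<psi> \<xi>)"
    by (simp add: LIM_zero_iff)
  have "(\<lambda>k. LINT x|lborel. trunc (real k) f x * fourier \<psi> x) \<longlonglongrightarrow> (LINT x|lborel. f x * fourier \<psi> x)"
  proof (rule integral_dominated_convergence[where w = "\<lambda>x. cmod (f x * fourier \<psi> x)"])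
    show "AE x in lborel. (\<lambda>k. trunc (real k) f x * fourier \<psi> x) \<longlonglongrightarrow> f x * fourier \<psi> x"
      by (intro AE_I2 tendsto_eventually) (use trunc_eventually[of f] in \<open>auto elim!: eventually_mono\<close>)
    show "integrable lborel (\<lambda>x. cmod (f x * fourier \<psi> x))"
      by (intro integrable_norm L2_mult_integrable f \<psi>2)
    show "AE x in lborel. norm (trunc (real k) f x * fourier \<psi> x) \<le> cmod (f x * fourier \<psi> x)" for k
      by (intro AE_I2) (auto simp: trunc_def indicator_def)
  qed measurable
  from LIMSEQ_unique[OF 1 this]
  show "(LINT \<xi>|lborel. fourier_L2 f \<xi> * \<psi> \<xi>) = (LINT x|lborel. f x * fourier \<psi> x)" .
qed

section \<open>Gaussian test functions and the equation in frequency space\<close>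

text \<open>
  The case \<open>s = 1\<close> of the functions in \<open>fourier_gaussian\<close>; the factor \<open>1\<close> keeps the two forms
  syntactically equal.
\<close>

abbreviation gauss_wave :: "real^'n \<Rightarrow> real^'n \<Rightarrow> complex" where
  "gauss_wave y \<equiv> (\<lambda>\<xi>. exp (\<i> * complex_of_real (\<xi> \<bullet> y)) * complex_of_real (exp (- (1 * norm \<xi>)\<^sup>2 / 2)))"

text \<open>
  A class of functions stable under multiplication by polynomials, all of whose members lie
  in \<open>L\<^sup>1\<close> and \<open>L\<^sup>2\<close>. The exponent \<open>1/8\<close> is one choice below the \<open>1/2\<close> in the Gaussians of \<open>gauss_wave\<close>;
  the gap absorbs powers of \<open>1 + norm \<xi>\<close>.
\<close>

definition gauss_rapid :: "(real^'n \<Rightarrow> complex) \<Rightarrow> bool" where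
  "gauss_rapid f \<longleftrightarrow> f \<in> borel_measurable borel \<and>
     (\<forall>k::nat. \<exists>C. \<forall>\<xi>. (1 + norm \<xi>) ^ k * cmod (f \<xi>) \<le> C * exp (- (norm \<xi>)\<^sup>2 / 8))"

lemma integrable_exp_norm_sq:
  "integrable lborel (\<lambda>\<xi>::real^'n. exp (- (norm \<xi>)\<^sup>2 / 8))" "integrable lborel (\<lambda>\<xi>::real^'n. exp (- (norm \<xi>)\<^sup>2 / 4))"
proof -
  have "(1/2 * r)\<^sup>2 / 2 = r\<^sup>2 / 8" "(sqrt (1/2) * r)\<^sup>2 / 2 = r\<^sup>2 / 4" for r :: real
    by (auto simp: power_mult_distrib power_divide)
  hence *: "- (1/2 * r)\<^sup>2 / 2 = - r\<^sup>2 / 8" "- (sqrt (1/2) * r)\<^sup>2 / 2 = - r\<^sup>2 / 4" for r :: real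
    by (metis minus_divide_left)+
  show "integrable lborel (\<lambda>\<xi>::real^'n. exp (- (norm \<xi>)\<^sup>2 / 8))" "integrable lborel (\<lambda>\<xi>::real^'n. exp (- (norm \<xi>)\<^sup>2 / 4))"
    using integrable_gaussian[where 'n='n, of "1/2"] integrable_gaussian[where 'n='n, of "sqrt (1/2)"]
    unfolding * by auto
qed

lemma gauss_rapid_measurable: "gauss_rapid f \<Longrightarrow> f \<in> borel_measurable borel"
  by (simp add: gauss_rapid_def)

lemma gauss_rapid_bound:
  assumes "gauss_rapid f"
  obtains C where "C \<ge> 0" "\<And>\<xi>. (1 + norm \<xi>) ^ k * cmod (f \<xi>) \<le> C * exp (- (norm \<xi>)\<^sup>2 / 8)"
proof -
  obtain C where C: "\<And>\<xi>. (1 + norm \<xi>) ^ k * cmod (f \<xi>) \<le> C * exp (- (norm \<xi>)\<^sup>2 / 8)"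
    using assms unfolding gauss_rapid_def by blast
  have "0 \<le> C * exp (- (norm (0::real^'b))\<^sup>2 / 8)"
    using order_trans[OF _ C[of 0]] by simp
  hence "C \<ge> 0" by simp
  thus ?thesis using C that by blast
qed

lemma gauss_rapid_moment_integrable:
  fixes f :: "real^'n \<Rightarrow> complex"
  assumes f: "gauss_rapid f"
  shows "integrable lborel (\<lambda>\<xi>. (1 + norm \<xi>) ^ k * cmod (f \<xi>))"
proof -
  note [measurable] = gauss_rapid_measurable[OF f]
  obtain C where C: "C \<ge> 0" "\<And>\<xi>. (1 + norm \<xi>) ^ k * cmod (f \<xi>) \<le> C * exp (- (norm \<xi>)\<^sup>2 / 8)"
    using gauss_rapid_bound[OF f] by metis
  show ?thesis
  proof (rule Bochner_Integration.integrable_bound)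
    show "integrable lborel (\<lambda>\<xi>::real^'n. C * exp (- (norm \<xi>)\<^sup>2 / 8))"
      by (intro integrable_mult_right integrable_exp_norm_sq)
    show "AE \<xi> in lborel. norm ((1 + norm \<xi>) ^ k * cmod (f \<xi>)) \<le> norm (C * exp (- (norm \<xi>)\<^sup>2 / 8))"
      using C by (intro AE_I2) (simp add: abs_mult)
  qed measurable
qed

lemma gauss_rapid_integrable:
  assumes f: "gauss_rapid f"
  shows "integrable lborel f"
  by (rule Bochner_Integration.integrable_bound[OF gauss_rapid_moment_integrable[OF f, of 0]])
     (use gauss_rapid_measurable[OF f] in auto)

lemma gauss_rapid_L2:
  fixes f :: "real^'n \<Rightarrow> complex"
  assumes f: "gauss_rapid f"
  shows "f \<in> L2"
proof -
  note [measurable] = gauss_rapid_measurable[OF f]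
  obtain C where C: "C \<ge> 0" "\<And>\<xi>. cmod (f \<xi>) \<le> C * exp (- (norm \<xi>)\<^sup>2 / 8)"
    using gauss_rapid_bound[OF f, of 0] by auto
  have "integrable lborel (\<lambda>\<xi>. (cmod (f \<xi>))\<^sup>2)"
  proof (rule Bochner_Integration.integrable_bound)
    show "integrable lborel (\<lambda>\<xi>::real^'n. C\<^sup>2 * exp (- (norm \<xi>)\<^sup>2 / 4))"
      by (intro integrable_mult_right integrable_exp_norm_sq)
    have "(cmod (f \<xi>))\<^sup>2 \<le> C\<^sup>2 * exp (- (norm \<xi>)\<^sup>2 / 4)" for \<xi>
    proof -
      have "(cmod (f \<xi>))\<^sup>2 \<le> (C * exp (- (norm \<xi>)\<^sup>2 / 8))\<^sup>2"
        using C by (intro power_mono) auto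
      thus ?thesis by (simp add: power_mult_distrib flip: exp_double)
    qed
    thus "AE \<xi> in lborel. norm ((cmod (f \<xi>))\<^sup>2) \<le> norm (C\<^sup>2 * exp (- (norm \<xi>)\<^sup>2 / 4))"
      by (intro AE_I2) simp
  qed measurable
  thus ?thesis by (simp add: L2_def)
qed

lemma gauss_rapid_mult:
  fixes f q :: "real^'n \<Rightarrow> complex"
  assumes f: "gauss_rapid f" and [measurable]: "q \<in> borel_measurable borel"
    and q: "\<And>\<xi>. cmod (q \<xi>) \<le> (1 + norm \<xi>) ^ m"
  shows "gauss_rapid (\<lambda>\<xi>. q \<xi> * f \<xi>)"
  unfolding gauss_rapid_def
proof (intro conjI allI)
  note [measurable] = gauss_rapid_measurable[OF f]
  show "(\<lambda>\<xi>. q \<xi> * f \<xi>) \<in> borel_measurable borel" by measurable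
  fix k
  obtain C where C: "\<And>\<xi>. (1 + norm \<xi>) ^ (k + m) * cmod (f \<xi>) \<le> C * exp (- (norm \<xi>)\<^sup>2 / 8)"
    using gauss_rapid_bound[OF f] by metis
  show "\<exists>C. \<forall>\<xi>. (1 + norm \<xi>) ^ k * cmod (q \<xi> * f \<xi>) \<le> C * exp (- (norm \<xi>)\<^sup>2 / 8)"
  proof (intro exI allI)
    fix \<xi>
    have "(1 + norm \<xi>) ^ k * cmod (q \<xi> * f \<xi>) = ((1 + norm \<xi>) ^ k * cmod (f \<xi>)) * cmod (q \<xi>)"
      by (simp add: norm_mult)
    also have "\<dots> \<le> ((1 + norm \<xi>) ^ k * cmod (f \<xi>)) * (1 + norm \<xi>) ^ m"
      by (intro mult_left_mono q) auto
    also have "\<dots> = (1 + norm \<xi>) ^ (k + m) * cmod (f \<xi>)" by (simp add: power_add)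
    also have "\<dots> \<le> C * exp (- (norm \<xi>)\<^sup>2 / 8)" by (rule C)
    finally show "(1 + norm \<xi>) ^ k * cmod (q \<xi> * f \<xi>) \<le> C * exp (- (norm \<xi>)\<^sup>2 / 8)" .
  qed
qed

lemma power_le_fact_exp:
  fixes x :: real
  assumes "x \<ge> 0"
  shows "x ^ k \<le> fact k * exp x"
proof -
  have "x ^ k /\<^sub>R fact k \<le> exp x"
    unfolding exp_def
    using sum_le_suminf[OF summable_exp_generic[of x], of "{k}"] assms by auto
  thus ?thesis by (simp add: field_simps)
qed

lemma gauss_rapid_wave:
  fixes y :: "real^'n"
  shows "gauss_rapid (gauss_wave y)"
  unfolding gauss_rapid_def
proof (intro conjI allI)
  show "(gauss_wave y) \<in> borel_measurable borel"
    by measurable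
  fix k :: nat
  show "\<exists>C. \<forall>\<xi>::real^'n. (1 + norm \<xi>) ^ k * cmod (exp (\<i> * complex_of_real (\<xi> \<bullet> y)) * exp (- (1 * norm \<xi>)\<^sup>2 / 2)) \<le> C * exp (- (norm \<xi>)\<^sup>2 / 8)"
  proof (intro exI allI)
    fix \<xi> :: "real^'n"
    let ?r = "norm \<xi>"
    have "(1 + ?r) ^ k * exp (- ?r\<^sup>2 / 2) \<le> fact k * exp (1 + ?r) * exp (- ?r\<^sup>2 / 2)"
      by (intro mult_right_mono power_le_fact_exp) auto
    also have "\<dots> = fact k * exp (1 + ?r - ?r\<^sup>2 / 2)" by (simp add: mult_exp_exp)
    \<comment> \<open>3/8 r^2 - r + 1 = 3/8 (r - 4/3)^2 + 1/3\<close>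
    also have "1 + ?r - ?r\<^sup>2 / 2 \<le> 2 + - ?r\<^sup>2 / 8"
      using zero_le_power2[of "?r - 4/3"] by (simp add: power2_eq_square field_simps)
    hence "fact k * exp (1 + ?r - ?r\<^sup>2 / 2) \<le> fact k * exp (2 + - ?r\<^sup>2 / 8)" by simp
    also have "\<dots> = (fact k * exp 2) * exp (- ?r\<^sup>2 / 8)" by (simp only: exp_add mult.assoc)
    finally show "(1 + norm \<xi>) ^ k * cmod (exp (\<i> * complex_of_real (\<xi> \<bullet> y)) * exp (- (1 * norm \<xi>)\<^sup>2 / 2)) \<le> (fact k * exp 2) * exp (- (norm \<xi>)\<^sup>2 / 8)"
      by (simp add: norm_mult)
  qed
qed

text \<open>
  Differentiation under the integral sign. The Taylor estimate \<open>\<bar>e\<^sup>i\<^sup>t - 1 - i t\<bar> \<le> t\<^sup>2\<close> bounds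
  the remainder by \<open>\<bar>h\<bar>\<^sup>2\<close> times a second moment of \<open>f\<close>.
\<close>

lemma fourier_has_derivative:
  fixes f :: "real^'n \<Rightarrow> complex"
  assumes f: "gauss_rapid f"
  shows "(fourier f has_derivative (\<lambda>h. fourier (\<lambda>\<xi>. (- \<i> * complex_of_real (h \<bullet> \<xi>)) * f \<xi>) x)) (at x)"
proof -
  note [measurable] = gauss_rapid_measurable[OF f]
  note int = gauss_rapid_integrable[OF f]
  let ?e = "\<lambda>\<xi>::real^'n. exp (- \<i> * complex_of_real (x \<bullet> \<xi>))"
  let ?L = "\<lambda>h. fourier (\<lambda>\<xi>. (- \<i> * complex_of_real (h \<bullet> \<xi>)) * f \<xi>) x"
  let ?M = "\<lambda>k::nat. LINT \<xi>|lborel. (1 + norm \<xi>) ^ k * cmod (f \<xi>)"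
  have CS: "\<bar>h \<bullet> \<xi>\<bar> \<le> norm h * (1 + norm \<xi>)" for h \<xi> :: "real^'n"
    using Cauchy_Schwarz_ineq2[of h \<xi>] by (simp add: algebra_simps) (smt (verit) norm_ge_zero)
  have le: "cmod ((- \<i> * complex_of_real (h \<bullet> \<xi>)) * f \<xi>) \<le> norm h * ((1 + norm \<xi>) ^ 1 * cmod (f \<xi>))" for h \<xi>
    using mult_right_mono[OF CS, of "cmod (f \<xi>)"] by (simp add: mult.assoc norm_mult)
  have intL: "integrable lborel (\<lambda>\<xi>. (- \<i> * complex_of_real (h \<bullet> \<xi>)) * f \<xi>)" for h
  proof (rule Bochner_Integration.integrable_bound)
    show "integrable lborel (\<lambda>\<xi>. norm h * ((1 + norm \<xi>) ^ 1 * cmod (f \<xi>)))"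
      by (intro integrable_mult_right gauss_rapid_moment_integrable f)
    show "AE \<xi> in lborel. norm ((- \<i> * complex_of_real (h \<bullet> \<xi>)) * f \<xi>) \<le> norm (norm h * ((1 + norm \<xi>) ^ 1 * cmod (f \<xi>)))"
      using le by (intro AE_I2) (auto intro: order_trans[OF _ abs_ge_self])
  qed measurable
  have bl: "bounded_linear ?L"
  proof (rule bounded_linear_intro)
    show "?L (h + k) = ?L h + ?L k" for h k
      using fourier_lincomb[OF intL[of h] intL[of k], of 1 1 x] by (simp add: inner_add_left algebra_simps)
    show "?L (r *\<^sub>R h) = r *\<^sub>R ?L h" for r h
      using fourier_lincomb[OF intL[of h] intL[of h], of "of_real r" 0 x] by (simp add: scaleR_conv_of_real[where 'a=complex] algebra_simps)
    show "norm (?L h) \<le> norm h * ?M 1" for h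
    proof -
      have "norm (?L h) \<le> (LINT \<xi>|lborel. cmod ((- \<i> * complex_of_real (h \<bullet> \<xi>)) * f \<xi>))" by (rule cmod_fourier_le)
      also have "\<dots> \<le> (LINT \<xi>|lborel. norm h * ((1 + norm \<xi>) ^ 1 * cmod (f \<xi>)))"
        by (intro integral_mono le integrable_norm intL integrable_mult_right gauss_rapid_moment_integrable f)
      finally show ?thesis by simp
    qed
  qed
  have rem: "norm (fourier f (x + h) - fourier f x - ?L h) \<le> (norm h)\<^sup>2 * ?M 2" for h
  proof -
    have i1: "integrable lborel (\<lambda>\<xi>. f \<xi> * exp (- \<i> * complex_of_real ((x + h) \<bullet> \<xi>)))"
      and i2: "integrable lborel (\<lambda>\<xi>. f \<xi> * ?e \<xi>)"
      and i3: "integrable lborel (\<lambda>\<xi>. (- \<i> * complex_of_real (h \<bullet> \<xi>)) * f \<xi> * ?e \<xi>)"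
      by (intro integrable_fourier_integrand int intL)+
    let ?R = "\<lambda>\<xi>. f \<xi> * exp (- \<i> * complex_of_real ((x + h) \<bullet> \<xi>)) - f \<xi> * ?e \<xi> - (- \<i> * complex_of_real (h \<bullet> \<xi>)) * f \<xi> * ?e \<xi>"
    have eq: "fourier f (x + h) - fourier f x - ?L h = (LINT \<xi>|lborel. ?R \<xi>)"
      unfolding fourier_def using i1 i2 i3 by (simp only: Bochner_Integration.integral_diff Bochner_Integration.integrable_diff)
    have "norm (LINT \<xi>|lborel. ?R \<xi>) \<le> (LINT \<xi>|lborel. norm (?R \<xi>))" by (rule integral_norm_bound)
    also have "\<dots> \<le> (LINT \<xi>|lborel. (norm h)\<^sup>2 * ((1 + norm \<xi>) ^ 2 * cmod (f \<xi>)))"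
    proof (rule integral_mono)
      show "integrable lborel (\<lambda>\<xi>. norm (?R \<xi>))"
        by (intro integrable_norm Bochner_Integration.integrable_diff i1 i2 i3)
      show "integrable lborel (\<lambda>\<xi>. (norm h)\<^sup>2 * ((1 + norm \<xi>) ^ 2 * cmod (f \<xi>)))"
        by (intro integrable_mult_right gauss_rapid_moment_integrable f)
      fix \<xi>
      let ?t = "- (h \<bullet> \<xi>)"
      have "?R \<xi> = f \<xi> * ?e \<xi> * (iexp ?t - (\<Sum>k\<le>1. (\<i> * ?t)^k / fact k))"
        by (simp add: inner_add_left algebra_simps exp_add[symmetric] exp_diff[symmetric])
      hence "norm (?R \<xi>) = cmod (f \<xi>) * cmod (iexp ?t - (\<Sum>k\<le>1. (\<i> * ?t)^k / fact k))"
        by (simp add: norm_mult)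
      also have "\<dots> \<le> cmod (f \<xi>) * ((norm h)\<^sup>2 * (1 + norm \<xi>) ^ 2)"
      proof (intro mult_left_mono)
        have "cmod (iexp ?t - (\<Sum>k\<le>1. (\<i> * ?t)^k / fact k)) \<le> \<bar>?t\<bar> ^ Suc 1 / fact (Suc 1)"
          by (rule iexp_approx1)
        also have "\<dots> \<le> \<bar>?t\<bar>\<^sup>2" by (simp add: power2_eq_square)
        also have "\<dots> \<le> (norm h * (1 + norm \<xi>))\<^sup>2"
          using CS[of h \<xi>] by (intro power_mono) simp_all
        finally show "cmod (iexp ?t - (\<Sum>k\<le>1. (\<i> * ?t)^k / fact k)) \<le> (norm h)\<^sup>2 * (1 + norm \<xi>) ^ 2"
          by (simp add: power_mult_distrib)
      qed simp
      finally show "norm (?R \<xi>) \<le> (norm h)\<^sup>2 * ((1 + norm \<xi>) ^ 2 * cmod (f \<xi>))" by (simp add: mult_ac)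
    qed
    finally show ?thesis unfolding eq by simp
  qed
  have "(\<lambda>h. norm (fourier f (x + h) - fourier f x - ?L h) / norm h) \<midarrow>0\<rightarrow> 0"
  proof (rule Lim_null_comparison)
    show "\<forall>\<^sub>F h in at 0. norm (norm (fourier f (x + h) - fourier f x - ?L h) / norm h) \<le> norm h * ?M 2"
    proof (rule always_eventually, rule allI)
      fix h
      show "norm (norm (fourier f (x + h) - fourier f x - ?L h) / norm h) \<le> norm h * ?M 2"
        using rem[of h] by (cases "h = 0") (auto simp: field_simps power2_eq_square)
    qed
    have "((\<lambda>h. norm h * ?M 2) \<longlongrightarrow> norm (0::real^'n) * ?M 2) (at (0::real^'n))"
      by (rule tendsto_mult[OF tendsto_norm[OF tendsto_ident_at] tendsto_const])
    thus "((\<lambda>h. norm h * ?M 2) \<longlongrightarrow> 0) (at (0::real^'n))" by simp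
  qed
  with bl show ?thesis by (simp add: has_derivative_at)
qed

lemma gauss_rapid_component:
  fixes f :: "real^'n \<Rightarrow> complex"
  assumes f: "gauss_rapid f"
  shows "gauss_rapid (\<lambda>\<xi>. (- \<i> * complex_of_real (\<xi> $ i)) * f \<xi>)"
proof (rule gauss_rapid_mult[where m=1, OF f])
  show "cmod (- \<i> * complex_of_real (\<xi> $ i)) \<le> (1 + norm \<xi>) ^ 1" for \<xi> :: "real^'n"
    using component_le_norm_cart[of \<xi> i] by (simp add: norm_mult)
qed measurable

lemma partial_deriv_fourier:
  fixes f :: "real^'n \<Rightarrow> complex"
  assumes f: "gauss_rapid f"
  shows "partial_deriv i (fourier f) = fourier (\<lambda>\<xi>. (- \<i> * complex_of_real (\<xi> $ i)) * f \<xi>)"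
proof
  fix x
  show "partial_deriv i (fourier f) x = fourier (\<lambda>\<xi>. (- \<i> * complex_of_real (\<xi> $ i)) * f \<xi>) x"
    unfolding partial_deriv_def frechet_derivative_at[OF fourier_has_derivative[OF f, of x], symmetric]
    by (simp add: inner_axis')
qed

lemma fourier_sum:
  assumes "finite I" "\<And>i. i \<in> I \<Longrightarrow> integrable lborel (f i)"
  shows "(\<Sum>i\<in>I. fourier (f i) x) = fourier (\<lambda>\<xi>. \<Sum>i\<in>I. f i \<xi>) x"
  unfolding fourier_def sum_distrib_right
  by (subst Bochner_Integration.integral_sum) (auto intro!: integrable_fourier_integrand[simplified] assms)

lemma gauss_rapid_sq_norm:
  fixes f :: "real^'n \<Rightarrow> complex"
  assumes f: "gauss_rapid f"
  shows "gauss_rapid (\<lambda>\<xi>. complex_of_real (- (norm \<xi>)\<^sup>2) * f \<xi>)"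
proof (rule gauss_rapid_mult[where m=2, OF f])
  show "cmod (complex_of_real (- (norm \<xi>)\<^sup>2)) \<le> (1 + norm \<xi>) ^ 2" for \<xi> :: "real^'n"
    by (simp add: norm_power power_mono)
qed measurable

lemma laplacian_fourier:
  fixes f :: "real^'n \<Rightarrow> complex"
  assumes f: "gauss_rapid f"
  shows "laplacian (fourier f) = fourier (\<lambda>\<xi>. complex_of_real (- (norm \<xi>)\<^sup>2) * f \<xi>)"
proof
  fix x
  let ?g = "\<lambda>i \<xi>. (- \<i> * complex_of_real (\<xi> $ i)) * ((- \<i> * complex_of_real (\<xi> $ i)) * f \<xi>)"
  have "laplacian (fourier f) x = (\<Sum>i\<in>UNIV. fourier (?g i) x)"
    unfolding laplacian_def partial_deriv_fourier[OF f] partial_deriv_fourier[OF gauss_rapid_component[OF f]] ..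
  also have "\<dots> = fourier (\<lambda>\<xi>. \<Sum>i\<in>UNIV. ?g i \<xi>) x"
    by (rule fourier_sum) (auto intro!: gauss_rapid_integrable gauss_rapid_component[OF gauss_rapid_component[OF f], simplified])
  also have "(\<lambda>\<xi>. \<Sum>i\<in>UNIV. ?g i \<xi>) = (\<lambda>\<xi>. complex_of_real (- (norm \<xi>)\<^sup>2) * f \<xi>)"
  proof
    fix \<xi> :: "real^'n"
    have "(norm \<xi>)\<^sup>2 = (\<Sum>i\<in>UNIV. (\<xi> $ i)\<^sup>2)"
      by (simp add: norm_vec_def L2_set_def sum_nonneg)
    moreover have "?g i \<xi> = - (complex_of_real ((\<xi> $ i)\<^sup>2) * f \<xi>)" for i
      by (simp add: power2_eq_square algebra_simps)
    ultimately show "(\<Sum>i\<in>UNIV. ?g i \<xi>) = complex_of_real (- (norm \<xi>)\<^sup>2) * f \<xi>"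
      by (simp add: sum_negf sum_distrib_right)
  qed
  finally show "laplacian (fourier f) x = fourier (\<lambda>\<xi>. complex_of_real (- (norm \<xi>)\<^sup>2) * f \<xi>) x" .
qed

text \<open>
  Polynomials times the Gaussian centred at \<open>y\<close>, generated so that membership is visibly
  preserved by differentiation.
\<close>

inductive_set gauss_poly :: "real^'n \<Rightarrow> (real^'n \<Rightarrow> complex) set" for y :: "real^'n" where
  base: "(\<lambda>x. complex_of_real (exp (- (norm (x - y))\<^sup>2 / 2))) \<in> gauss_poly y"
| coord: "f \<in> gauss_poly y \<Longrightarrow> (\<lambda>x. complex_of_real ((x - y) $ i) * f x) \<in> gauss_poly y"
| add: "f \<in> gauss_poly y \<Longrightarrow> g \<in> gauss_poly y \<Longrightarrow> (\<lambda>x. f x + g x) \<in> gauss_poly y"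
| cmult: "f \<in> gauss_poly y \<Longrightarrow> (\<lambda>x. c * f x) \<in> gauss_poly y"

lemma gauss_poly_deriv:
  fixes y :: "real^'n"
  assumes "f \<in> gauss_poly y"
  shows "\<exists>f'. (\<forall>x. (f has_derivative f' x) (at x)) \<and> (\<forall>i. (\<lambda>x. f' x (axis i 1)) \<in> gauss_poly y)"
  using assms
proof induction
  case base
  let ?f' = "\<lambda>x h. complex_of_real (- ((x - y) \<bullet> h) * exp (- (norm (x - y))\<^sup>2 / 2))"
  have "((\<lambda>x. exp (- ((x - y) \<bullet> (x - y)) / 2)) has_derivative (\<lambda>h. - ((x - y) \<bullet> h) * exp (- (norm (x - y))\<^sup>2 / 2))) (at x)" for x
    by (auto intro!: derivative_eq_intros simp: power2_norm_eq_inner inner_commute field_simps)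
  from has_derivative_of_real[OF this]
  have "((\<lambda>x. complex_of_real (exp (- ((x - y) \<bullet> (x - y)) / 2))) has_derivative ?f' x) (at x)" for x .
  moreover have "(\<lambda>x. ?f' x (axis i 1)) \<in> gauss_poly y" for i
    using gauss_poly.cmult[OF gauss_poly.coord[OF gauss_poly.base], of "-1" y i] by (simp add: inner_axis algebra_simps)
  ultimately show ?case by (intro exI[of _ ?f']) (simp add: power2_norm_eq_inner)
next
  case (coord f i)
  then obtain f' where f': "\<And>x. (f has_derivative f' x) (at x)" "\<And>j. (\<lambda>x. f' x (axis j 1)) \<in> gauss_poly y" by blast
  let ?g = "\<lambda>x h. complex_of_real ((x - y) $ i) * f' x h + complex_of_real (h $ i) * f x"
  have "((\<lambda>x. complex_of_real ((x - y) $ i) * f x) has_derivative ?g x) (at x)" for x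
    by (auto intro!: derivative_eq_intros f'(1) bounded_linear_imp_has_derivative[OF bounded_linear_vec_nth])
  moreover have "(\<lambda>x. ?g x (axis j 1)) \<in> gauss_poly y" for j
    by (intro gauss_poly.add gauss_poly.coord gauss_poly.cmult f' coord)
  ultimately show ?case by (intro exI[of _ ?g] conjI allI)
next
  case (add f g)
  then obtain f' g' where "\<And>x. (f has_derivative f' x) (at x)" "\<And>j. (\<lambda>x. f' x (axis j 1)) \<in> gauss_poly y"
    "\<And>x. (g has_derivative g' x) (at x)" "\<And>j. (\<lambda>x. g' x (axis j 1)) \<in> gauss_poly y" by blast
  thus ?case
    by (intro exI[of _ "\<lambda>x h. f' x h + g' x h"]) (auto intro!: has_derivative_add gauss_poly.add)
next
  case (cmult f c)
  then obtain f' where "\<And>x. (f has_derivative f' x) (at x)" "\<And>j. (\<lambda>x. f' x (axis j 1)) \<in> gauss_poly y" by blast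
  thus ?case
    by (intro exI[of _ "\<lambda>x h. c * f' x h"]) (auto intro!: has_derivative_mult_right gauss_poly.cmult)
qed

lemma gauss_poly_bounded:
  fixes y :: "real^'n"
  assumes "f \<in> gauss_poly y"
  shows "\<exists>C. \<forall>x. (1 + norm x) ^ k * cmod (f x) \<le> C"
  using assms
proof (induction arbitrary: k)
  case base
  show ?case
  proof (intro exI allI)
    fix x :: "real^'n"
    let ?r = "norm (x - y)"
    have "norm x \<le> ?r + norm y" using norm_triangle_sub[of x y] by simp
    moreover have "0 \<le> norm y * ?r" by simp
    moreover have "(1 + norm y) * (1 + ?r) = 1 + ?r + norm y + norm y * ?r" by (simp add: algebra_simps)
    ultimately have "1 + norm x \<le> (1 + norm y) * (1 + ?r)" by linarith
    hence "(1 + norm x) ^ k \<le> ((1 + norm y) * (1 + ?r)) ^ k" by (intro power_mono) auto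
    also have "\<dots> \<le> (1 + norm y) ^ k * (fact k * exp (1 + ?r))"
      unfolding power_mult_distrib by (intro mult_left_mono power_le_fact_exp) auto
    finally have "(1 + norm x) ^ k * exp (- ?r\<^sup>2 / 2) \<le> (1 + norm y) ^ k * (fact k * exp (1 + ?r)) * exp (- ?r\<^sup>2 / 2)"
      by (rule mult_right_mono) simp
    also have "\<dots> = (1 + norm y) ^ k * fact k * exp (1 + ?r + - ?r\<^sup>2 / 2)" by (simp only: exp_add mult_ac)
    also have "\<dots> \<le> (1 + norm y) ^ k * fact k * exp 2"
    proof -
      have "1 + ?r + - ?r\<^sup>2 / 2 \<le> 2"
        using zero_le_power2[of "?r - 1"] by (simp add: power2_eq_square algebra_simps)
      thus ?thesis by (intro mult_left_mono) auto
    qed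
    finally show "(1 + norm x) ^ k * cmod (complex_of_real (exp (- ?r\<^sup>2 / 2))) \<le> (1 + norm y) ^ k * fact k * exp 2"
      by simp
  qed
next
  case (coord f i)
  obtain C where C: "\<And>x. (1 + norm x) ^ Suc k * cmod (f x) \<le> C" using coord.IH by blast
  show ?case
  proof (intro exI allI)
    fix x :: "real^'n"
    have "\<bar>(x - y) $ i\<bar> \<le> norm x + norm y"
      using component_le_norm_cart[of "x - y" i] norm_triangle_ineq4[of x y] by linarith
    also have "\<dots> \<le> (1 + norm y) * (1 + norm x)" by (simp add: algebra_simps add_increasing)
    finally have "(1 + norm x) ^ k * cmod (f x) * \<bar>(x - y) $ i\<bar> \<le> (1 + norm x) ^ k * cmod (f x) * ((1 + norm y) * (1 + norm x))"
      by (intro mult_left_mono) auto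
    also have "\<dots> = (1 + norm y) * ((1 + norm x) ^ Suc k * cmod (f x))" by simp
    also have "\<dots> \<le> (1 + norm y) * C" by (intro mult_left_mono C) auto
    finally show "(1 + norm x) ^ k * cmod (complex_of_real ((x - y) $ i) * f x) \<le> (1 + norm y) * C"
      by (simp only: norm_mult norm_of_real mult_ac)
  qed
next
  case (add f g)
  obtain C D where C: "\<And>x. (1 + norm x) ^ k * cmod (f x) \<le> C" and D: "\<And>x. (1 + norm x) ^ k * cmod (g x) \<le> D"
    using add.IH by meson
  show ?case
  proof (intro exI allI)
    fix x :: "real^'n"
    have "(1 + norm x) ^ k * cmod (f x + g x) \<le> (1 + norm x) ^ k * (cmod (f x) + cmod (g x))"
      by (intro mult_left_mono norm_triangle_ineq) auto
    also have "\<dots> \<le> C + D" using C[of x] D[of x] by (simp add: distrib_left)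
    finally show "(1 + norm x) ^ k * cmod (f x + g x) \<le> C + D" .
  qed
next
  case (cmult f c)
  obtain C where C: "\<And>x. (1 + norm x) ^ k * cmod (f x) \<le> C" using cmult.IH by blast
  show ?case
  proof (intro exI allI)
    fix x :: "real^'n"
    have "cmod c * ((1 + norm x) ^ k * cmod (f x)) \<le> cmod c * C" by (intro mult_left_mono C) auto
    thus "(1 + norm x) ^ k * cmod (c * f x) \<le> cmod c * C" by (simp add: norm_mult mult_ac)
  qed
qed

lemma gauss_poly_schwartz:
  assumes f: "f \<in> gauss_poly y"
  shows "f \<in> schwartz"
proof -
  have pd: "partial_deriv i g \<in> gauss_poly y" "\<forall>x. g differentiable (at x)" if g: "g \<in> gauss_poly y" for g i
  proof -
    obtain g' where g': "\<And>x. (g has_derivative g' x) (at x)" "\<And>j. (\<lambda>x. g' x (axis j 1)) \<in> gauss_poly y"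
      using gauss_poly_deriv[OF g] by blast
    have "partial_deriv i g = (\<lambda>x. g' x (axis i 1))"
      unfolding partial_deriv_def[abs_def] using frechet_derivative_at[OF g'(1)] by metis
    thus "partial_deriv i g \<in> gauss_poly y" using g' by simp
    show "\<forall>x. g differentiable (at x)" using g'(1) by (auto simp: differentiable_def)
  qed
  have it: "iter_deriv is f \<in> gauss_poly y" for "is"
    unfolding iter_deriv_def by (induction "is") (auto intro: f pd)
  show ?thesis
    unfolding schwartz_def
  proof (safe intro!: CollectI)
    fix "is" x show "iter_deriv is f differentiable (at x)" using pd(2)[OF it] by blast
  next
    fix "is" :: "'a list" and k :: nat
    obtain C where "\<And>x. (1 + norm x) ^ k * cmod (iter_deriv is f x) \<le> C"
      using gauss_poly_bounded[OF it] by metis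
    thus "bounded (range (\<lambda>x. (1 + norm x) ^ k *\<^sub>R iter_deriv is f x))"
      unfolding bounded_iff by (intro exI[of _ C]) (auto simp: abs_of_nonneg)
  qed
qed

text \<open>
  These transforms serve as test functions. Explicitly they are multiples of translated
  Gaussians, hence Schwartz functions; as Fourier integrals they are accessible to
  \<open>laplacian_fourier\<close> and the multiplication formula.
\<close>

lemma fourier_wave_schwartz:
  fixes y :: "real^'n"
  shows "fourier (gauss_wave y) \<in> schwartz"
proof -
  have "fourier (gauss_wave y)
    = (\<lambda>x. complex_of_real ((2 * pi) ^ CARD('n) / sqrt (2 * pi) ^ CARD('n)) * complex_of_real (exp (- (norm (x - y))\<^sup>2 / 2)))"
  proof
    fix x
    show "fourier (gauss_wave y) x
      = complex_of_real ((2 * pi) ^ CARD('n) / sqrt (2 * pi) ^ CARD('n)) * complex_of_real (exp (- (norm (x - y))\<^sup>2 / 2))"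
      unfolding fourier_gaussian[of 1 y x, OF zero_less_one]
      by (simp add: gauss_eq norm_minus_commute[of x y])
  qed
  also have "\<dots> \<in> gauss_poly y" by (intro gauss_poly.cmult gauss_poly.base)
  finally show ?thesis by (rule gauss_poly_schwartz)
qed

text \<open>
  Testing with the Gaussian centred at \<open>y\<close> moves the equation to the frequency side, where it
  says that the symbol applied to the transforms, times \<open>exp (- \<bar>\<xi>\<bar>\<^sup>2 / 2)\<close>, has vanishing
  Fourier transform at \<open>- y\<close>. As \<open>y\<close> is arbitrary, uniqueness for integrable functions applies.
\<close>

lemma weak_equation_fourier:
  fixes u v w :: "real^'n \<Rightarrow> complex"
  assumes u: "u \<in> L2" and v: "v \<in> L2" and w: "w \<in> L2"
    and eq: "\<And>\<phi>. \<phi> \<in> schwartz \<Longrightarrow>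
       (LINT x|lborel. w x * \<phi> x - w x * laplacian \<phi> x
              + u x * laplacian (laplacian \<phi>) x - u x * laplacian \<phi> x + v x * \<phi> x) = 0"
  shows "AE \<xi> in lborel. (1 + (norm \<xi>)\<^sup>2) * fourier_L2 w \<xi>
     + ((norm \<xi>)\<^sup>2 * (1 + (norm \<xi>)\<^sup>2)) * fourier_L2 u \<xi> + fourier_L2 v \<xi> = 0"
proof -
  let ?U = "fourier_L2 u" and ?V = "fourier_L2 v" and ?W = "fourier_L2 w"
  let ?S = "\<lambda>\<xi>. (1 + (norm \<xi>)\<^sup>2) * ?W \<xi> + ((norm \<xi>)\<^sup>2 * (1 + (norm \<xi>)\<^sup>2)) * ?U \<xi> + ?V \<xi>"
  let ?H = "\<lambda>\<xi>::real^'n. ?S \<xi> * complex_of_real (exp (- (1 * norm \<xi>)\<^sup>2 / 2))"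
  have key: "integrable lborel (\<lambda>\<xi>. ?S \<xi> * (exp (\<i> * complex_of_real (\<xi> \<bullet> y)) * exp (- (1 * norm \<xi>)\<^sup>2 / 2)))
     \<and> (LINT \<xi>|lborel. ?S \<xi> * (exp (\<i> * complex_of_real (\<xi> \<bullet> y)) * exp (- (1 * norm \<xi>)\<^sup>2 / 2))) = 0" for y :: "real^'n"
  proof -
    \<comment> \<open>multiplication by - norm squared in frequency is the Laplacian of the transform, so p0,
      p1, p2 belong to the test function, its Laplacian and its bi-Laplacian\<close>
    define p0 where "p0 = gauss_wave y"
    define p1 where "p1 = (\<lambda>\<xi>. complex_of_real (- (norm \<xi>)\<^sup>2) * p0 \<xi>)"
    define p2 where "p2 = (\<lambda>\<xi>. complex_of_real (- (norm \<xi>)\<^sup>2) * p1 \<xi>)"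
    have r: "gauss_rapid p0" "gauss_rapid p1" "gauss_rapid p2"
      unfolding p2_def p1_def p0_def by (intro gauss_rapid_sq_norm gauss_rapid_wave)+
    have l1: "laplacian (fourier p0) = fourier p1" and l2: "laplacian (fourier p1) = fourier p2"
      unfolding p2_def p1_def using laplacian_fourier[OF r(1)] laplacian_fourier[OF r(2)] by (auto simp: p1_def)
    have m: "(LINT \<xi>|lborel. fourier_L2 f \<xi> * p \<xi>) = (LINT x|lborel. f x * fourier p x)"
      "integrable lborel (\<lambda>x. f x * fourier p x)" "integrable lborel (\<lambda>\<xi>. fourier_L2 f \<xi> * p \<xi>)"
      if "f \<in> L2" "gauss_rapid p" for f p :: "real^'n \<Rightarrow> complex"
      using fourier_L2_multiplication[OF that(1) gauss_rapid_L2[OF that(2)] gauss_rapid_integrable[OF that(2)]]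
      by (auto intro!: L2_mult_integrable that gauss_rapid_L2 fourier_L2_in_L2)
    have "fourier p0 \<in> schwartz" unfolding p0_def by (rule fourier_wave_schwartz)
    from eq[OF this, unfolded l1 l2]
    have "0 = (LINT x|lborel. w x * fourier p0 x) - (LINT x|lborel. w x * fourier p1 x) + (LINT x|lborel. u x * fourier p2 x)
       - (LINT x|lborel. u x * fourier p1 x) + (LINT x|lborel. v x * fourier p0 x)"
      using m(2)[OF u r(2)] m(2)[OF u r(3)] m(2)[OF w r(1)] m(2)[OF w r(2)] m(2)[OF v r(1)] by simp
    also have "\<dots> = (LINT \<xi>|lborel. ?W \<xi> * p0 \<xi>) - (LINT \<xi>|lborel. ?W \<xi> * p1 \<xi>) + (LINT \<xi>|lborel. ?U \<xi> * p2 \<xi>)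
       - (LINT \<xi>|lborel. ?U \<xi> * p1 \<xi>) + (LINT \<xi>|lborel. ?V \<xi> * p0 \<xi>)"
      by (simp only: m(1)[OF u r(2)] m(1)[OF u r(3)] m(1)[OF w r(1)] m(1)[OF w r(2)] m(1)[OF v r(1)])
    also have "\<dots> = (LINT \<xi>|lborel. ?W \<xi> * p0 \<xi> - ?W \<xi> * p1 \<xi> + ?U \<xi> * p2 \<xi> - ?U \<xi> * p1 \<xi> + ?V \<xi> * p0 \<xi>)"
      using m(3)[OF u r(2)] m(3)[OF u r(3)] m(3)[OF w r(1)] m(3)[OF w r(2)] m(3)[OF v r(1)] by simp
    finally have 1: "(LINT \<xi>|lborel. ?W \<xi> * p0 \<xi> - ?W \<xi> * p1 \<xi> + ?U \<xi> * p2 \<xi> - ?U \<xi> * p1 \<xi> + ?V \<xi> * p0 \<xi>) = 0" by simp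
    have 2: "integrable lborel (\<lambda>\<xi>. ?W \<xi> * p0 \<xi> - ?W \<xi> * p1 \<xi> + ?U \<xi> * p2 \<xi> - ?U \<xi> * p1 \<xi> + ?V \<xi> * p0 \<xi>)"
      using m(3)[OF u r(2)] m(3)[OF u r(3)] m(3)[OF w r(1)] m(3)[OF w r(2)] m(3)[OF v r(1)] by simp
    have 3: "(\<lambda>\<xi>. ?W \<xi> * p0 \<xi> - ?W \<xi> * p1 \<xi> + ?U \<xi> * p2 \<xi> - ?U \<xi> * p1 \<xi> + ?V \<xi> * p0 \<xi>) = (\<lambda>\<xi>. ?S \<xi> * p0 \<xi>)"
      unfolding p2_def p1_def by (simp add: algebra_simps power2_eq_square)
    show ?thesis using 1 2 unfolding 3 unfolding p0_def by simp
  qed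
  have "AE \<xi> in lborel. ?H \<xi> = 0"
  proof (rule fourier_inj_AE)
    show "integrable lborel ?H" using key[of 0] by simp
    fix y :: "real^'n"
    have "fourier ?H y = (LINT \<xi>|lborel. ?S \<xi> * (exp (\<i> * complex_of_real (\<xi> \<bullet> (- y))) * exp (- (1 * norm \<xi>)\<^sup>2 / 2)))"
      unfolding fourier_def by (intro Bochner_Integration.integral_cong refl) (simp add: inner_commute mult_ac)
    also have "\<dots> = 0" using key[of "- y"] by blast
    finally show "fourier ?H y = 0" .
  qed
  thus ?thesis by eventually_elim simp
qed

section \<open>Differentiating squared norms in time\<close>

text \<open>
  Differentiability at time \<open>t\<close> in the norm of \<open>L\<^sup>2\<close>, on the half-line and hence one-sided at \<open>0\<close>.
\<close>

definition has_L2_deriv ::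
  "(real \<Rightarrow> real^'n \<Rightarrow> complex) \<Rightarrow> (real^'n \<Rightarrow> complex) \<Rightarrow> real \<Rightarrow> bool" where
  "has_L2_deriv F F' t \<longleftrightarrow> (\<forall>r\<ge>0. F r \<in> L2) \<and> F' \<in> L2 \<and>
     ((\<lambda>r. L2_sq (\<lambda>\<xi>. (F r \<xi> - F t \<xi>) /\<^sub>R (r - t) - F' \<xi>)) \<longlongrightarrow> 0) (at t within {0..})"

lemma L2_sq_cong_AE:
  assumes "AE x in lborel. f x = g x"
  shows "L2_sq f = L2_sq g"
  unfolding L2_sq_def by (rule nn_integral_cong_AE) (use assms in eventually_elim, simp)

lemma has_L2_deriv_add:
  assumes F: "has_L2_deriv F F' t" and G: "has_L2_deriv G G' t" and t: "t \<ge> 0"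
  shows "has_L2_deriv (\<lambda>r \<xi>. F r \<xi> + G r \<xi>) (\<lambda>\<xi>. F' \<xi> + G' \<xi>) t"
  unfolding has_L2_deriv_def
proof (intro conjI allI impI)
  have L: "F r \<in> L2" "G r \<in> L2" if "r \<ge> 0" for r using F G that by (auto simp: has_L2_deriv_def)
  have L': "F' \<in> L2" "G' \<in> L2" using F G by (auto simp: has_L2_deriv_def)
  show "(\<lambda>\<xi>. F r \<xi> + G r \<xi>) \<in> L2" if "r \<ge> 0" for r
    using L2_lincomb[OF L[OF that], of 1 1] by simp
  show "(\<lambda>\<xi>. F' \<xi> + G' \<xi>) \<in> L2"
    using L2_lincomb[OF L', of 1 1] by simp
  let ?Q = "\<lambda>r. L2_sq (\<lambda>\<xi>. (F r \<xi> + G r \<xi> - (F t \<xi> + G t \<xi>)) /\<^sub>R (r - t) - (F' \<xi> + G' \<xi>))"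
  let ?f = "\<lambda>r \<xi>. (F r \<xi> - F t \<xi>) /\<^sub>R (r - t) - F' \<xi>" and ?g = "\<lambda>r \<xi>. (G r \<xi> - G t \<xi>) /\<^sub>R (r - t) - G' \<xi>"
  have lim: "((\<lambda>r. 2 * L2_sq (?f r) + 2 * L2_sq (?g r)) \<longlongrightarrow> 2 * 0 + 2 * 0) (at t within {0..})"
    using F G unfolding has_L2_deriv_def by (intro tendsto_add ennreal_tendsto_cmult) auto
  have lim: "((\<lambda>r. 2 * L2_sq (?f r) + 2 * L2_sq (?g r)) \<longlongrightarrow> 0) (at t within {0..})"
    using lim by simp
  show "((\<lambda>r. ?Q r) \<longlongrightarrow> 0) (at t within {0..})"
  proof (rule tendsto_sandwich[OF always_eventually _ tendsto_const lim])
    show "\<forall>\<^sub>F r in at t within {0..}. ?Q r \<le> 2 * L2_sq (?f r) + 2 * L2_sq (?g r)"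
      unfolding eventually_at_filter
    proof (intro always_eventually allI impI)
      fix r assume "r \<in> {0::real..}"
      note [measurable] = L[THEN L2_D(1)] L'[THEN L2_D(1)]
      have [measurable]: "F r \<in> borel_measurable borel" "F t \<in> borel_measurable borel"
        "G r \<in> borel_measurable borel" "G t \<in> borel_measurable borel"
        using L[THEN L2_D(1)] t \<open>r \<in> {0..}\<close> by auto
      have "(\<lambda>\<xi>. (F r \<xi> + G r \<xi> - (F t \<xi> + G t \<xi>)) /\<^sub>R (r - t) - (F' \<xi> + G' \<xi>)) = (\<lambda>\<xi>. ?f r \<xi> + ?g r \<xi>)"
        by (simp add: algebra_simps)
      thus "?Q r \<le> 2 * L2_sq (?f r) + 2 * L2_sq (?g r)"
        using L2_sq_add_le[of "?f r" "?g r"] by simp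
    qed
  qed simp
qed

lemma L2_cnj: "f \<in> L2 \<Longrightarrow> (\<lambda>x. cnj (f x)) \<in> L2"
  using measurable_compose[OF _ borel_measurable_continuous_onI[of cnj], of f borel]
  by (auto simp: L2_def intro: continuous_intros)

text \<open>
  With \<open>q = (F r - F t) / (r - t)\<close> the difference quotient of the squared norm is
  \<open>2 Re \<langle>q, F t\<rangle> + (r - t) \<bar>q\<bar>\<^sup>2\<close>, and \<open>q\<close> tends to \<open>F'\<close> in norm.
\<close>

lemma has_L2_deriv_norm_sq:
  fixes F :: "real \<Rightarrow> real^'n \<Rightarrow> complex"
  assumes F: "has_L2_deriv F F' t" and t: "t \<ge> 0"
  shows "((\<lambda>r. LINT \<xi>|lborel. (cmod (F r \<xi>))\<^sup>2) has_real_derivative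
     (LINT \<xi>|lborel. 2 * Re (F' \<xi> * cnj (F t \<xi>)))) (at t within {0..})"
proof -
  have L: "F r \<in> L2" if "r \<ge> 0" for r using F that by (auto simp: has_L2_deriv_def)
  have L': "F' \<in> L2" using F by (auto simp: has_L2_deriv_def)
  let ?e = "\<lambda>r \<xi>. (F r \<xi> - F t \<xi>) /\<^sub>R (r - t) - F' \<xi>"
  let ?n = "\<lambda>r. LINT \<xi>|lborel. (cmod (F r \<xi>))\<^sup>2"
  let ?D = "LINT \<xi>|lborel. 2 * Re (F' \<xi> * cnj (F t \<xi>))"
  have e2: "?e r \<in> L2" if "r \<ge> 0" for r
    using L2_lincomb[OF L2_lincomb[OF L[OF that] L[OF t], of "of_real (inverse (r - t))" "- of_real (inverse (r - t))"] L', of 1 "-1"]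
    by (simp add: scaleR_conv_of_real algebra_simps)
  have "((\<lambda>r. L2_sq (?e r)) \<longlongrightarrow> 0) (at t within {0..})"
    using F by (simp add: has_L2_deriv_def)
  moreover have "\<forall>\<^sub>F r in at t within {0..}. L2_sq (?e r) = ennreal ((L2_norm (?e r))\<^sup>2)"
    unfolding eventually_at_filter using L2_norm_sq[OF e2] by (intro always_eventually) auto
  ultimately have "((\<lambda>r. ennreal ((L2_norm (?e r))\<^sup>2)) \<longlongrightarrow> ennreal 0) (at t within {0..})"
    using tendsto_cong by force
  hence "((\<lambda>r. (L2_norm (?e r))\<^sup>2) \<longlongrightarrow> 0) (at t within {0..})" by (subst (asm) tendsto_ennreal_iff) auto
  from tendsto_real_sqrt[OF this] have n0: "((\<lambda>r. L2_norm (?e r)) \<longlongrightarrow> 0) (at t within {0..})" by simp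
  have bound: "\<bar>(?n r - ?n t) / (r - t) - ?D\<bar>
     \<le> 2 * (L2_norm (?e r) * L2_norm (F t)) + \<bar>r - t\<bar> * (2 * (L2_norm F')\<^sup>2 + 2 * (L2_norm (?e r))\<^sup>2)"
    if r: "r \<ge> 0" "r \<noteq> t" for r
  proof -
    let ?q = "\<lambda>\<xi>. F' \<xi> + ?e r \<xi>"
    have q2: "?q \<in> L2" using L2_lincomb[OF L' e2[OF r(1)], of 1 1] by simp
    have i1: "integrable lborel (\<lambda>\<xi>. 2 * Re (F' \<xi> * cnj (F t \<xi>)))"
      and i2: "integrable lborel (\<lambda>\<xi>. 2 * Re (?e r \<xi> * cnj (F t \<xi>)))"
      by (intro integrable_mult_right integrable_Re L2_mult_integrable L' e2 r L2_cnj L t)+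
    have i3: "integrable lborel (\<lambda>\<xi>. (r - t) * (cmod (?q \<xi>))\<^sup>2)"
      by (intro integrable_mult_right L2_D(2) q2)
    have pt: "((cmod (F r \<xi>))\<^sup>2 - (cmod (F t \<xi>))\<^sup>2) / (r - t)
       = 2 * Re (F' \<xi> * cnj (F t \<xi>)) + 2 * Re (?e r \<xi> * cnj (F t \<xi>)) + (r - t) * (cmod (?q \<xi>))\<^sup>2" for \<xi>
    proof -
      have Fr: "F r \<xi> = F t \<xi> + (r - t) *\<^sub>R ?q \<xi>" using r by simp
      have "(cmod (a + s *\<^sub>R b))\<^sup>2 - (cmod a)\<^sup>2 = s * (2 * Re (b * cnj a) + s * (cmod b)\<^sup>2)" for a b :: complex and s :: real
        unfolding cmod_power2 by (simp add: power2_eq_square algebra_simps)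
      from this[of "F t \<xi>" "r - t" "?q \<xi>"] Fr
      have "(cmod (F r \<xi>))\<^sup>2 - (cmod (F t \<xi>))\<^sup>2 = (r - t) * (2 * Re (?q \<xi> * cnj (F t \<xi>)) + (r - t) * (cmod (?q \<xi>))\<^sup>2)"
        by simp
      hence "((cmod (F r \<xi>))\<^sup>2 - (cmod (F t \<xi>))\<^sup>2) / (r - t) = 2 * Re (?q \<xi> * cnj (F t \<xi>)) + (r - t) * (cmod (?q \<xi>))\<^sup>2"
        using r(2) by simp
      also have "2 * Re (?q \<xi> * cnj (F t \<xi>)) = 2 * Re (F' \<xi> * cnj (F t \<xi>)) + 2 * Re (?e r \<xi> * cnj (F t \<xi>))"
        by (simp only: distrib_right plus_complex.sel distrib_left)
      finally show ?thesis .
    qed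
    have "(?n r - ?n t) / (r - t) = (LINT \<xi>|lborel. ((cmod (F r \<xi>))\<^sup>2 - (cmod (F t \<xi>))\<^sup>2) / (r - t))"
      using L2_D(2)[OF L[OF r(1)]] L2_D(2)[OF L[OF t]] by simp
    also have "\<dots> = ?D + (LINT \<xi>|lborel. 2 * Re (?e r \<xi> * cnj (F t \<xi>))) + (LINT \<xi>|lborel. (r - t) * (cmod (?q \<xi>))\<^sup>2)"
      unfolding pt using i1 i2 i3 by (simp only: Bochner_Integration.integral_add Bochner_Integration.integrable_add)
    finally have split: "(?n r - ?n t) / (r - t) - ?D = (LINT \<xi>|lborel. 2 * Re (?e r \<xi> * cnj (F t \<xi>))) + (LINT \<xi>|lborel. (r - t) * (cmod (?q \<xi>))\<^sup>2)"
      by simp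
    have "\<bar>LINT \<xi>|lborel. 2 * Re (?e r \<xi> * cnj (F t \<xi>))\<bar> = 2 * \<bar>Re (LINT \<xi>|lborel. ?e r \<xi> * cnj (F t \<xi>))\<bar>"
      by (simp only: integral_mult_right_zero abs_mult abs_numeral integral_Re[OF L2_mult_integrable[OF e2[OF r(1)] L2_cnj[OF L[OF t]]]])
    also have "\<dots> \<le> 2 * (L2_norm (?e r) * L2_norm (\<lambda>\<xi>. cnj (F t \<xi>)))"
      using order_trans[OF abs_Re_le_cmod L2_Cauchy_Schwarz[OF e2[OF r(1)] L2_cnj[OF L[OF t]]]] by simp
    also have "L2_norm (\<lambda>\<xi>. cnj (F t \<xi>)) = L2_norm (F t)" by (simp add: L2_norm_def)
    finally have b1: "\<bar>LINT \<xi>|lborel. 2 * Re (?e r \<xi> * cnj (F t \<xi>))\<bar> \<le> 2 * (L2_norm (?e r) * L2_norm (F t))" .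
    have "(L2_norm ?q)\<^sup>2 \<le> 2 * (L2_norm F')\<^sup>2 + 2 * (L2_norm (?e r))\<^sup>2"
    proof -
      have "L2_sq ?q \<le> 2 * L2_sq F' + 2 * L2_sq (?e r)"
        using L'[THEN L2_D(1)] e2[OF r(1), THEN L2_D(1)] by (rule L2_sq_add_le)
      thus ?thesis
        unfolding L2_norm_sq[OF q2] L2_norm_sq[OF L'] L2_norm_sq[OF e2[OF r(1)]]
        by (simp flip: ennreal_numeral ennreal_mult ennreal_plus)
    qed
    moreover have "(LINT \<xi>|lborel. (r - t) * (cmod (?q \<xi>))\<^sup>2) = (r - t) * (L2_norm ?q)\<^sup>2"
      by (simp add: L2_norm_def integral_nonneg_AE)
    ultimately have b2: "\<bar>LINT \<xi>|lborel. (r - t) * (cmod (?q \<xi>))\<^sup>2\<bar> \<le> \<bar>r - t\<bar> * (2 * (L2_norm F')\<^sup>2 + 2 * (L2_norm (?e r))\<^sup>2)"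
      by (simp only: abs_mult abs_power2 mult_left_mono abs_ge_zero)
    show ?thesis unfolding split using b1 b2 by linarith
  qed
  have "((\<lambda>r. (?n r - ?n t) / (r - t) - ?D) \<longlongrightarrow> 0) (at t within {0..})"
  proof (rule Lim_null_comparison)
    show "\<forall>\<^sub>F r in at t within {0..}. norm ((?n r - ?n t) / (r - t) - ?D)
      \<le> 2 * (L2_norm (?e r) * L2_norm (F t)) + \<bar>r - t\<bar> * (2 * (L2_norm F')\<^sup>2 + 2 * (L2_norm (?e r))\<^sup>2)"
      unfolding eventually_at_filter using bound by (intro always_eventually) auto
    have "((\<lambda>r. 2 * (L2_norm (?e r) * L2_norm (F t)) + \<bar>r - t\<bar> * (2 * (L2_norm F')\<^sup>2 + 2 * (L2_norm (?e r))\<^sup>2))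
      \<longlongrightarrow> 2 * (0 * L2_norm (F t)) + \<bar>t - t\<bar> * (2 * (L2_norm F')\<^sup>2 + 2 * 0\<^sup>2)) (at t within {0..})"
      by (intro tendsto_intros n0)
    thus "((\<lambda>r. 2 * (L2_norm (?e r) * L2_norm (F t)) + \<bar>r - t\<bar> * (2 * (L2_norm F')\<^sup>2 + 2 * (L2_norm (?e r))\<^sup>2))
      \<longlongrightarrow> 0) (at t within {0..})" by simp
  qed
  thus ?thesis unfolding has_field_derivative_iff by (simp add: LIM_zero_iff)
qed

lemma Hs_D:
  assumes "f \<in> Hs s"
  shows "f \<in> L2" "fourier_L2 f \<in> L2"
    "integrable lborel (\<lambda>\<xi>. (1 + (norm \<xi>)\<^sup>2) powr s * (cmod (fourier_L2 f \<xi>))\<^sup>2)"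
  using assms fourier_L2_in_L2 by (auto simp: Hs_def)

lemma Hs_norm_sq:
  assumes "f \<in> Hs s"
  shows "(\<integral>\<^sup>+\<xi>. ennreal ((1 + (norm \<xi>)\<^sup>2) powr s * (cmod (fourier_L2 f \<xi>))\<^sup>2) \<partial>lborel) = ennreal ((Hs_norm s f)\<^sup>2)"
  using nn_integral_eq_integral[OF Hs_D(3)[OF assms]] by (simp add: Hs_norm_def integral_nonneg_AE)

lemma Hs_lincomb:
  fixes f g :: "real^'n \<Rightarrow> complex"
  assumes f: "f \<in> Hs s" and g: "g \<in> Hs s"
  shows "(\<lambda>x. a * f x + b * g x) \<in> Hs s"
proof -
  let ?w = "\<lambda>\<xi>::real^'n. (1 + (norm \<xi>)\<^sup>2) powr s"
  let ?h = "\<lambda>x. a * f x + b * g x"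
  have h: "?h \<in> L2" by (intro L2_lincomb Hs_D f g)+ (use f g Hs_D in auto)
  note [measurable] = Hs_D(2)[OF f, THEN L2_D(1)] Hs_D(2)[OF g, THEN L2_D(1)] fourier_L2_in_L2[OF h, THEN L2_D(1)]
  have "integrable lborel (\<lambda>\<xi>. ?w \<xi> * (cmod (fourier_L2 ?h \<xi>))\<^sup>2)"
  proof (rule Bochner_Integration.integrable_bound)
    show "integrable lborel (\<lambda>\<xi>. 2 * (cmod a)\<^sup>2 * (?w \<xi> * (cmod (fourier_L2 f \<xi>))\<^sup>2) + 2 * (cmod b)\<^sup>2 * (?w \<xi> * (cmod (fourier_L2 g \<xi>))\<^sup>2))"
      by (intro Bochner_Integration.integrable_add integrable_mult_right Hs_D f g)
    show "AE \<xi> in lborel. norm (?w \<xi> * (cmod (fourier_L2 ?h \<xi>))\<^sup>2) \<le> norm (2 * (cmod a)\<^sup>2 * (?w \<xi> * (cmod (fourier_L2 f \<xi>))\<^sup>2) + 2 * (cmod b)\<^sup>2 * (?w \<xi> * (cmod (fourier_L2 g \<xi>))\<^sup>2))"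
      using fourier_L2_lincomb[OF Hs_D(1)[OF f] Hs_D(1)[OF g], of a b]
    proof eventually_elim
      case (elim \<xi>)
      have "?w \<xi> * (cmod (fourier_L2 ?h \<xi>))\<^sup>2 \<le> ?w \<xi> * (2 * (cmod (a * fourier_L2 f \<xi>))\<^sup>2 + 2 * (cmod (b * fourier_L2 g \<xi>))\<^sup>2)"
        unfolding elim by (intro mult_left_mono norm_add_sq_le) auto
      also have "\<dots> = 2 * (cmod a)\<^sup>2 * (?w \<xi> * (cmod (fourier_L2 f \<xi>))\<^sup>2) + 2 * (cmod b)\<^sup>2 * (?w \<xi> * (cmod (fourier_L2 g \<xi>))\<^sup>2)"
        by (simp add: norm_mult power_mult_distrib algebra_simps)
      finally show ?case by (simp add: abs_mult) 
    qed
  qed measurable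
  thus ?thesis using h by (simp add: Hs_def)
qed

lemma weight_bounded_multiplier_L2:
  fixes q f :: "real^'n \<Rightarrow> complex"
  assumes [measurable]: "q \<in> borel_measurable borel" and q: "\<And>\<xi>. (cmod (q \<xi>))\<^sup>2 \<le> 1 + (norm \<xi>)\<^sup>2"
    and f: "f \<in> Hs 1"
  shows "L2_sq (\<lambda>\<xi>. q \<xi> * fourier_L2 f \<xi>) \<le> ennreal ((Hs_norm 1 f)\<^sup>2)"
    and "(\<lambda>\<xi>. q \<xi> * fourier_L2 f \<xi>) \<in> L2"
proof -
  note [measurable] = Hs_D(2)[OF f, THEN L2_D(1)]
  have "(cmod (q \<xi> * fourier_L2 f \<xi>))\<^sup>2 \<le> (1 + (norm \<xi>)\<^sup>2) powr 1 * (cmod (fourier_L2 f \<xi>))\<^sup>2" for \<xi>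
    using q[of \<xi>] by (simp add: norm_mult power_mult_distrib mult_right_mono)
  thus *: "L2_sq (\<lambda>\<xi>. q \<xi> * fourier_L2 f \<xi>) \<le> ennreal ((Hs_norm 1 f)\<^sup>2)"
    unfolding Hs_norm_sq[OF f, symmetric] L2_sq_def by (intro nn_integral_mono ennreal_leI)
  have "(\<lambda>\<xi>. q \<xi> * fourier_L2 f \<xi>) \<in> borel_measurable borel" by measurable
  thus "(\<lambda>\<xi>. q \<xi> * fourier_L2 f \<xi>) \<in> L2"
    using * by (auto simp: L2_iff intro: le_less_trans)
qed

text \<open>
  A multiplier of size at most \<open>(1 + \<bar>\<xi>\<bar>\<^sup>2)\<^sup>1\<^sup>/\<^sup>2\<close> maps \<open>H\<^sup>1\<close> to \<open>L\<^sup>2\<close> on the frequency side, and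
  linearity of the transform turns difference quotients into difference quotients.
\<close>

lemma Hs_deriv_multiplier:
  fixes q :: "real^'n \<Rightarrow> complex"
  assumes [measurable]: "q \<in> borel_measurable borel" and q: "\<And>\<xi>. (cmod (q \<xi>))\<^sup>2 \<le> 1 + (norm \<xi>)\<^sup>2"
    and uv: "Hs_has_deriv 1 u v" and t: "t \<ge> 0"
  shows "has_L2_deriv (\<lambda>r \<xi>. q \<xi> * fourier_L2 (u r) \<xi>) (\<lambda>\<xi>. q \<xi> * fourier_L2 (v t) \<xi>) t"
  unfolding has_L2_deriv_def
proof (intro conjI allI impI)
  have H: "u r \<in> Hs 1" "v r \<in> Hs 1" if "r \<ge> 0" for r
    using uv that by (auto simp: Hs_has_deriv_def)
  show "(\<lambda>\<xi>. q \<xi> * fourier_L2 (u r) \<xi>) \<in> L2" if "r \<ge> 0" for r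
    by (intro weight_bounded_multiplier_L2 assms H that)
  show "(\<lambda>\<xi>. q \<xi> * fourier_L2 (v t) \<xi>) \<in> L2"
    by (intro weight_bounded_multiplier_L2 assms H)
  let ?d = "\<lambda>r x. (u r x - u t x) /\<^sub>R (r - t) - v t x"
  let ?Q = "\<lambda>r. L2_sq (\<lambda>\<xi>. (q \<xi> * fourier_L2 (u r) \<xi> - q \<xi> * fourier_L2 (u t) \<xi>) /\<^sub>R (r - t) - q \<xi> * fourier_L2 (v t) \<xi>)"
  have "((\<lambda>r. Hs_norm 1 (?d r)) \<longlongrightarrow> 0) (at t within {0..})"
    using uv t by (auto simp: Hs_has_deriv_def)
  hence "((\<lambda>r. ennreal ((Hs_norm 1 (?d r))\<^sup>2)) \<longlongrightarrow> ennreal (0\<^sup>2)) (at t within {0..})"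
    by (intro tendsto_ennrealI tendsto_power)
  hence lim: "((\<lambda>r. ennreal ((Hs_norm 1 (?d r))\<^sup>2)) \<longlongrightarrow> 0) (at t within {0..})" by simp
  show "((\<lambda>r. ?Q r) \<longlongrightarrow> 0) (at t within {0..})"
  proof (rule tendsto_sandwich[OF always_eventually _ tendsto_const lim])
    show "\<forall>\<^sub>F r in at t within {0..}. ?Q r \<le> ennreal ((Hs_norm 1 (?d r))\<^sup>2)"
      unfolding eventually_at_filter
    proof (intro always_eventually allI impI)
      fix r assume "r \<in> {0::real..}"
      hence r: "r \<ge> 0" by simp
      let ?c = "complex_of_real (inverse (r - t))"
      have dq: "(\<lambda>x. ?c * u r x + (- ?c) * u t x) \<in> Hs 1" by (intro Hs_lincomb H r t)
      have deq: "?d r = (\<lambda>x. 1 * (?c * u r x + (- ?c) * u t x) + (- 1) * v t x)"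
        by (simp add: scaleR_conv_of_real algebra_simps)
      have d: "?d r \<in> Hs 1" unfolding deq by (intro Hs_lincomb[OF dq] H t)
      have "AE \<xi> in lborel. fourier_L2 (?d r) \<xi> = (fourier_L2 (u r) \<xi> - fourier_L2 (u t) \<xi>) /\<^sub>R (r - t) - fourier_L2 (v t) \<xi>"
        using fourier_L2_lincomb[OF Hs_D(1)[OF dq] Hs_D(1)[OF H(2)[OF t]], of 1 "-1", folded deq]
          fourier_L2_lincomb[OF Hs_D(1)[OF H(1)[OF r]] Hs_D(1)[OF H(1)[OF t]], of ?c "- ?c"]
      proof eventually_elim
        case (elim \<xi>)
        show ?case unfolding elim(1) elim(2) by (simp add: scaleR_conv_of_real algebra_simps)
      qed
      hence "AE \<xi> in lborel. (q \<xi> * fourier_L2 (u r) \<xi> - q \<xi> * fourier_L2 (u t) \<xi>) /\<^sub>R (r - t) - q \<xi> * fourier_L2 (v t) \<xi> = q \<xi> * fourier_L2 (?d r) \<xi>"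
      proof eventually_elim
        case (elim \<xi>)
        show ?case unfolding elim by (simp add: scaleR_conv_of_real algebra_simps)
      qed
      hence "?Q r = L2_sq (\<lambda>\<xi>. q \<xi> * fourier_L2 (?d r) \<xi>)"
        by (rule L2_sq_cong_AE)
      also have "\<dots> \<le> ennreal ((Hs_norm 1 (?d r))\<^sup>2)"
        by (rule weight_bounded_multiplier_L2[OF _ q d]) measurable
      finally show "?Q r \<le> ennreal ((Hs_norm 1 (?d r))\<^sup>2)" .
    qed
  qed simp
qed

section \<open>A Lyapunov functional for the damped oscillator at each frequency\<close>

text \<open>
  After division by \<open>1 + \<rho>\<close>, where \<open>\<rho> = \<bar>\<xi>\<bar>\<^sup>2\<close>, the equation at a fixed frequency is the damped
  oscillator \<open>U'' + 2 damp \<rho> U' + \<rho> U = 0\<close>.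
\<close>

definition damp :: "real \<Rightarrow> real" where
  "damp \<rho> = 1 / (2 * (1 + \<rho>))"

text \<open>
  Compared with the energy \<open>\<bar>V\<bar>\<^sup>2 + \<rho> \<bar>U\<bar>\<^sup>2\<close>, the square of \<open>V + damp \<rho> U\<close> contributes a cross
  term that makes the functional dissipate \<open>\<bar>U\<bar>\<^sup>2\<close> as well as \<open>\<bar>V\<bar>\<^sup>2\<close>. Since \<open>damp \<rho>\<close> stays away
  from \<open>0\<close> at low frequencies, it controls \<open>\<bar>U\<bar>\<^sup>2\<close> there without a factor \<open>1 / \<rho>\<close>.
\<close>

definition lyap :: "real \<Rightarrow> complex \<Rightarrow> complex \<Rightarrow> real" where
  "lyap \<rho> U V = (cmod (V + complex_of_real (damp \<rho>) * U))\<^sup>2 + (\<rho> + (damp \<rho>)\<^sup>2) * (cmod U)\<^sup>2"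

text \<open>
  Parabolic at low frequencies, as for the heat equation. At high frequencies it tends to \<open>0\<close>
  like \<open>1 / (2 \<rho>)\<close>: time decay there has to be bought with derivatives of the data.
\<close>

definition decay_rate :: "real \<Rightarrow> real" where
  "decay_rate \<rho> = (if \<rho> \<le> 1 then \<rho> / 4 else damp \<rho>)"

lemma damp_bounds:
  assumes "\<rho> \<ge> 0"
  shows "0 < damp \<rho>" "damp \<rho> \<le> 1/2" "\<rho> \<le> 1 \<Longrightarrow> 1/4 \<le> damp \<rho>" "1 < \<rho> \<Longrightarrow> damp \<rho> \<le> 1/4"
  using assms by (auto simp: damp_def field_simps)

lemma lyap_upper: "lyap \<rho> U V \<le> 2 * (cmod V)\<^sup>2 + (\<rho> + 3 * (damp \<rho>)\<^sup>2) * (cmod U)\<^sup>2"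
  using norm_add_sq_le[of V "complex_of_real (damp \<rho>) * U"]
  by (simp add: lyap_def norm_mult power_mult_distrib algebra_simps)

lemma decay_rate_lyap_le:
  assumes "\<rho> \<ge> 0"
  shows "decay_rate \<rho> * lyap \<rho> U V \<le> 2 * damp \<rho> * ((cmod V)\<^sup>2 + \<rho> * (cmod U)\<^sup>2)"
proof (cases "\<rho> \<le> 1")
  case True
  have "(damp \<rho>)\<^sup>2 \<le> (1/2)\<^sup>2" using damp_bounds[OF assms] by (intro power_mono) auto
  hence "\<rho> + 3 * (damp \<rho>)\<^sup>2 \<le> 2" using True by (simp add: power2_eq_square)
  hence "lyap \<rho> U V \<le> 2 * (cmod V)\<^sup>2 + 2 * (cmod U)\<^sup>2"
    using lyap_upper[of \<rho> U V] mult_right_mono[of "\<rho> + 3 * (damp \<rho>)\<^sup>2" 2 "(cmod U)\<^sup>2"] by simp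
  hence "decay_rate \<rho> * lyap \<rho> U V \<le> \<rho> / 4 * (2 * (cmod V)\<^sup>2 + 2 * (cmod U)\<^sup>2)"
    using True assms by (simp add: decay_rate_def mult_left_mono)
  also have "\<dots> = 1/2 * (\<rho> * (cmod V)\<^sup>2 + \<rho> * (cmod U)\<^sup>2)" by (simp add: algebra_simps)
  also have "\<dots> \<le> 2 * damp \<rho> * ((cmod V)\<^sup>2 + \<rho> * (cmod U)\<^sup>2)"
    using damp_bounds[OF assms] True assms
    by (intro mult_mono add_mono order_refl) (auto simp: mult_left_le_one_le)
  finally show ?thesis .
next
  case False
  have "(damp \<rho>)\<^sup>2 \<le> (1/4)\<^sup>2" using damp_bounds[OF assms] False by (intro power_mono) auto
  hence "\<rho> + 3 * (damp \<rho>)\<^sup>2 \<le> 2 * \<rho>" using False by (simp add: power2_eq_square)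
  hence "lyap \<rho> U V \<le> 2 * (cmod V)\<^sup>2 + 2 * \<rho> * (cmod U)\<^sup>2"
    using lyap_upper[of \<rho> U V] mult_right_mono[of "\<rho> + 3 * (damp \<rho>)\<^sup>2" "2 * \<rho>" "(cmod U)\<^sup>2"] by simp
  hence "decay_rate \<rho> * lyap \<rho> U V \<le> damp \<rho> * (2 * (cmod V)\<^sup>2 + 2 * \<rho> * (cmod U)\<^sup>2)"
    using False damp_bounds(1)[OF assms] by (simp add: decay_rate_def)
  thus ?thesis by (simp add: algebra_simps)
qed

text \<open>
  The derivative of \<open>lyap\<close> along a solution. All terms with \<open>Re (V * cnj U)\<close> cancel, which is
  what the coefficient \<open>damp \<rho>\<close> in \<open>lyap\<close> is chosen for.
\<close>

lemma lyap_dissipation: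
  fixes U V W :: complex
  assumes \<rho>: "\<rho> \<ge> 0"
    and eq: "complex_of_real (1 + \<rho>) * W + complex_of_real (\<rho> * (1 + \<rho>)) * U + V = 0"
  shows "2 * Re ((W + damp \<rho> * V) * cnj (V + damp \<rho> * U)) + (\<rho> + (damp \<rho>)\<^sup>2) * (2 * Re (V * cnj U))
    = - (2 * damp \<rho> * ((cmod V)\<^sup>2 + \<rho> * (cmod U)\<^sup>2))"
proof -
  let ?k = "damp \<rho>"
  have k: "(1 + \<rho>) * (2 * ?k) = 1" using \<rho> by (simp add: damp_def)
  have k': "complex_of_real (1 + \<rho>) * complex_of_real (2 * ?k) = 1"
    unfolding of_real_mult[symmetric] k by simp
  have "complex_of_real (1 + \<rho>) * (W + \<rho> * U + (2 * ?k) * V) = complex_of_real (1 + \<rho>) * W + complex_of_real (\<rho> * (1 + \<rho>)) * U + (complex_of_real (1 + \<rho>) * complex_of_real (2 * ?k)) * V"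
    by (simp add: algebra_simps)
  also have "\<dots> = 0" unfolding k' using eq by simp
  finally have "W + \<rho> * U + (2 * ?k) * V = 0"
    using \<rho> by (metis mult_eq_0_iff of_real_eq_0_iff add_nonneg_eq_0_iff zero_le_one zero_neq_one)
  hence W: "W = - (\<rho> * U) - (2 * ?k) * V" by (simp add: algebra_simps eq_neg_iff_add_eq_0)
  show ?thesis unfolding W cmod_power2 by (simp add: power2_eq_square algebra_simps)
qed

lemma fourier_L2_cong_AE:
  fixes f g :: "real^'n \<Rightarrow> complex"
  assumes [measurable]: "f \<in> borel_measurable borel" "g \<in> borel_measurable borel"
    and eq: "AE x in lborel. f x = g x"
  shows "fourier_L2 f = fourier_L2 g"
proof -
  have "fourier (trunc R f) = fourier (trunc R g)" for R
    unfolding fourier_def[abs_def]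
  proof (intro ext integral_cong_AE)
    fix \<xi> :: "real^'n"
    show "AE x in lborel. trunc R f x * exp (- \<i> * complex_of_real (\<xi> \<bullet> x)) = trunc R g x * exp (- \<i> * complex_of_real (\<xi> \<bullet> x))"
      using eq by eventually_elim (simp add: trunc_def)
  qed measurable
  thus ?thesis unfolding fourier_L2_def has_fourier_L2_iff by simp
qed

lemma lyap_measurable:
  fixes U V :: "real^'n \<Rightarrow> complex"
  assumes [measurable]: "U \<in> borel_measurable borel" "V \<in> borel_measurable borel"
  shows "(\<lambda>\<xi>. lyap ((norm \<xi>)\<^sup>2) (U \<xi>) (V \<xi>)) \<in> borel_measurable borel"
  unfolding lyap_def damp_def by measurable

lemma decay_rate_measurable [measurable]: "(\<lambda>\<xi>::real^'n. decay_rate ((norm \<xi>)\<^sup>2)) \<in> borel_measurable borel"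
  unfolding decay_rate_def damp_def by measurable

text \<open>
  The frequency-wise equation holds only almost everywhere at each fixed time, while
  differentiability in time is only known in norm. The functional is therefore integrated
  over a set of frequencies before it is differentiated.
\<close>

locale weak_solution =
  fixes u v w :: "real \<Rightarrow> real^'n \<Rightarrow> complex"
  assumes uv: "Hs_has_deriv 1 u v" and vw: "Hs_has_deriv 1 v w"
    and weak: "\<And>t \<phi>. t > 0 \<Longrightarrow> \<phi> \<in> schwartz \<Longrightarrow>
           (LINT x|lborel. w t x * \<phi> x - w t x * laplacian \<phi> x
              + u t x * laplacian (laplacian \<phi>) x - u t x * laplacian \<phi> x + v t x * \<phi> x) = 0"
begin

abbreviation "U t \<equiv> fourier_L2 (u t)"
abbreviation "V t \<equiv> fourier_L2 (v t)"
abbreviation "W t \<equiv> fourier_L2 (w t)"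

lemma sol_Hs: 
  assumes "t \<ge> 0"
  shows "u t \<in> Hs 1" "v t \<in> Hs 1" "w t \<in> Hs 1"
  using uv vw assms by (auto simp: Hs_has_deriv_def)

definition lyap_on :: "(real^'n) set \<Rightarrow> real \<Rightarrow> real" where
  "lyap_on A t = (LINT \<xi>|lborel. indicator A \<xi> * lyap ((norm \<xi>)\<^sup>2) (U t \<xi>) (V t \<xi>))"

text \<open>
  The two squares in \<open>lyap\<close>, restricted to \<open>A\<close>, and below them their time derivatives. As
  elements of \<open>L\<^sup>2\<close> they are covered by \<open>has_L2_deriv_norm_sq\<close>.
\<close>

definition vel :: "(real^'n) set \<Rightarrow> real \<Rightarrow> real^'n \<Rightarrow> complex" where
  "vel A t \<xi> = indicator A \<xi> * V t \<xi> + (indicator A \<xi> * complex_of_real (damp ((norm \<xi>)\<^sup>2))) * U t \<xi>"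
definition pos :: "(real^'n) set \<Rightarrow> real \<Rightarrow> real^'n \<Rightarrow> complex" where
  "pos A t \<xi> = (indicator A \<xi> * complex_of_real (sqrt ((norm \<xi>)\<^sup>2 + (damp ((norm \<xi>)\<^sup>2))\<^sup>2))) * U t \<xi>"
definition vel' :: "(real^'n) set \<Rightarrow> real \<Rightarrow> real^'n \<Rightarrow> complex" where
  "vel' A t \<xi> = indicator A \<xi> * W t \<xi> + (indicator A \<xi> * complex_of_real (damp ((norm \<xi>)\<^sup>2))) * V t \<xi>"
definition pos' :: "(real^'n) set \<Rightarrow> real \<Rightarrow> real^'n \<Rightarrow> complex" where
  "pos' A t \<xi> = (indicator A \<xi> * complex_of_real (sqrt ((norm \<xi>)\<^sup>2 + (damp ((norm \<xi>)\<^sup>2))\<^sup>2))) * V t \<xi>"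

abbreviation lyap_on' :: "(real^'n) set \<Rightarrow> real \<Rightarrow> real" where
  "lyap_on' A t \<equiv> (LINT \<xi>|lborel. 2 * Re (vel' A t \<xi> * cnj (vel A t \<xi>))) + (LINT \<xi>|lborel. 2 * Re (pos' A t \<xi> * cnj (pos A t \<xi>)))"

lemma vel_pos_deriv:
  assumes [measurable]: "A \<in> sets borel" and t: "t \<ge> 0"
  shows "has_L2_deriv (vel A) (vel' A t) t" "has_L2_deriv (pos A) (pos' A t) t"
proof -
  have k: "(damp ((norm \<xi>)\<^sup>2))\<^sup>2 \<le> 1" for \<xi> :: "real^'n"
    using damp_bounds[of "(norm \<xi>)\<^sup>2"] power_mono[of "damp ((norm \<xi>)\<^sup>2)" 1 2] by simp
  have "has_L2_deriv (\<lambda>r \<xi>. indicator A \<xi> * V r \<xi>) (\<lambda>\<xi>. indicator A \<xi> * W t \<xi>) t"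
    by (rule Hs_deriv_multiplier[OF _ _ vw t]) (auto simp: indicator_def)
  moreover have "has_L2_deriv (\<lambda>r \<xi>. (indicator A \<xi> * complex_of_real (damp ((norm \<xi>)\<^sup>2))) * U r \<xi>) (\<lambda>\<xi>. (indicator A \<xi> * complex_of_real (damp ((norm \<xi>)\<^sup>2))) * V t \<xi>) t"
  proof (rule Hs_deriv_multiplier[OF _ _ uv t])
    show "(\<lambda>\<xi>. indicator A \<xi> * complex_of_real (damp ((norm \<xi>)\<^sup>2))) \<in> borel_measurable borel"
      unfolding damp_def by measurable
    show "(cmod (indicator A \<xi> * complex_of_real (damp ((norm \<xi>)\<^sup>2))))\<^sup>2 \<le> 1 + (norm \<xi>)\<^sup>2" for \<xi>
      using k[of \<xi>] by (auto simp: indicator_def add_increasing2)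
  qed
  ultimately show "has_L2_deriv (vel A) (vel' A t) t"
    unfolding vel_def[abs_def] vel'_def[abs_def] by (rule has_L2_deriv_add[OF _ _ t])
  show "has_L2_deriv (pos A) (pos' A t) t"
    unfolding pos_def[abs_def] pos'_def[abs_def]
  proof (rule Hs_deriv_multiplier[OF _ _ uv t])
    show "(\<lambda>\<xi>. indicator A \<xi> * complex_of_real (sqrt ((norm \<xi>)\<^sup>2 + (damp ((norm \<xi>)\<^sup>2))\<^sup>2))) \<in> borel_measurable borel"
      unfolding damp_def by measurable
    show "(cmod (indicator A \<xi> * complex_of_real (sqrt ((norm \<xi>)\<^sup>2 + (damp ((norm \<xi>)\<^sup>2))\<^sup>2))))\<^sup>2 \<le> 1 + (norm \<xi>)\<^sup>2" for \<xi>
      using k[of \<xi>] by (auto simp: indicator_def)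
  qed
qed

lemma vel_pos_L2:
  assumes "A \<in> sets borel" "t \<ge> 0"
  shows "vel A t \<in> L2" "pos A t \<in> L2" "vel' A t \<in> L2" "pos' A t \<in> L2"
  using vel_pos_deriv[OF assms] assms(2) by (auto simp: has_L2_deriv_def)

lemma lyap_split: "(cmod (vel A t \<xi>))\<^sup>2 + (cmod (pos A t \<xi>))\<^sup>2 = indicator A \<xi> * lyap ((norm \<xi>)\<^sup>2) (U t \<xi>) (V t \<xi>)"
  by (auto simp: vel_def pos_def lyap_def indicator_def norm_mult power_mult_distrib)

lemma lyap_integrable:
  assumes "A \<in> sets borel" "t \<ge> 0"
  shows "integrable lborel (\<lambda>\<xi>. indicator A \<xi> * lyap ((norm \<xi>)\<^sup>2) (U t \<xi>) (V t \<xi>))"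
  unfolding lyap_split[symmetric] by (intro Bochner_Integration.integrable_add L2_D(2) vel_pos_L2 assms)

lemma lyap_on_eq:
  assumes "A \<in> sets borel" "t \<ge> 0"
  shows "lyap_on A t = (LINT \<xi>|lborel. (cmod (vel A t \<xi>))\<^sup>2) + (LINT \<xi>|lborel. (cmod (pos A t \<xi>))\<^sup>2)"
  unfolding lyap_on_def lyap_split[symmetric] by (intro Bochner_Integration.integral_add L2_D(2) vel_pos_L2 assms)

lemma lyap_on_deriv:
  assumes A: "A \<in> sets borel" and t: "t \<ge> 0"
  shows "(lyap_on A has_real_derivative lyap_on' A t) (at t within {0..})"
proof (rule has_field_derivative_transform_within[where d=1])
  show "((\<lambda>r. (LINT \<xi>|lborel. (cmod (vel A r \<xi>))\<^sup>2) + (LINT \<xi>|lborel. (cmod (pos A r \<xi>))\<^sup>2)) has_real_derivative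
     lyap_on' A t) (at t within {0..})"
    by (intro DERIV_add has_L2_deriv_norm_sq vel_pos_deriv A t)
qed (use t lyap_on_eq[OF A] in auto)

lemma lyap_on_dissipation:
  assumes A: "A \<in> sets borel" and t: "t > 0" and \<gamma>: "\<And>\<xi>. \<xi> \<in> A \<Longrightarrow> \<gamma> \<le> decay_rate ((norm \<xi>)\<^sup>2)"
  shows "lyap_on' A t \<le> - \<gamma> * lyap_on A t"
proof -
  have t0: "t \<ge> 0" using t by simp
  have i: "integrable lborel (\<lambda>\<xi>. 2 * Re (vel' A t \<xi> * cnj (vel A t \<xi>)))" "integrable lborel (\<lambda>\<xi>. 2 * Re (pos' A t \<xi> * cnj (pos A t \<xi>)))"
    by (intro integrable_mult_right integrable_Re L2_mult_integrable L2_cnj vel_pos_L2 A t0)+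
  have "AE \<xi> in lborel. (1 + (norm \<xi>)\<^sup>2) * W t \<xi> + ((norm \<xi>)\<^sup>2 * (1 + (norm \<xi>)\<^sup>2)) * U t \<xi> + V t \<xi> = 0"
    by (rule weak_equation_fourier[OF _ _ _ weak[OF t]]) (use sol_Hs[OF t0] Hs_D in auto)
  hence AE: "AE \<xi> in lborel. 2 * Re (vel' A t \<xi> * cnj (vel A t \<xi>)) + 2 * Re (pos' A t \<xi> * cnj (pos A t \<xi>))
     \<le> - \<gamma> * (indicator A \<xi> * lyap ((norm \<xi>)\<^sup>2) (U t \<xi>) (V t \<xi>))"
  proof eventually_elim
    case (elim \<xi>)
    show ?case
    proof (cases "\<xi> \<in> A")
      case True
      let ?\<rho> = "(norm \<xi>)\<^sup>2"
      let ?k = "damp ?\<rho>"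
      have nn: "0 \<le> lyap ?\<rho> (U t \<xi>) (V t \<xi>)" by (simp add: lyap_def)
      have "2 * Re (pos' A t \<xi> * cnj (pos A t \<xi>)) = (?\<rho> + ?k\<^sup>2) * (2 * Re (V t \<xi> * cnj (U t \<xi>)))"
      proof -
        have "pos' A t \<xi> * cnj (pos A t \<xi>) = complex_of_real ((sqrt (?\<rho> + ?k\<^sup>2))\<^sup>2) * (V t \<xi> * cnj (U t \<xi>))"
          using True unfolding pos_def pos'_def by (simp add: power2_eq_square mult_ac del: real_sqrt_pow2 real_sqrt_mult_self real_sqrt_pow2_iff)
        also have "\<dots> = (?\<rho> + ?k\<^sup>2) *\<^sub>R (V t \<xi> * cnj (U t \<xi>))"
          by (simp add: scaleR_conv_of_real)
        finally show ?thesis by simp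
      qed
      moreover have "vel A t \<xi> = V t \<xi> + ?k * U t \<xi>" "vel' A t \<xi> = W t \<xi> + ?k * V t \<xi>"
        using True by (auto simp: vel_def vel'_def)
      ultimately have "2 * Re (vel' A t \<xi> * cnj (vel A t \<xi>)) + 2 * Re (pos' A t \<xi> * cnj (pos A t \<xi>))
         = - (2 * ?k * ((cmod (V t \<xi>))\<^sup>2 + ?\<rho> * (cmod (U t \<xi>))\<^sup>2))"
        using lyap_dissipation[of ?\<rho> "W t \<xi>" "U t \<xi>" "V t \<xi>"] elim by simp
      also have "\<dots> \<le> - (decay_rate ?\<rho> * lyap ?\<rho> (U t \<xi>) (V t \<xi>))"
        using decay_rate_lyap_le[of ?\<rho> "U t \<xi>" "V t \<xi>"] by simp
      also have "\<dots> \<le> - (\<gamma> * lyap ?\<rho> (U t \<xi>) (V t \<xi>))"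
        using mult_right_mono[OF \<gamma>[OF True] nn] by simp
      finally show ?thesis using True by simp
    qed (simp add: vel_def vel'_def pos_def pos'_def)
  qed
  have "lyap_on' A t
    = (LINT \<xi>|lborel. 2 * Re (vel' A t \<xi> * cnj (vel A t \<xi>)) + 2 * Re (pos' A t \<xi> * cnj (pos A t \<xi>)))"
    by (rule Bochner_Integration.integral_add[symmetric, OF i])
  also have "\<dots> \<le> (LINT \<xi>|lborel. - \<gamma> * (indicator A \<xi> * lyap ((norm \<xi>)\<^sup>2) (U t \<xi>) (V t \<xi>)))"
    by (intro integral_mono_AE AE integrable_mult_right lyap_integrable A t0 Bochner_Integration.integrable_add i)
  also have "\<dots> = - \<gamma> * lyap_on A t"
    unfolding lyap_on_def by (rule integral_mult_right_zero)
  finally show ?thesis .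
qed

text \<open>
  Gronwall's inequality: \<open>exp (\<gamma> t) * lyap_on A t\<close> has a nonpositive derivative for \<open>t > 0\<close> and
  is continuous at \<open>0\<close>.
\<close>

lemma lyap_on_decay:
  assumes A: "A \<in> sets borel" and \<gamma>: "\<And>\<xi>. \<xi> \<in> A \<Longrightarrow> \<gamma> \<le> decay_rate ((norm \<xi>)\<^sup>2)" and T: "T \<ge> 0"
  shows "exp (\<gamma> * T) * lyap_on A T \<le> lyap_on A 0"
proof (cases "T = 0")
  case False
  have d: "((\<lambda>t. exp (\<gamma> * t) * lyap_on A t) has_real_derivative exp (\<gamma> * t) * (\<gamma> * lyap_on A t + lyap_on' A t)) (at t within {0..})" if "t \<ge> 0" for t
    by (auto intro!: derivative_eq_intros lyap_on_deriv[OF A that] simp: algebra_simps)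
  have "exp (\<gamma> * T) * lyap_on A T \<le> exp (\<gamma> * 0) * lyap_on A 0"
  proof (rule DERIV_nonpos_imp_decreasing_open[where f="\<lambda>t. exp (\<gamma> * t) * lyap_on A t" and a=0 and b=T])
    show "0 \<le> T" by (rule T)
    show "continuous_on {0..T} (\<lambda>t. exp (\<gamma> * t) * lyap_on A t)"
    proof (rule continuous_on_subset)
      show "continuous_on {0..} (\<lambda>t. exp (\<gamma> * t) * lyap_on A t)"
        unfolding continuous_on_eq_continuous_within using d
        by (auto intro!: DERIV_continuous)
    qed auto
    fix t assume t: "0 < t" "t < T"
    have "at t within {0..} = at t" using t by (intro at_within_interior) auto
    hence "((\<lambda>t. exp (\<gamma> * t) * lyap_on A t) has_real_derivative exp (\<gamma> * t) * (\<gamma> * lyap_on A t + lyap_on' A t)) (at t)"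
      using d[of t] t by simp
    moreover have "exp (\<gamma> * t) * (\<gamma> * lyap_on A t + lyap_on' A t) \<le> 0"
      using lyap_on_dissipation[OF A t(1) \<gamma>] by (intro mult_nonneg_nonpos) auto
    ultimately show "\<exists>y. ((\<lambda>t. exp (\<gamma> * t) * lyap_on A t) has_real_derivative y) (at t) \<and> y \<le> 0" by blast
  qed
  thus ?thesis by simp
qed simp

text \<open>
  The decay of the integrated functional applies to the set \<open>B\<close> of frequencies that violate
  the claim, and forces \<open>B\<close> to be a null set.
\<close>

lemma lyap_decay_level:
  assumes T: "T \<ge> 0"
  shows "AE \<xi> in lborel. \<gamma> \<le> decay_rate ((norm \<xi>)\<^sup>2) \<longrightarrow>
     lyap ((norm \<xi>)\<^sup>2) (U T \<xi>) (V T \<xi>) \<le> exp (- \<gamma> * T) * lyap ((norm \<xi>)\<^sup>2) (U 0 \<xi>) (V 0 \<xi>)"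
proof -
  let ?L = "\<lambda>t \<xi>. lyap ((norm \<xi>)\<^sup>2) (U t \<xi>) (V t \<xi>)"
  note [measurable] = lyap_measurable[OF Hs_D(2)[OF sol_Hs(1)[OF T], THEN L2_D(1)] Hs_D(2)[OF sol_Hs(2)[OF T], THEN L2_D(1)]]
    lyap_measurable[OF Hs_D(2)[OF sol_Hs(1)[of 0], THEN L2_D(1)] Hs_D(2)[OF sol_Hs(2)[of 0], THEN L2_D(1)], simplified]
  define B where "B = {\<xi>. \<gamma> \<le> decay_rate ((norm \<xi>)\<^sup>2) \<and> exp (- \<gamma> * T) * ?L 0 \<xi> < ?L T \<xi>}"
  have B[measurable]: "B \<in> sets borel" unfolding B_def by measurable
  let ?d = "\<lambda>\<xi>. indicator B \<xi> * ?L T \<xi> - exp (- \<gamma> * T) * (indicator B \<xi> * ?L 0 \<xi>)"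
  have i: "integrable lborel ?d"
    by (intro Bochner_Integration.integrable_diff integrable_mult_right lyap_integrable B T order_refl)
  have nn: "0 \<le> ?d \<xi>" for \<xi> by (auto simp: indicator_def B_def)
  have "(LINT \<xi>|lborel. ?d \<xi>) = lyap_on B T - exp (- \<gamma> * T) * lyap_on B 0"
    unfolding lyap_on_def using lyap_integrable[OF B T] lyap_integrable[OF B order_refl] by simp
  also have "\<dots> \<le> 0"
  proof -
    have "exp (\<gamma> * T) * lyap_on B T \<le> lyap_on B 0" by (rule lyap_on_decay[OF B _ T]) (simp add: B_def)
    hence "exp (- \<gamma> * T) * (exp (\<gamma> * T) * lyap_on B T) \<le> exp (- \<gamma> * T) * lyap_on B 0" by (intro mult_left_mono) auto
    thus ?thesis by (simp add: mult.assoc[symmetric] mult_exp_exp)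
  qed
  finally have "(LINT \<xi>|lborel. ?d \<xi>) \<le> 0" .
  moreover have "0 \<le> (LINT \<xi>|lborel. ?d \<xi>)" by (intro integral_nonneg_AE AE_I2 nn)
  ultimately have "(LINT \<xi>|lborel. ?d \<xi>) = 0" by (rule antisym)
  hence "AE \<xi> in lborel. ?d \<xi> = 0"
    by (subst (asm) integral_nonneg_eq_0_iff_AE[OF i]) (intro AE_I2 nn)
  thus ?thesis by eventually_elim (auto simp: indicator_def B_def split: if_splits)
qed

text \<open>
  The null set in \<open>lyap_decay_level\<close> depends on \<open>\<gamma>\<close>, so only countably many rates can be used
  together. A rational rate between half of \<open>decay_rate\<close> and \<open>decay_rate\<close> is available at every
  frequency; this is the origin of the factor \<open>1/2\<close>.
\<close>

lemma lyap_decay: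
  assumes T: "T \<ge> 0"
  shows "AE \<xi> in lborel. lyap ((norm \<xi>)\<^sup>2) (U T \<xi>) (V T \<xi>)
     \<le> exp (- decay_rate ((norm \<xi>)\<^sup>2) / 2 * T) * lyap ((norm \<xi>)\<^sup>2) (U 0 \<xi>) (V 0 \<xi>)"
proof -
  have "AE \<xi> in lborel. \<forall>q::rat. of_rat q \<le> decay_rate ((norm \<xi>)\<^sup>2) \<longrightarrow>
     lyap ((norm \<xi>)\<^sup>2) (U T \<xi>) (V T \<xi>) \<le> exp (- of_rat q * T) * lyap ((norm \<xi>)\<^sup>2) (U 0 \<xi>) (V 0 \<xi>)"
    using lyap_decay_level[OF T] by (simp add: AE_all_countable)
  thus ?thesis
  proof eventually_elim
    case (elim \<xi>)
    let ?c = "decay_rate ((norm \<xi>)\<^sup>2)"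
    have "?c \<ge> 0" using damp_bounds[of "(norm \<xi>)\<^sup>2"] by (auto simp: decay_rate_def)
    have "\<exists>q::rat. ?c / 2 \<le> of_rat q \<and> of_rat q \<le> ?c"
    proof (cases "?c = 0")
      case True thus ?thesis by (intro exI[of _ 0]) simp
    next
      case False
      with \<open>?c \<ge> 0\<close> have "?c / 2 < ?c" by simp
      from of_rat_dense[OF this] show ?thesis by (meson less_imp_le)
    qed
    then obtain q :: rat where q: "?c / 2 \<le> of_rat q" "of_rat q \<le> ?c" by blast
    have "lyap ((norm \<xi>)\<^sup>2) (U T \<xi>) (V T \<xi>) \<le> exp (- of_rat q * T) * lyap ((norm \<xi>)\<^sup>2) (U 0 \<xi>) (V 0 \<xi>)"
      using elim q by blast
    also have "\<dots> \<le> exp (- ?c / 2 * T) * lyap ((norm \<xi>)\<^sup>2) (U 0 \<xi>) (V 0 \<xi>)"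
    proof (rule mult_right_mono)
      have "?c / 2 * T \<le> of_rat q * T" using q T by (intro mult_right_mono) auto
      thus "exp (- of_rat q * T) \<le> exp (- ?c / 2 * T)" by simp
    qed (simp add: lyap_def)
    finally show ?case .
  qed
qed

end

section \<open>Decay of the solution\<close>

lemma powr_le_exp:
  fixes x :: real
  assumes "x > 0" "p > 0" "a > 0"
  shows "x powr p \<le> (p / a) powr p * exp (a * x)"
proof -
  have "a * x / p \<le> exp (a * x / p)" using exp_ge_add_one_self[of "a * x / p"] by linarith
  hence "(a * x / p) powr p \<le> exp (a * x / p) powr p" using assms by (intro powr_mono2) auto
  also have "\<dots> = exp (a * x)" using assms by (simp add: powr_def)
  finally have "(p / a) powr p * (a * x / p) powr p \<le> (p / a) powr p * exp (a * x)" by (rule mult_left_mono) simp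
  moreover have "(p / a) powr p * (a * x / p) powr p = x powr p"
    using assms by (subst powr_mult[symmetric]) (auto simp: field_simps)
  ultimately show ?thesis by simp
qed

text \<open>
  For \<open>\<rho> \<le> 1\<close> one has \<open>1/4 \<le> damp \<rho> \<le> 1/2\<close>, so \<open>lyap\<close> lies above \<open>\<bar>U\<bar>\<^sup>2 / 16\<close> and below
  \<open>2 \<bar>V\<bar>\<^sup>2 + 2 \<bar>U\<bar>\<^sup>2\<close>.
\<close>

lemma low_frequency_decay:
  assumes \<rho>: "0 \<le> \<rho>" "\<rho> \<le> 1"
    and decay: "lyap \<rho> U V \<le> exp (- decay_rate \<rho> / 2 * T) * lyap \<rho> U0 V0"
  shows "(cmod U)\<^sup>2 \<le> 32 * exp (- \<rho> * T / 8) * ((cmod V0)\<^sup>2 + (cmod U0)\<^sup>2)"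
proof -
  have k: "(1/4)\<^sup>2 \<le> (damp \<rho>)\<^sup>2" "(damp \<rho>)\<^sup>2 \<le> (1/2)\<^sup>2"
    using damp_bounds[OF \<rho>(1)] \<rho>(2) by (auto intro!: power_mono)
  have "1/16 * (cmod U)\<^sup>2 \<le> (\<rho> + (damp \<rho>)\<^sup>2) * (cmod U)\<^sup>2"
    using k \<rho> by (intro mult_right_mono) (auto simp: power2_eq_square)
  also have "\<dots> \<le> lyap \<rho> U V" by (simp add: lyap_def)
  also note decay
  also have "lyap \<rho> U0 V0 \<le> 2 * (cmod V0)\<^sup>2 + (\<rho> + 3 * (damp \<rho>)\<^sup>2) * (cmod U0)\<^sup>2" by (rule lyap_upper)
  also have "\<dots> \<le> 2 * (cmod V0)\<^sup>2 + 2 * (cmod U0)\<^sup>2"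
    using k \<rho> by (intro add_mono mult_right_mono) (auto simp: power2_eq_square)
  finally have "1/16 * (cmod U)\<^sup>2 \<le> exp (- decay_rate \<rho> / 2 * T) * (2 * (cmod V0)\<^sup>2 + 2 * (cmod U0)\<^sup>2)"
    by (simp add: mult_left_mono)
  moreover have "- decay_rate \<rho> / 2 * T = - \<rho> * T / 8" using \<rho> by (simp add: decay_rate_def)
  ultimately have "1/16 * (cmod U)\<^sup>2 \<le> exp (- \<rho> * T / 8) * (2 * (cmod V0)\<^sup>2 + 2 * (cmod U0)\<^sup>2)"
    by (simp only:)
  thus ?thesis by (simp add: algebra_simps)
qed

text \<open>
  The loss of regularity: \<open>exp (- T / (4 (1 + \<rho>)))\<close> decays in \<open>T\<close> only at the price of powers of
  \<open>1 + \<rho>\<close>, and \<open>powr_le_exp\<close> trades \<open>T powr (- (l + 1))\<close> for \<open>(1 + \<rho>) powr (l + 1)\<close>. Dividing by \<open>\<rho>\<close>,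
  which is comparable to \<open>1 + \<rho>\<close>, saves one power on \<open>V0\<close>.
\<close>

lemma high_frequency_decay:
  assumes \<rho>: "1 < \<rho>" and T: "T > 0" and l: "l > -1"
    and decay: "lyap \<rho> U V \<le> exp (- decay_rate \<rho> / 2 * T) * lyap \<rho> U0 V0"
  shows "(cmod U)\<^sup>2 \<le> 4 * (4 * (l + 1)) powr (l + 1) * T powr (- (l + 1))
     * ((1 + \<rho>) powr l * (cmod V0)\<^sup>2 + (1 + \<rho>) powr (l + 1) * (cmod U0)\<^sup>2)"
proof -
  let ?m = "1 + \<rho>" and ?p = "l + 1"
  have m: "?m > 0" using \<rho> by simp
  have k: "(damp \<rho>)\<^sup>2 \<le> (1/4)\<^sup>2"
    using damp_bounds[of \<rho>] \<rho> by (intro power_mono) auto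
  \<comment> \<open>twice decay_rate at these frequencies is 1 / (1 + rho), so the exponent is - T / (4 (1 +
    rho))\<close>
  have e1: "exp (- decay_rate \<rho> / 2 * T) * exp (1/4 * (T / ?m)) = 1"
    using \<rho> by (simp add: decay_rate_def damp_def mult_exp_exp field_simps)
  have "(T / ?m) powr ?p \<le> (?p / (1/4)) powr ?p * exp (1/4 * (T / ?m))"
    using T m l by (intro powr_le_exp) auto
  hence "exp (- decay_rate \<rho> / 2 * T) * (T / ?m) powr ?p \<le> exp (- decay_rate \<rho> / 2 * T) * ((4 * ?p) powr ?p * exp (1/4 * (T / ?m)))"
    by (intro mult_left_mono) (auto simp: mult.commute)
  also have "\<dots> = (4 * ?p) powr ?p * (exp (- decay_rate \<rho> / 2 * T) * exp (1/4 * (T / ?m)))"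
    by (rule mult.left_commute)
  finally have "exp (- decay_rate \<rho> / 2 * T) * (T / ?m) powr ?p \<le> (4 * ?p) powr ?p"
    unfolding e1 by simp
  hence "exp (- decay_rate \<rho> / 2 * T) * (T / ?m) powr ?p * (T powr (- ?p) * ?m powr ?p) \<le> (4 * ?p) powr ?p * (T powr (- ?p) * ?m powr ?p)"
    by (rule mult_right_mono) simp
  moreover have "(T / ?m) powr ?p * (T powr (- ?p) * ?m powr ?p) = 1"
  proof -
    have "(T / ?m) powr ?p = T powr ?p / ?m powr ?p" "T powr (- ?p) = 1 / T powr ?p"
      using T m by (simp_all only: powr_divide powr_minus_divide less_imp_le)
    moreover have "T powr ?p > 0" "?m powr ?p > 0" using T m by simp_all
    ultimately show ?thesis by (simp only: times_divide_eq_left times_divide_eq_right) simp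
  qed
  ultimately have ex: "exp (- decay_rate \<rho> / 2 * T) \<le> (4 * ?p) powr ?p * (T powr (- ?p) * ?m powr ?p)"
    by (simp add: mult.assoc)
  have "\<rho> * (cmod U)\<^sup>2 \<le> (\<rho> + (damp \<rho>)\<^sup>2) * (cmod U)\<^sup>2" by (intro mult_right_mono) auto
  also have "\<dots> \<le> lyap \<rho> U V" by (simp add: lyap_def)
  also note decay
  also have "lyap \<rho> U0 V0 \<le> 2 * (cmod V0)\<^sup>2 + (\<rho> + 3 * (damp \<rho>)\<^sup>2) * (cmod U0)\<^sup>2" by (rule lyap_upper)
  also have "\<dots> \<le> 2 * (cmod V0)\<^sup>2 + 2 * ?m * (cmod U0)\<^sup>2"
    using k \<rho> by (intro add_mono mult_right_mono) (auto simp: power2_eq_square)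
  finally have "\<rho> * (cmod U)\<^sup>2 \<le> exp (- decay_rate \<rho> / 2 * T) * (2 * (cmod V0)\<^sup>2 + 2 * ?m * (cmod U0)\<^sup>2)"
    by (simp add: mult_left_mono)
  moreover have "?m / 2 * (cmod U)\<^sup>2 \<le> \<rho> * (cmod U)\<^sup>2" using \<rho> by (intro mult_right_mono) auto
  ultimately have "?m / 2 * (cmod U)\<^sup>2 \<le> exp (- decay_rate \<rho> / 2 * T) * (2 * (cmod V0)\<^sup>2 + 2 * ?m * (cmod U0)\<^sup>2)"
    by linarith
  also have "\<dots> \<le> ((4 * ?p) powr ?p * (T powr (- ?p) * ?m powr ?p)) * (2 * (cmod V0)\<^sup>2 + 2 * ?m * (cmod U0)\<^sup>2)"
    using m by (intro mult_right_mono ex) auto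
  also have "\<dots> = ?m / 2 * (4 * (4 * ?p) powr ?p * T powr (- ?p) * (?m powr l * (cmod V0)\<^sup>2 + ?m powr ?p * (cmod U0)\<^sup>2))"
  proof -
    have "(K * (t * (r * s))) * (2 * a + 2 * s * b) = s / 2 * (4 * K * t * (r * a + (r * s) * b))" for K t r s a b :: real
      by (simp add: field_simps)
    moreover have "?m powr ?p = ?m powr l * ?m" using m by (simp add: powr_add)
    ultimately show ?thesis by (simp only:)
  qed
  finally show ?thesis by (rule mult_left_le_imp_le) (use m in simp)
qed

lemma integral_low_frequency:
  assumes T: "T > 0"
  shows "(\<integral>\<^sup>+\<xi>. ennreal (exp (- (norm (\<xi>::real^'n))\<^sup>2 * T / 8)) \<partial>lborel)
    = ennreal (T powr (- real CARD('n) / 2) * (LINT \<xi>::real^'n|lborel. exp (- (norm \<xi>)\<^sup>2 / 8)))"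
proof -
  let ?c = "1 / sqrt T"
  have "(\<integral>\<^sup>+\<xi>. ennreal (exp (- (norm (\<xi>::real^'n))\<^sup>2 * T / 8)) \<partial>lborel)
     = ennreal (\<bar>?c\<bar> ^ DIM(real^'n)) * (\<integral>\<^sup>+\<xi>. ennreal (exp (- (norm (0 + ?c *\<^sub>R (\<xi>::real^'n)))\<^sup>2 * T / 8)) \<partial>lborel)"
    by (rule nn_integral_lborel_affine) (use T in \<open>auto simp del: DIM_cart\<close>)
  also have "(\<lambda>\<xi>::real^'n. ennreal (exp (- (norm (0 + ?c *\<^sub>R \<xi>))\<^sup>2 * T / 8))) = (\<lambda>\<xi>. ennreal (exp (- (norm \<xi>)\<^sup>2 / 8)))"
    using T by (simp add: power_divide)
  also have "(\<integral>\<^sup>+\<xi>. ennreal (exp (- (norm (\<xi>::real^'n))\<^sup>2 / 8)) \<partial>lborel) = ennreal (LINT \<xi>::real^'n|lborel. exp (- (norm \<xi>)\<^sup>2 / 8))"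
    by (rule nn_integral_eq_integral[OF integrable_exp_norm_sq(1)]) auto
  also have "\<bar>?c\<bar> ^ DIM(real^'n) = T powr (- real CARD('n) / 2)"
  proof -
    have "\<bar>?c\<bar> = T powr (- 1/2)" using T by (simp add: powr_half_sqrt powr_minus_divide)
    thus ?thesis using T by (simp add: powr_powr flip: powr_realpow)
  qed
  finally show ?thesis by (simp add: ennreal_mult integral_nonneg_AE)
qed

lemma L11_dominates:
  assumes "f \<in> L11"
  shows "integrable lborel f" "cmod (fourier f \<xi>) \<le> L11_norm f" "0 \<le> L11_norm f"
proof -
  show i: "integrable lborel f" using assms by (simp add: L11_def)
  have "cmod (fourier f \<xi>) \<le> (LINT x|lborel. cmod (f x))" by (rule cmod_fourier_le)
  also have "\<dots> \<le> L11_norm f"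
    unfolding L11_norm_def
  proof (rule integral_mono)
    show "integrable lborel (\<lambda>x. (1 + norm x) * cmod (f x))" using assms by (simp add: L11_def)
    show "cmod (f x) \<le> (1 + norm x) * cmod (f x)" for x
      by (simp add: distrib_right)
  qed (use i in auto)
  finally show "cmod (fourier f \<xi>) \<le> L11_norm f" .
  show "0 \<le> L11_norm f" unfolding L11_norm_def by (intro integral_nonneg_AE) auto
qed

lemma fourier_L2_bound_L11:
  assumes "f \<in> L2" "f \<in> L11"
  shows "AE \<xi> in lborel. cmod (fourier_L2 f \<xi>) \<le> L11_norm f"
  using fourier_L2_eq_fourier[OF assms(1) L11_dominates(1)[OF assms(2)]]
  by eventually_elim (simp add: L11_dominates(2)[OF assms(2)])

text \<open>
  The two pointwise bounds are added and integrated over all frequencies. At low frequencies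
  the transforms of the data are bounded by their norms in \<open>L\<^sup>1\<^sup>,\<^sup>1\<close> and the integral of
  \<open>exp (- \<bar>\<xi>\<bar>\<^sup>2 T / 8)\<close> is a multiple of \<open>T powr (- n / 2)\<close>, which for \<open>T \<ge> 1\<close> is at most
  \<open>T powr (- (l + 1))\<close>. At high frequencies the Sobolev norms of the data appear.
\<close>

lemma (in weak_solution) L2_decay:
  fixes l T :: real
  assumes n: "l + 1 \<le> real CARD('n) / 2" and l: "l > -1" and T: "T \<ge> 1"
    and u0: "u0 \<in> Hs (l + 1) \<inter> L11" and u1: "u1 \<in> Hs l \<inter> L11"
    and init: "AE x in lborel. u 0 x = u0 x" "AE x in lborel. v 0 x = u1 x"
  shows "(L2_norm (u T))\<^sup>2 \<le>
     2 * (32 * (LINT \<xi>::real^'n|lborel. exp (- (norm \<xi>)\<^sup>2 / 8)) + 4 * (4 * (l + 1)) powr (l + 1))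
       * T powr (- (l + 1)) * (Hs_norm l u1 + Hs_norm (l + 1) u0 + L11_norm u1 + L11_norm u0)\<^sup>2"
proof -
  let ?J = "LINT \<xi>::real^'n|lborel. exp (- (norm \<xi>)\<^sup>2 / 8)" and ?K = "(4 * (l + 1)) powr (l + 1)"
  let ?p = "l + 1"
  let ?v = "\<lambda>\<xi>. (1 + (norm \<xi>)\<^sup>2) powr l * (cmod (fourier_L2 u1 \<xi>))\<^sup>2" and ?u = "\<lambda>\<xi>. (1 + (norm \<xi>)\<^sup>2) powr ?p * (cmod (fourier_L2 u0 \<xi>))\<^sup>2"
  let ?I = "Hs_norm l u1 + Hs_norm ?p u0 + L11_norm u1 + L11_norm u0"
  let ?N = "(L11_norm u1)\<^sup>2 + (L11_norm u0)\<^sup>2" and ?H = "(Hs_norm l u1)\<^sup>2 + (Hs_norm ?p u0)\<^sup>2"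
  have T0: "T \<ge> 0" "T > 0" using T by auto
  have h0: "u0 \<in> Hs ?p" "u0 \<in> L11" "u1 \<in> Hs l" "u1 \<in> L11" using u0 u1 by auto
  note meas = Hs_D(1)[OF h0(1), THEN L2_D(1)] Hs_D(1)[OF h0(3), THEN L2_D(1)]
  have U0: "U 0 = fourier_L2 u0"
    using Hs_D(1)[OF sol_Hs(1)[OF order_refl], THEN L2_D(1)] meas(1) init(1) by (rule fourier_L2_cong_AE)
  have V0: "V 0 = fourier_L2 u1"
    using Hs_D(1)[OF sol_Hs(2)[OF order_refl], THEN L2_D(1)] meas(2) init(2) by (rule fourier_L2_cong_AE)
  note [measurable] = Hs_D(2)[OF h0(1), THEN L2_D(1)] Hs_D(2)[OF h0(3), THEN L2_D(1)]
  have nn: "0 \<le> L11_norm u0" "0 \<le> L11_norm u1" "0 \<le> Hs_norm l u1" "0 \<le> Hs_norm ?p u0" "0 \<le> ?J"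
    using h0 by (auto intro!: L11_dominates integral_nonneg_AE simp: Hs_norm_def)
  have split: "ennreal (a * b + c * (d + e)) = ennreal a * ennreal b + ennreal c * (ennreal d + ennreal e)"
    if "0 \<le> a" "0 \<le> b" "0 \<le> c" "0 \<le> d" "0 \<le> e" for a b c d e
    using that by (simp add: ennreal_mult)
  have "AE \<xi> in lborel. (cmod (U T \<xi>))\<^sup>2 \<le> 32 * ?N * exp (- (norm \<xi>)\<^sup>2 * T / 8)
     + 4 * ?K * T powr (- ?p) * (?v \<xi> + ?u \<xi>)"
    using lyap_decay[OF T0(1)] fourier_L2_bound_L11[OF Hs_D(1)[OF h0(1)] h0(2)] fourier_L2_bound_L11[OF Hs_D(1)[OF h0(3)] h0(4)]
  proof eventually_elim
    case (elim \<xi>)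
    let ?\<rho> = "(norm \<xi>)\<^sup>2"
    let ?lo = "32 * ?N * exp (- ?\<rho> * T / 8)"
    let ?hi = "4 * ?K * T powr (- ?p) * (?v \<xi> + ?u \<xi>)"
    have nn': "0 \<le> ?lo" "0 \<le> ?hi" by (auto intro!: mult_nonneg_nonneg add_nonneg_nonneg)
    show ?case
    proof (cases "?\<rho> \<le> 1")
      case True
      have "(cmod (U T \<xi>))\<^sup>2 \<le> 32 * exp (- ?\<rho> * T / 8) * ((cmod (V 0 \<xi>))\<^sup>2 + (cmod (U 0 \<xi>))\<^sup>2)"
        by (rule low_frequency_decay[OF _ True elim(1)]) simp
      also have "\<dots> \<le> 32 * exp (- ?\<rho> * T / 8) * ?N"
        unfolding U0 V0 using elim(2,3) by (intro mult_left_mono add_mono power_mono) auto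
      also have "\<dots> = ?lo" by (simp only: mult_ac)
      finally show ?thesis using nn'(2) by linarith
    next
      case False
      have "(cmod (U T \<xi>))\<^sup>2 \<le> ?hi"
        using high_frequency_decay[OF _ T0(2) l elim(1)] False unfolding U0 V0 by simp
      thus ?thesis using nn'(1) by linarith
    qed
  qed
  hence "L2_sq (U T) \<le> (\<integral>\<^sup>+\<xi>. ennreal (32 * ?N * exp (- (norm \<xi>)\<^sup>2 * T / 8)
     + 4 * ?K * T powr (- ?p) * (?v \<xi> + ?u \<xi>)) \<partial>lborel)"
    unfolding L2_sq_def by (intro nn_integral_mono_AE, elim eventually_mono, intro ennreal_leI)
  also have "\<dots> = (\<integral>\<^sup>+\<xi>. ennreal (32 * ?N) * ennreal (exp (- (norm \<xi>)\<^sup>2 * T / 8))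
     + ennreal (4 * ?K * T powr (- ?p)) * (ennreal (?v \<xi>) + ennreal (?u \<xi>)) \<partial>lborel)"
    by (intro nn_integral_cong split) auto
  also have "\<dots> = ennreal (32 * ?N) * (\<integral>\<^sup>+\<xi>. ennreal (exp (- (norm (\<xi>::real^'n))\<^sup>2 * T / 8)) \<partial>lborel)
     + ennreal (4 * ?K * T powr (- ?p)) * ((\<integral>\<^sup>+\<xi>. ennreal (?v \<xi>) \<partial>lborel) + (\<integral>\<^sup>+\<xi>. ennreal (?u \<xi>) \<partial>lborel))"
    by (simp add: nn_integral_add nn_integral_cmult)
  also have "\<dots> = ennreal (32 * ?N) * ennreal (T powr (- real CARD('n) / 2) * ?J)
     + ennreal (4 * ?K * T powr (- ?p)) * (ennreal ((Hs_norm l u1)\<^sup>2) + ennreal ((Hs_norm ?p u0)\<^sup>2))"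
    by (simp only: integral_low_frequency[OF T0(2)] Hs_norm_sq[OF h0(1)] Hs_norm_sq[OF h0(3)])
  also have "\<dots> = ennreal (32 * ?N * (T powr (- real CARD('n) / 2) * ?J) + 4 * ?K * T powr (- ?p) * ?H)"
    using nn by (intro split[symmetric]) auto
  also have "\<dots> \<le> ennreal ((32 * ?J + 4 * ?K) * T powr (- ?p) * ?I\<^sup>2)"
  proof (rule ennreal_leI)
    have tp: "T powr (- real CARD('n) / 2) \<le> T powr (- ?p)"
      using T n by (intro powr_mono) auto
    have "?N + ?H \<le> ?I\<^sup>2"
      using nn by (simp add: power2_eq_square algebra_simps add_nonneg_nonneg)
    moreover have "0 \<le> ?N" "0 \<le> ?H" by auto
    ultimately have NH: "?N \<le> ?I\<^sup>2" "?H \<le> ?I\<^sup>2" by linarith+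
    have "32 * ?N * (T powr (- real CARD('n) / 2) * ?J) \<le> 32 * ?I\<^sup>2 * (T powr (- ?p) * ?J)"
      using NH nn tp by (intro mult_mono) auto
    moreover have "4 * ?K * T powr (- ?p) * ?H \<le> 4 * ?K * T powr (- ?p) * ?I\<^sup>2"
      using NH by (intro mult_left_mono) auto
    ultimately show "32 * ?N * (T powr (- real CARD('n) / 2) * ?J) + 4 * ?K * T powr (- ?p) * ?H
       \<le> (32 * ?J + 4 * ?K) * T powr (- ?p) * ?I\<^sup>2"
      by (simp add: algebra_simps)
  qed
  finally have L: "2 * L2_sq (U T) \<le> 2 * ennreal ((32 * ?J + 4 * ?K) * T powr (- ?p) * ?I\<^sup>2)"
    by (rule mult_left_mono) simp
  have uT: "u T \<in> L2" using sol_Hs(1)[OF T0(1)] by (rule Hs_D)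
  have "1 * L2_sq (u T) \<le> ennreal ((2 * pi) ^ CARD('n)) * L2_sq (u T)"
  proof (rule mult_right_mono)
    have "(1::real) \<le> (2 * pi) ^ CARD('n)" using pi_gt3 by (intro one_le_power) auto
    thus "(1::ennreal) \<le> ennreal ((2 * pi) ^ CARD('n))" by (metis ennreal_1 ennreal_leI)
  qed simp
  also note L2_sq_le_fourier_L2[OF uT]
  also note L
  also have "2 * ennreal ((32 * ?J + 4 * ?K) * T powr (- ?p) * ?I\<^sup>2) = ennreal (2 * ((32 * ?J + 4 * ?K) * T powr (- ?p) * ?I\<^sup>2))"
    using nn by (subst ennreal_mult) auto
  finally have "(L2_norm (u T))\<^sup>2 \<le> 2 * ((32 * ?J + 4 * ?K) * T powr (- ?p) * ?I\<^sup>2)"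
    unfolding L2_norm_sq[OF uT] mult_1 using nn by (subst (asm) ennreal_le_iff) auto
  thus ?thesis by (simp only: mult.assoc)
qed

theorem theorem5p1:
  fixes l :: real
  assumes "CARD('n::finite) \<ge> 7"
    and "2 \<le> l" and "l < real CARD('n) / 2 - 1"
  shows "\<exists>C>0. \<forall>(u0 :: real ^ 'n \<Rightarrow> complex) u1 u.
           u0 \<in> Hs (l + 1) \<inter> L11 \<longrightarrow> u1 \<in> Hs l \<inter> L11 \<longrightarrow>
           u \<in> X2 \<longrightarrow> solves_cauchy u0 u1 u \<longrightarrow>
           (\<forall>t\<ge>1. L2_norm (u t)
              \<le> C * (Hs_norm l u1 + Hs_norm (l + 1) u0 + L11_norm u1 + L11_norm u0)
                  * t powr (- (l + 1) / 2))"
proof -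
  define M where "M = 2 * (32 * (LINT \<xi>::real^'n|lborel. exp (- (norm \<xi>)\<^sup>2 / 8)) + 4 * (4 * (l + 1)) powr (l + 1))"
  have "0 \<le> (LINT \<xi>::real^'n|lborel. exp (- (norm \<xi>)\<^sup>2 / 8))" by (intro integral_nonneg_AE) auto
  moreover have "0 < (4 * (l + 1)) powr (l + 1)" using assms by simp
  ultimately have M: "M > 0" unfolding M_def by (simp add: add_nonneg_pos)
  show ?thesis
  proof (intro exI[of _ "sqrt M"] conjI allI impI)
    show "sqrt M > 0" using M by simp
    fix u0 u1 :: "real^'n \<Rightarrow> complex" and u t
    assume u0: "u0 \<in> Hs (l + 1) \<inter> L11" and u1: "u1 \<in> Hs l \<inter> L11"
      and sol: "solves_cauchy u0 u1 u" and t: "1 \<le> (t::real)"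
    let ?I = "Hs_norm l u1 + Hs_norm (l + 1) u0 + L11_norm u1 + L11_norm u0"
    from sol obtain v w where vw: "weak_solution u v w"
      and init: "AE x in lborel. u 0 x = u0 x" "AE x in lborel. v 0 x = u1 x"
      unfolding solves_cauchy_def weak_solution_def by blast
    have "(L2_norm (u t))\<^sup>2 \<le> M * t powr (- (l + 1)) * ?I\<^sup>2"
      unfolding M_def using weak_solution.L2_decay[OF vw _ _ t u0 u1 init] assms by simp
    also have "\<dots> = (sqrt M * ?I * t powr (- (l + 1) / 2))\<^sup>2"
    proof -
      have "(t powr (- (l + 1) / 2))\<^sup>2 = t powr (- (l + 1))"
        using t by (simp add: power2_eq_square flip: powr_add)
      thus ?thesis using M by (simp add: power_mult_distrib)
    qed
    finally show "L2_norm (u t) \<le> sqrt M * ?I * t powr (- (l + 1) / 2)"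
    proof (rule power2_le_imp_le)
      have "0 \<le> ?I" using u0 u1
        by (auto intro!: add_nonneg_nonneg L11_dominates integral_nonneg_AE simp: Hs_norm_def)
      thus "0 \<le> sqrt M * ?I * t powr (- (l + 1) / 2)" using M by simp
    qed
  qed
qed

end
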